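(* Let $G_0,G_1\in M_n(\mathbb{R})$ be two kernels of $1$-permanental vectors and let $\{G_\alpha:\alpha\in[0,1]\}$ be an interpolation between them such that for every $\alpha\in[0,1]$, $G_\alpha$ is an inverse M-matrix with a positive definite symmetric part, and such that for all $i,j\in[n]$ the map $\alpha\mapsto G_{\alpha,ij}$ is of class $C^1([0,1])$ with $\frac{d}{d\alpha}G_{\alpha,ij}$ having a constant sign. Let $\{\ell_\alpha:\alpha\in[0,1]\}$ be the corresponding $1$-permanental vectors (with kernels $G_\alpha$). Let $f:\mathbb{R}_+^n\to\mathbb{R}$ be any function with subexponential growth for $k\le2$ orders of partial derivatives, such that for any $i\in[n]$ either of the following is true: 1. $\frac{d}{d\alpha}G_{\alpha,ii}\ge0$ for all $\alpha\in[0,1]$, and $\partial_if(l)+l_i\,\partial_{ii}f(l)\ge0$ for all $l\in\mathbb{R}_+^n$; 2. $\frac{d}{d\alpha}G_{\alpha,ii}\le0$ for all $\alpha\in[0,1]$, and $\partial_if(l)+l_i\,\partial_{ii}f(l)\le0$ for all $l\in\mathbb{R}_+^n$; and for any $i\ne j$ either of the following is true: 1. $\frac{d}{d\alpha}G_{\alpha,ij}\ge0$ for all $\alpha\in[0,1]$, and $\partial_{ij}f(l)\ge0$ for all $l\in\mathbb{R}_+^n$; 2. $\frac{d}{d\alpha}G_{\alpha,ij}\le0$ for all $\alpha\in[0,1]$, and $\partial_{ij}f(l)\le0$ for all $l\in\mathbb{R}_+^n$. Then $\mathbb{E}[f(\ell_1)]\ge\mathbb{E}[f(\ell_0)]$.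
   Context: $M_n(\mathbb{R})$ is the set of real $n\times n$ matrices; $[n]=\{1,\dots,n\}$, $\mathbb{R}_+=[0,\infty)$, $|A|$ is the determinant of $A$; the symmetric part of $A$ is $\frac12(A+A^T)$. The interpolation has endpoints $G_0$ at $\alpha=0$ and $G_1$ at $\alpha=1$. A random vector $\ell\in\mathbb{R}_+^n$ is a $1$-permanental vector with kernel $G\in M_n(\mathbb{R})$ if for every $\lambda\in\mathbb{R}_+^n$, $\mathbb{E}[e^{-\langle\lambda,\ell\rangle}]=|I+\Lambda G|^{-1}$, where $\Lambda=\mathrm{diag}(\lambda_1,\dots,\lambda_n)$. An M-matrix is a real matrix of the form $sI-B$ with $B$ entrywise nonnegative and $s\ge\rho(B)$, $\rho$ the spectral radius. An inverse M-matrix is the inverse of an invertible M-matrix. A function $g:\mathbb{R}_+^n\to\mathbb{R}$ has subexponential growth if $\lim_{\|l\|\to\infty}\frac{\log(1+|g(l)|)}{\|l\|}=0$. A function $f$ has subexponential growth for $k\le2$ orders of partial derivatives if $f$ has subexponential growth and all partial derivatives $\partial_if=\frac{\partial f}{\partial l_i}$ and $\partial_{ij}f=\frac{\partial^2f}{\partial l_i\partial l_j}$, $i,j\in[n]$, exist and have subexponential growth. *)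

theory Defs
  imports "HOL-Probability.Probability"
begin

definition nonneg_orthant :: "(real ^ 'n) set" where
  "nonneg_orthant = {l. \<forall>i. 0 \<le> l $ i}"

definition diag_matrix :: "real ^ 'n \<Rightarrow> real ^ 'n ^ 'n" where
  "diag_matrix v = (\<chi> i j. if i = j then v $ i else 0)"

text \<open>The values are required to lie in the orthant everywhere, not just almost surely:
  test functions are only meaningful on the orthant.\<close>

definition one_permanental_vector ::
  "'w measure \<Rightarrow> real ^ 'n ^ 'n \<Rightarrow> ('w \<Rightarrow> real ^ 'n) \<Rightarrow> bool" where
  "one_permanental_vector M G X \<longleftrightarrow>
     prob_space M \<and> X \<in> borel_measurable M \<and> (\<forall>\<omega>\<in>space M. X \<omega> \<in> nonneg_orthant) \<and>
     (\<forall>v\<in>nonneg_orthant.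
        (\<integral>\<omega>. exp (- (v \<bullet> X \<omega>)) \<partial>M) = inverse (det (mat 1 + diag_matrix v ** G)))"

text \<open>Eigenvalues of a real matrix are taken over the complex numbers.\<close>

definition complex_eigenvalues :: "real ^ 'n ^ 'n \<Rightarrow> complex set" where
  "complex_eigenvalues A =
     {z. \<exists>v::complex ^ 'n. v \<noteq> 0 \<and> map_matrix complex_of_real A *v v = z *s v}"

definition spec_radius :: "real ^ 'n ^ 'n \<Rightarrow> real" where
  "spec_radius A = Max (cmod ` complex_eigenvalues A)"

definition M_matrix :: "real ^ 'n ^ 'n \<Rightarrow> bool" where
  "M_matrix A \<longleftrightarrow>
     (\<exists>s B. A = mat s - B \<and> (\<forall>i j. 0 \<le> B $ i $ j) \<and> spec_radius B \<le> s)"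

definition inverse_M_matrix :: "real ^ 'n ^ 'n \<Rightarrow> bool" where
  "inverse_M_matrix G \<longleftrightarrow> (\<exists>A. M_matrix A \<and> invertible A \<and> G = matrix_inv A)"

definition sym_part :: "real ^ 'n ^ 'n \<Rightarrow> real ^ 'n ^ 'n" where
  "sym_part A = (1 / 2) *\<^sub>R (A + transpose A)"

definition pos_definite :: "real ^ 'n ^ 'n \<Rightarrow> bool" where
  "pos_definite S \<longleftrightarrow> transpose S = S \<and> (\<forall>x. x \<noteq> 0 \<longrightarrow> 0 < x \<bullet> (S *v x))"

text \<open>Partial derivatives of a function on the orthant depend only on its values there;
  they are one-sided at points whose coordinate in the direction of differentiation is 0.\<close>

definition has_partial_derivative ::
  "(real ^ 'n \<Rightarrow> real) \<Rightarrow> 'n \<Rightarrow> real \<Rightarrow> real ^ 'n \<Rightarrow> bool" where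
  "has_partial_derivative f i D l \<longleftrightarrow>
     ((\<lambda>t. f (l + t *\<^sub>R axis i 1)) has_real_derivative D)
       (at 0 within {t. l + t *\<^sub>R axis i 1 \<in> nonneg_orthant})"

definition partial_derivative :: "'n \<Rightarrow> (real ^ 'n \<Rightarrow> real) \<Rightarrow> real ^ 'n \<Rightarrow> real" where
  "partial_derivative i f l = (THE D. has_partial_derivative f i D l)"

definition partially_differentiable :: "'n \<Rightarrow> (real ^ 'n \<Rightarrow> real) \<Rightarrow> bool" where
  "partially_differentiable i f \<longleftrightarrow>
     (\<forall>l\<in>nonneg_orthant. \<exists>D. has_partial_derivative f i D l)"

text \<open>The order of differentiation is that of \<open>\<partial>\<^sup>2f / \<partial>l\<^sub>i\<partial>l\<^sub>j = \<partial>\<^sub>i(\<partial>\<^sub>jf)\<close>.\<close>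

definition partial_derivative2 ::
  "'n \<Rightarrow> 'n \<Rightarrow> (real ^ 'n \<Rightarrow> real) \<Rightarrow> real ^ 'n \<Rightarrow> real" where
  "partial_derivative2 i j f = partial_derivative i (partial_derivative j f)"

definition subexponential_growth :: "(real ^ 'n \<Rightarrow> real) \<Rightarrow> bool" where
  "subexponential_growth g \<longleftrightarrow>
     ((\<lambda>l. ln (1 + \<bar>g l\<bar>) / norm l) \<longlongrightarrow> 0) (inf at_infinity (principal nonneg_orthant))"

definition subexponential_growth_order2 :: "(real ^ 'n \<Rightarrow> real) \<Rightarrow> bool" where
  "subexponential_growth_order2 f \<longleftrightarrow>
     subexponential_growth f \<and>
     (\<forall>i. partially_differentiable i f \<and> subexponential_growth (partial_derivative i f)) \<and>
     (\<forall>i j. partially_differentiable i (partial_derivative j f) \<and>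
            subexponential_growth (partial_derivative2 i j f))"

end

(*
Write A for the inverse of G, Q = 1 - A / s with s large (an entrywise nonnegative matrix), and
y_i = s / (s + v_i). Then 1 / det (1 + diag v G) is a constant times (prod y_i) / det (1 - diag y Q),
which by Cramer's rule and Neumann series is a power series in y with nonnegative coefficients. As
y^(k+1) is the Laplace transform of a product of Gamma distributions, the permanental vector is a
mixture of such products, and everything reduces to the means F(k) of f under them.

Along the interpolation, the derivative of 1 / det (1 + diag v G) is a sum over (i, j) of G'_ij times
series with nonnegative coefficients in the second differences of k |-> y^(k+1): the mixed difference
for i <> j, and a discrete version of d_i + l_i d_ii for i = j. Integrated over the interpolation,
this expresses E f(X_1) - E f(X_0) through second differences of F if f is an exponential, and then
for general f by approximation (Stone-Weierstrass in exp (-l)) in a weighted norm. The sign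
conditions on the derivatives of f pass to the second differences of F.

Continuity of f is not part of the hypotheses, but the diagonal condition makes f monotone in each
coordinate, and a separately continuous function with this property is jointly continuous. Apart from
this, f enters only through its finite increments and the monotone functions l_i d_i f, so that second
derivatives never have to be integrated.
*)
theory Submission
  imports Defs
begin

section \<open>Determinants and inverses\<close>

text \<open>The series in y are needed beyond the unit cube that the y_i fill. Under the Gamma
  product with shapes k_i + 1, the mean of exp (\<epsilon> sum l_i) is (s / (s - \<epsilon>))^(|k| +
  n), that is, R^(|k| + n) for \<epsilon> = s (1 - 1 / R). So convergence at y = (R, ..., R) with R
  > 1 is what bounds all functionals in the norm with weight exp (\<epsilon> sum l_i) and gives the
  permanental vectors exponential moments. As f is bounded for every positive weight, a smaller one
  leaves room for the approximation. The parameter is integrated out, so s, R and all bounds must be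
  uniform in it.

  The diagonal terms set the form of the series. Their second difference has factors k_i, so a
  series for 1 / det alone does not suffice. Let W = 1 / det (1 - diag y Q) and let N be the Neumann
  series of diag y Q. Both W and N_ii W are explicit in y_i, and N_ii W is the derivative of y_i W
  in y_i. The same coefficients thus serve both, with an extra factor k_i + 1.\<close>

definition replace_row :: "real ^ 'n ^ 'm \<Rightarrow> 'm \<Rightarrow> real ^ 'n \<Rightarrow> real ^ 'n ^ 'm" where
  "replace_row A i r = (\<chi> a. if a = i then r else A $ a)"

lemma replace_row_nth [simp]: "replace_row A i r $ a = (if a = i then r else A $ a)"
  by (simp add: replace_row_def)

lemma matrix_add_rdistrib: "((A + B) ** C) = (A ** C) + (B ** (C :: real ^ 'n ^ 'm))"
  by (vector matrix_matrix_mult_def sum.distrib[symmetric] field_simps)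

text \<open>Cramer's rule, transposed so that a row is replaced instead of a column:
  \<open>y $ i = 0\<close> makes row \<open>i\<close> of \<open>mat 1 - diag_matrix y ** Q\<close> a
  unit vector, so that the right side becomes a determinant of the same kind.\<close>

lemma left_inverse_entry:
  fixes V M :: "real ^ 'n ^ 'n"
  assumes "V ** M = mat 1"
  shows "V $ j $ i * det M = det (replace_row M i (axis j 1))"
proof -
  have "transpose M ** transpose V = mat 1"
    using assms by (metis matrix_transpose_mul transpose_mat)
  then have *: "transpose M *v column j (transpose V) = axis j 1"
    by (simp add: matrix_vector_mult_def matrix_matrix_mult_def column_def mat_def axis_def vec_eq_iff)
  have "det (\<chi> a b. if b = i then (transpose M *v column j (transpose V)) $ a else transpose M $ a $ b)
    = column j (transpose V) $ i * det (transpose M)"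
    by (rule cramer_lemma)
  moreover have "(\<chi> a b. if b = i then (transpose M *v column j (transpose V)) $ a else transpose M $ a $ b)
    = transpose (replace_row M i (axis j 1))"
    unfolding * by (simp add: transpose_def vec_eq_iff)
  ultimately show ?thesis
    by (simp add: column_def transpose_def[of V])
qed

text \<open>Jacobi's formula, by the Leibniz expansion and the product rule. The cofactors are
  determinants with a row replaced by a unit vector, the form in which
  \<open>left_inverse_entry\<close> recognises them as entries of the inverse.\<close>

lemma det_has_real_derivative:
  fixes M :: "real \<Rightarrow> real ^ 'n ^ 'n"
  assumes "\<And>i j. ((\<lambda>t. M t $ i $ j) has_real_derivative M' $ i $ j) (at x within S)"
  shows "((\<lambda>t. det (M t)) has_real_derivative
    (\<Sum>i\<in>UNIV. \<Sum>j\<in>UNIV. M' $ i $ j * det (replace_row (M x) i (axis j 1)))) (at x within S)"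
proof -
  define P where "P = {p. p permutes (UNIV :: 'n set)}"
  have P: "finite P"
    unfolding P_def by (simp add: finite_permutations)
  \<comment> \<open>Only the permutations with \<open>p i = j\<close> survive when row
    \<open>i\<close> is \<open>axis j 1\<close>, and every permutation has exactly one such
    \<open>j\<close>.\<close>
  have row: "(\<Sum>j\<in>UNIV. M' $ i $ j * det (replace_row (M x) i (axis j 1)))
      = (\<Sum>p\<in>P. of_int (sign p) * (M' $ i $ p i * (\<Prod>a\<in>UNIV - {i}. M x $ a $ p a)))" for i
  proof -
    have "det (replace_row (M x) i (axis j 1))
        = (\<Sum>p\<in>P. of_int (sign p) * ((if p i = j then 1 else 0) * (\<Prod>a\<in>UNIV - {i}. M x $ a $ p a)))" for j
      unfolding det_def P_def
      by (rule sum.cong[OF refl], subst prod.remove[of UNIV i])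
        (auto simp: axis_def intro!: prod.cong)
    then have "(\<Sum>j\<in>UNIV. M' $ i $ j * det (replace_row (M x) i (axis j 1)))
        = (\<Sum>j\<in>UNIV. \<Sum>p\<in>P. (if p i = j then of_int (sign p) * (M' $ i $ j * (\<Prod>a\<in>UNIV - {i}. M x $ a $ p a)) else 0))"
      by (auto simp: sum_distrib_left intro!: sum.cong)
    also have "\<dots> = (\<Sum>p\<in>P. \<Sum>j\<in>UNIV. (if p i = j then of_int (sign p) * (M' $ i $ j * (\<Prod>a\<in>UNIV - {i}. M x $ a $ p a)) else 0))"
      by (rule sum.swap)
    finally show ?thesis by simp
  qed
  have prod: "((\<lambda>t. \<Prod>i\<in>UNIV. M t $ i $ p i) has_real_derivative
     (\<Sum>i\<in>UNIV. M' $ i $ p i * (\<Prod>a\<in>UNIV - {i}. M x $ a $ p a))) (at x within S)" for p :: "'n \<Rightarrow> 'n"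
  proof -
    have "((\<lambda>t. \<Prod>i\<in>UNIV. M t $ i $ p i) has_derivative
        (\<lambda>y. \<Sum>i\<in>UNIV. (M' $ i $ p i * y) * (\<Prod>a\<in>UNIV - {i}. M x $ a $ p a))) (at x within S)"
      by (rule has_derivative_prod) (use assms in \<open>simp add: has_field_derivative_def\<close>)
    then show ?thesis
      unfolding has_field_derivative_def sum_distrib_right by (simp only: mult_ac)
  qed
  have "((\<lambda>t. \<Sum>p\<in>P. of_int (sign p) * (\<Prod>i\<in>UNIV. M t $ i $ p i)) has_real_derivative
     (\<Sum>p\<in>P. of_int (sign p) * (\<Sum>i\<in>UNIV. M' $ i $ p i * (\<Prod>a\<in>UNIV - {i}. M x $ a $ p a)))) (at x within S)"
    by (intro DERIV_sum DERIV_cmult prod)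
  moreover have "(\<Sum>p\<in>P. of_int (sign p) * (\<Sum>i\<in>UNIV. M' $ i $ p i * (\<Prod>a\<in>UNIV - {i}. M x $ a $ p a)))
     = (\<Sum>i\<in>UNIV. \<Sum>j\<in>UNIV. M' $ i $ j * det (replace_row (M x) i (axis j 1)))"
    unfolding row by (subst sum.swap) (simp add: sum_distrib_left)
  ultimately show ?thesis
    by (simp add: det_def P_def)
qed

lemma continuous_on_det:
  fixes M :: "'a::topological_space \<Rightarrow> real ^ 'n ^ 'n"
  assumes "\<And>i j. continuous_on S (\<lambda>t. M t $ i $ j)"
  shows "continuous_on S (\<lambda>t. det (M t))"
  unfolding det_def by (intro continuous_intros assms)

lemma continuous_on_left_inverse:
  fixes V M :: "'a::topological_space \<Rightarrow> real ^ 'n ^ 'n"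
  assumes "\<And>i j. continuous_on S (\<lambda>t. M t $ i $ j)" and "\<And>t. t \<in> S \<Longrightarrow> V t ** M t = mat 1"
  shows "continuous_on S (\<lambda>t. V t $ j $ i)"
proof -
  have det: "det (M t) \<noteq> 0" if "t \<in> S" for t
    using assms(2)[OF that] by (metis invertible_det_nz invertible_left_inverse)
  have "continuous_on S (\<lambda>t. replace_row (M t) i (axis j 1) $ a $ b)" for a b
    using assms(1) by (cases "a = i") auto
  then have "continuous_on S (\<lambda>t. det (replace_row (M t) i (axis j 1)))"
    by (rule continuous_on_det)
  then have "continuous_on S (\<lambda>t. det (replace_row (M t) i (axis j 1)) / det (M t))"
    using det by (intro continuous_on_divide continuous_on_det[of S M] assms(1)) auto
  then show ?thesis
  proof (rule continuous_on_eq)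
    fix t assume t: "t \<in> S"
    show "det (replace_row (M t) i (axis j 1)) / det (M t) = V t $ j $ i"
      using left_inverse_entry[OF assms(2)[OF t], of j i] det[OF t] by (metis nonzero_mult_div_cancel_right)
  qed
qed

section \<open>Matrices with nonnegative inverse\<close>

lemma Z_matrix_inverse_nonneg:
  fixes A :: "real ^ 'n ^ 'n"
  assumes Z: "\<And>i j. i \<noteq> j \<Longrightarrow> A $ i $ j \<le> 0"
    and pos: "\<And>x. x \<noteq> 0 \<Longrightarrow> 0 < x \<bullet> (A *v x)"
    and v: "\<And>i. 0 \<le> (A *v v) $ i"
  shows "0 \<le> v $ i"
proof -
  \<comment> \<open>Test \<open>A v \<ge> 0\<close> against the negative part of \<open>v\<close>.\<close>
  define m where "m = (\<chi> i. max 0 (- v $ i))"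
  define p where "p = (\<chi> i. max 0 (v $ i))"
  have vpm: "v = p - m"
    by (auto simp: vec_eq_iff p_def m_def max_def)
  have "0 \<le> m \<bullet> (A *v v)"
    unfolding inner_vec_def by (intro sum_nonneg) (auto simp: m_def v)
  moreover have "m \<bullet> (A *v p) \<le> 0"
    unfolding inner_vec_def matrix_vector_mult_def
  proof (simp add: sum_distrib_left, intro sum_nonpos)
    fix i j
    show "m $ i * (A $ i $ j * p $ j) \<le> 0"
      using Z[of i j] by (cases "i = j") (auto simp: m_def p_def max_def mult_nonneg_nonpos mult_nonpos_nonneg mult_nonneg_nonneg zero_le_mult_iff mult_le_0_iff)
  qed
  moreover have "m \<bullet> (A *v v) = m \<bullet> (A *v p) - m \<bullet> (A *v m)"
    by (simp add: vpm matrix_vector_mult_diff_distrib inner_diff_right)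
  ultimately have "m = 0"
    using pos[of m] by force
  then show ?thesis
    by (auto simp: m_def vec_eq_iff max_def split: if_splits) (metis le_minus_iff neg_0_le_iff_le nle_le)
qed

lemma inner_sym_part: "x \<bullet> (sym_part G *v x) = x \<bullet> (G *v x)"
proof -
  have "x \<bullet> (transpose G *v x) = x \<bullet> (G *v x)"
    by (metis dot_lmul_matrix inner_commute transpose_matrix_vector)
  then show ?thesis
    by (simp add: sym_part_def scaleR_matrix_vector_assoc[symmetric] matrix_vector_mult_add_rdistrib inner_add_right)
qed

text \<open>Definiteness passes from \<open>G\<close> to its inverse \<open>A\<close> because x = G
  y gives x . A x and y . G y the same value; the off-diagonal signs of \<open>A\<close> are those
  of - B. Column \<open>j\<close> of \<open>G\<close> then solves \<open>A *v v = axis j 1\<close>,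
  and \<open>Z_matrix_inverse_nonneg\<close> applies.\<close>

lemma inverse_M_matrix_inverse_nonneg:
  fixes G :: "real ^ 'n ^ 'n"
  assumes G: "inverse_M_matrix G" and pd: "pos_definite (sym_part G)"
  obtains A where "A ** G = mat 1" "\<And>i j. i \<noteq> j \<Longrightarrow> A $ i $ j \<le> 0"
    "\<And>i j. 0 \<le> G $ i $ j"
proof -
  obtain A where A: "M_matrix A" "invertible A" "G = matrix_inv A"
    using G unfolding inverse_M_matrix_def by auto
  have "A ** matrix_inv A = mat 1 \<and> matrix_inv A ** A = mat 1"
    unfolding matrix_inv_def by (rule someI_ex) (use A(2) in \<open>simp add: invertible_def\<close>)
  then have AG: "A ** G = mat 1" "G ** A = mat 1"
    using A(3) by auto
  obtain s B where sB: "A = mat s - B" "\<And>i j. 0 \<le> B $ i $ j"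
    using A(1) unfolding M_matrix_def by auto
  have Z: "A $ i $ j \<le> 0" if "i \<noteq> j" for i j
    using that sB by (simp add: mat_def)
  have pos: "0 < x \<bullet> (A *v x)" if "x \<noteq> 0" for x
  proof -
    define y where "y = A *v x"
    have x: "x = G *v y"
      by (simp add: y_def matrix_vector_mul_assoc AG)
    then have "y \<noteq> 0"
      using that by auto
    then have "0 < y \<bullet> (G *v y)"
      using pd unfolding pos_definite_def by (metis inner_sym_part)
    moreover have "x \<bullet> (A *v x) = (G *v y) \<bullet> y"
      by (simp only: x[symmetric] y_def[symmetric])
    ultimately show ?thesis
      by (simp add: inner_commute)
  qed
  have "0 \<le> G $ i $ j" for i j
  proof -
    have col: "A *v column j G = axis j 1"
      using AG(1) by (simp add: matrix_vector_mult_def matrix_matrix_mult_def column_def mat_def axis_def vec_eq_iff)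
    have "0 \<le> (A *v column j G) $ i" for i
      unfolding col by (simp add: axis_def)
    then have "0 \<le> column j G $ i"
      using Z pos Z_matrix_inverse_nonneg[of A "column j G" i] by blast
    then show ?thesis
      by (simp add: column_def)
  qed
  with AG Z show ?thesis
    using that by blast
qed

section \<open>Neumann series\<close>

primrec matpow :: "real ^ 'n ^ 'n \<Rightarrow> nat \<Rightarrow> real ^ 'n ^ 'n" where
  "matpow B 0 = mat 1"
| "matpow B (Suc p) = B ** matpow B p"

definition neumann :: "real ^ 'n ^ 'n \<Rightarrow> real ^ 'n ^ 'n" where
  "neumann B = (\<chi> i j. \<Sum>p. matpow B p $ i $ j)"

lemma matpow_nonneg:
  assumes "\<And>i j. 0 \<le> B $ i $ j"
  shows "0 \<le> matpow B p $ i $ j"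
  by (induction p arbitrary: i j)
    (auto simp: mat_def matrix_matrix_mult_def intro!: sum_nonneg mult_nonneg_nonneg assms)

lemma matpow_mult_vec_le:
  fixes B :: "real ^ 'n ^ 'n"
  assumes B: "\<And>i j. 0 \<le> B $ i $ j" and x: "\<And>i. (B *v x) $ i \<le> \<rho> * x $ i" and "0 \<le> \<rho>"
  shows "(matpow B p *v x) $ i \<le> \<rho> ^ p * x $ i"
proof (induction p arbitrary: i)
  case (Suc p)
  have "(matpow B (Suc p) *v x) $ i = (\<Sum>j\<in>UNIV. B $ i $ j * (matpow B p *v x) $ j)"
    by (simp add: matrix_vector_mul_assoc[symmetric] matrix_vector_mult_def[of B])
  also have "\<dots> \<le> (\<Sum>j\<in>UNIV. B $ i $ j * (\<rho> ^ p * x $ j))"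
    by (intro sum_mono mult_left_mono Suc B)
  also have "\<dots> = \<rho> ^ p * (B *v x) $ i"
    by (simp add: matrix_vector_mult_def sum_distrib_left mult_ac)
  also have "\<dots> \<le> \<rho> ^ p * (\<rho> * x $ i)"
    using x[of i] \<open>0 \<le> \<rho>\<close> by (intro mult_left_mono) auto
  finally show ?case by (simp add: mult_ac)
qed simp

text \<open>A positive \<open>x\<close> that \<open>B\<close> contracts by \<open>\<rho> < 1\<close>
  replaces a matrix norm: one term of a row of \<open>matpow B p *v x\<close> is at most the whole
  row, so that entry (i, j) of the power is at most
  \<open>\<rho> ^ p * (x $ i / x $ j)\<close>.\<close>

lemma summable_matpow:
  fixes B :: "real ^ 'n ^ 'n"
  assumes B: "\<And>i j. 0 \<le> B $ i $ j" and x: "\<And>i. (B *v x) $ i \<le> \<rho> * x $ i"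
    and \<rho>: "0 \<le> \<rho>" "\<rho> < 1" and pos: "\<And>i. 0 < x $ i"
  shows "summable (\<lambda>p. matpow B p $ i $ j)"
proof (rule summable_comparison_test')
  show "summable (\<lambda>p. \<rho> ^ p * (x $ i / x $ j))"
    using \<rho> by (intro summable_mult2 summable_geometric) auto
  fix p :: nat
  have "matpow B p $ i $ j * x $ j \<le> (matpow B p *v x) $ i"
    unfolding matrix_vector_mult_def
    using member_le_sum[of j UNIV "\<lambda>j. matpow B p $ i $ j * x $ j"] matpow_nonneg[OF B] pos
    by (auto simp: less_imp_le)
  also have "\<dots> \<le> \<rho> ^ p * x $ i"
    by (rule matpow_mult_vec_le[OF B x \<rho>(1)])
  finally show "norm (matpow B p $ i $ j) \<le> \<rho> ^ p * (x $ i / x $ j)"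
    using pos[of j] matpow_nonneg[OF B, of p i j] by (simp add: field_simps)
qed

lemma neumann_nonneg:
  assumes "\<And>i j. 0 \<le> B $ i $ j" and "\<And>i j. summable (\<lambda>p. matpow B p $ i $ j)"
  shows "0 \<le> neumann B $ i $ j"
  unfolding neumann_def by (simp add: suminf_nonneg assms(2) matpow_nonneg assms(1))

lemma neumann_unfold:
  fixes B :: "real ^ 'n ^ 'n"
  assumes s: "\<And>i j. summable (\<lambda>p. matpow B p $ i $ j)"
  shows "neumann B = mat 1 + B ** neumann B"
proof -
  have "neumann B $ i $ j = (mat 1 + B ** neumann B) $ i $ j" for i j
  proof -
    have "neumann B $ i $ j = (\<Sum>p. matpow B (Suc p) $ i $ j) + mat 1 $ i $ j"
      using suminf_split_head[OF s[of i j]] by (simp add: neumann_def)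
    also have "(\<Sum>p. matpow B (Suc p) $ i $ j) = (\<Sum>p. \<Sum>l\<in>UNIV. B $ i $ l * matpow B p $ l $ j)"
      by (simp add: matrix_matrix_mult_def)
    also have "\<dots> = (\<Sum>l\<in>UNIV. \<Sum>p. B $ i $ l * matpow B p $ l $ j)"
      by (intro suminf_sum summable_mult s)
    also have "\<dots> = (B ** neumann B) $ i $ j"
      by (simp add: matrix_matrix_mult_def neumann_def suminf_mult[OF s])
    finally show ?thesis by simp
  qed
  then show ?thesis by (simp add: vec_eq_iff)
qed

lemma neumann_inverse:
  fixes B :: "real ^ 'n ^ 'n"
  assumes s: "\<And>i j. summable (\<lambda>p. matpow B p $ i $ j)"
  shows "(mat 1 - B) ** neumann B = mat 1" "neumann B ** (mat 1 - B) = mat 1"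
proof -
  have "(mat 1 - B) ** neumann B + B ** neumann B = mat 1 ** neumann B"
    by (subst matrix_add_rdistrib[symmetric]) simp
  then show *: "(mat 1 - B) ** neumann B = mat 1"
    using neumann_unfold[OF s] by (metis add_right_cancel matrix_mul_lid)
  show "neumann B ** (mat 1 - B) = mat 1"
    using * matrix_left_right_inverse by blast
qed

section \<open>Power series with nonnegative coefficients\<close>

definition mon :: "('n \<Rightarrow> nat) \<Rightarrow> real ^ 'n \<Rightarrow> real" where
  "mon \<kappa> y = (\<Prod>i\<in>UNIV. y $ i ^ \<kappa> i)"

definition cube :: "real \<Rightarrow> (real ^ 'n) set" where
  "cube R = {y. \<forall>i. 0 \<le> y $ i \<and> y $ i \<le> R}"

text \<open>Setting coordinates to 0 turns the corresponding rows of
  \<open>mat 1 - diag_matrix y ** Q\<close> into unit vectors; determinants are reduced one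
  coordinate at a time in this way.\<close>

definition restrict_vec :: "'n set \<Rightarrow> real ^ 'n \<Rightarrow> real ^ 'n" where
  "restrict_vec S y = (\<chi> i. if i \<in> S then y $ i else 0)"

text \<open>Coefficients in \<open>ennreal\<close> allow sums and products of series without
  convergence conditions; finiteness is settled later by evaluation at a single point. The exponents
  \<open>\<kappa> n\<close> may repeat, so that no terms ever have to be collected, and do not
  depend on the parameter \<open>t\<close>, so that the coefficients can be integrated over
  it.\<close>

definition nonneg_series :: "'a measure \<Rightarrow> (real ^ 'n) set \<Rightarrow> ('a \<Rightarrow> real ^ 'n \<Rightarrow> ennreal) \<Rightarrow> bool" where
  "nonneg_series A D \<phi> \<longleftrightarrow> (\<exists>a \<kappa>. (\<forall>n::nat. a n \<in> borel_measurable A) \<and>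
     (\<forall>t\<in>space A. \<forall>y\<in>D. \<phi> t y = (\<Sum>n. a n t * ennreal (mon (\<kappa> n) y))))"

lemma mon_nonneg: "y \<in> cube R \<Longrightarrow> 0 \<le> mon \<kappa> y"
  by (auto simp: mon_def cube_def intro!: prod_nonneg)

lemma mon_add: "mon (\<lambda>i. \<kappa> i + \<mu> i) y = mon \<kappa> y * mon \<mu> y"
  by (simp add: mon_def power_add prod.distrib)

lemma mon_0 [simp]: "mon (\<lambda>_. 0) y = 1"
  by (simp add: mon_def)

lemma mon_upd: "mon (\<kappa>(i := p)) y = y $ i ^ p * (\<Prod>j\<in>UNIV - {i}. y $ j ^ \<kappa> j)"
  unfolding mon_def by (subst prod.remove[of UNIV i]) (auto intro!: prod.cong)

lemma mon_remove: "mon \<kappa> y = y $ i ^ \<kappa> i * (\<Prod>j\<in>UNIV - {i}. y $ j ^ \<kappa> j)"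
  unfolding mon_def by (subst prod.remove[of UNIV i]) auto

lemma mon_restrict_vec: "mon \<kappa> (restrict_vec S y) = (if \<forall>i. i \<notin> S \<longrightarrow> \<kappa> i = 0 then mon \<kappa> y else 0)"
proof (cases "\<forall>i. i \<notin> S \<longrightarrow> \<kappa> i = 0")
  case True
  then show ?thesis
    by (auto simp: mon_def restrict_vec_def intro!: prod.cong)
next
  case False
  then obtain i where "i \<notin> S" "\<kappa> i \<noteq> 0" by auto
  then have "mon \<kappa> (restrict_vec S y) = 0"
    by (subst mon_remove[of _ _ i]) (simp add: restrict_vec_def)
  then show ?thesis
    using False by auto
qed

lemma restrict_vec_cube: "0 \<le> R \<Longrightarrow> y \<in> cube R \<Longrightarrow> restrict_vec S y \<in> cube R"
  by (auto simp: cube_def restrict_vec_def)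

lemma nonneg_series_cong:
  assumes "nonneg_series A D \<phi>" "\<And>t y. t \<in> space A \<Longrightarrow> y \<in> D \<Longrightarrow> \<psi> t y = \<phi> t y"
  shows "nonneg_series A D \<psi>"
proof -
  obtain a \<kappa> where *: "\<And>n::nat. a n \<in> borel_measurable A"
      "\<And>t y. t \<in> space A \<Longrightarrow> y \<in> D \<Longrightarrow> \<phi> t y = (\<Sum>n. a n t * ennreal (mon (\<kappa> n) y))"
    using assms(1) unfolding nonneg_series_def by blast
  show ?thesis
    unfolding nonneg_series_def
    by (rule exI[of _ a], rule exI[of _ \<kappa>]) (simp add: assms(2) *)
qed

lemma nonneg_series_mon:
  assumes "c \<in> borel_measurable A"
  shows "nonneg_series A D (\<lambda>t y. c t * ennreal (mon \<kappa> y))"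
  unfolding nonneg_series_def
proof (intro exI conjI allI ballI)
  show "(\<lambda>t. if n = 0 then c t else 0) \<in> borel_measurable A" for n :: nat
    using assms by (cases "n = 0") auto
  fix t y
  show "c t * ennreal (mon \<kappa> y) = (\<Sum>n::nat. (if n = 0 then c t else 0) * ennreal (mon \<kappa> y))"
    by (subst suminf_finite[of "{0}"]) auto
qed

lemma nonneg_series_const:
  assumes "c \<in> borel_measurable A"
  shows "nonneg_series A D (\<lambda>t y. c t)"
  using nonneg_series_mon[OF assms, of D "\<lambda>_. 0"] by simp

lemma nonneg_series_coord: "nonneg_series A D (\<lambda>t y. ennreal (y $ i))"
proof (rule nonneg_series_cong[OF nonneg_series_mon])
  show "(\<lambda>_. 1) \<in> borel_measurable A" by simp
  fix t y
  have "mon ((\<lambda>_. 0)(i := 1)) y = y $ i"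
    by (subst mon_upd) simp
  then show "ennreal (y $ i) = 1 * ennreal (mon ((\<lambda>_. 0)(i := 1)) y)"
    by simp
qed

lemma nonneg_series_suminf:
  fixes \<phi> :: "nat \<Rightarrow> 'a \<Rightarrow> real ^ 'n \<Rightarrow> ennreal"
  assumes "\<And>p. nonneg_series A D (\<phi> p)"
  shows "nonneg_series A D (\<lambda>t y. \<Sum>p. \<phi> p t y)"
proof -
  have "\<forall>p. \<exists>a \<kappa>. (\<forall>n::nat. a n \<in> borel_measurable A) \<and>
     (\<forall>t\<in>space A. \<forall>y\<in>D. \<phi> p t y = (\<Sum>n. a n t * ennreal (mon (\<kappa> n) y)))"
    using assms unfolding nonneg_series_def by blast
  then obtain a :: "nat \<Rightarrow> nat \<Rightarrow> 'a \<Rightarrow> ennreal" and \<kappa> :: "nat \<Rightarrow> nat \<Rightarrow> 'n \<Rightarrow> nat"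
    where a: "\<And>p n. a p n \<in> borel_measurable A"
      "\<And>p t y. t \<in> space A \<Longrightarrow> y \<in> D \<Longrightarrow> \<phi> p t y = (\<Sum>n. a p n t * ennreal (mon (\<kappa> p n) y))"
    by metis
  show ?thesis
    unfolding nonneg_series_def
  proof (intro exI conjI allI ballI)
    show "(\<lambda>(p, n). a p n) (prod_decode m) \<in> borel_measurable A" for m
      by (simp add: a split: prod.split)
    fix t and y :: "real ^ 'n" assume "t \<in> space A" "y \<in> D"
    then have "(\<Sum>m. (\<lambda>(p, n). a p n t * ennreal (mon (\<kappa> p n) y)) (prod_decode m)) = (\<Sum>p. \<phi> p t y)"
      by (intro suminf_ennreal_2dimen) (simp add: a)
    then show "(\<Sum>p. \<phi> p t y) = (\<Sum>m. (\<lambda>(p, n). a p n) (prod_decode m) t *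
        ennreal (mon ((\<lambda>(p, n). \<kappa> p n) (prod_decode m)) y))"
      by (simp add: case_prod_beta)
  qed
qed

lemma nonneg_series_add:
  assumes "nonneg_series A D \<phi>" "nonneg_series A D \<psi>"
  shows "nonneg_series A D (\<lambda>t y. \<phi> t y + \<psi> t y)"
proof (rule nonneg_series_cong[OF nonneg_series_suminf])
  let ?f = "\<lambda>p::nat. if p = 0 then \<phi> else if p = 1 then \<psi> else (\<lambda>_ _. 0)"
  show "nonneg_series A D (?f p)" for p
    using assms nonneg_series_const[of "\<lambda>_. 0" A D] by auto
  show "\<phi> t y + \<psi> t y = (\<Sum>p. ?f p t y)" for t y
    by (subst suminf_finite[of "{0, 1}"]) auto
qed

lemma nonneg_series_sum:
  assumes "finite I" "\<And>i. i \<in> I \<Longrightarrow> nonneg_series A D (\<phi> i)"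
  shows "nonneg_series A D (\<lambda>t y. \<Sum>i\<in>I. \<phi> i t y)"
  using assms by (induction I) (auto intro: nonneg_series_add nonneg_series_const)

text \<open>Cauchy product, left as a double series. The inclusion
  \<open>D \<subseteq> cube R\<close> keeps the monomials nonnegative, where \<open>ennreal\<close>
  is multiplicative.\<close>

lemma nonneg_series_mult:
  assumes "nonneg_series A D \<phi>" "nonneg_series A D \<psi>" and D: "D \<subseteq> cube R"
  shows "nonneg_series A D (\<lambda>t y. \<phi> t y * \<psi> t y)"
proof -
  obtain a :: "nat \<Rightarrow> 'a \<Rightarrow> ennreal" and \<kappa> where a: "\<And>n. a n \<in> borel_measurable A"
      "\<And>t y. t \<in> space A \<Longrightarrow> y \<in> D \<Longrightarrow> \<phi> t y = (\<Sum>n. a n t * ennreal (mon (\<kappa> n) y))"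
    using assms(1) unfolding nonneg_series_def by blast
  obtain b :: "nat \<Rightarrow> 'a \<Rightarrow> ennreal" and \<mu> where b: "\<And>n. b n \<in> borel_measurable A"
      "\<And>t y. t \<in> space A \<Longrightarrow> y \<in> D \<Longrightarrow> \<psi> t y = (\<Sum>n. b n t * ennreal (mon (\<mu> n) y))"
    using assms(2) unfolding nonneg_series_def by blast
  have "nonneg_series A D (\<lambda>t y. \<Sum>m. \<Sum>n. (a m t * b n t) * ennreal (mon (\<lambda>i. \<kappa> m i + \<mu> n i) y))"
    using a b by (intro nonneg_series_suminf nonneg_series_mon) auto
  then show ?thesis
  proof (rule nonneg_series_cong)
    fix t y assume y: "t \<in> space A" "y \<in> D"
    then have "mon (\<lambda>i. \<kappa> m i + \<mu> n i) y = mon (\<kappa> m) y * mon (\<mu> n) y" "0 \<le> mon (\<kappa> m) y" "0 \<le> mon (\<mu> n) y" for m n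
      using D mon_nonneg by (auto simp: mon_add)
    then have "(a m t * b n t) * ennreal (mon (\<lambda>i. \<kappa> m i + \<mu> n i) y)
        = (a m t * ennreal (mon (\<kappa> m) y)) * (b n t * ennreal (mon (\<mu> n) y))" for m n
      by (simp add: ennreal_mult mult_ac)
    then show "\<phi> t y * \<psi> t y = (\<Sum>m. \<Sum>n. (a m t * b n t) * ennreal (mon (\<lambda>i. \<kappa> m i + \<mu> n i) y))"
      by (simp add: a(2)[OF y] b(2)[OF y])
  qed
qed

lemma nonneg_series_power:
  assumes "nonneg_series A D \<phi>" and D: "D \<subseteq> cube R"
  shows "nonneg_series A D (\<lambda>t y. \<phi> t y ^ p)"
  by (induction p) (auto intro: nonneg_series_mult[OF _ _ D] assms nonneg_series_const)

lemma nonneg_series_restrict_vec: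
  fixes \<phi> :: "'a \<Rightarrow> real ^ 'n \<Rightarrow> ennreal"
  assumes "nonneg_series A (cube R) \<phi>" "0 \<le> R"
  shows "nonneg_series A (cube R) (\<lambda>t y. \<phi> t (restrict_vec S y))"
proof -
  obtain a :: "nat \<Rightarrow> 'a \<Rightarrow> ennreal" and \<kappa> where a: "\<And>n. a n \<in> borel_measurable A"
      "\<And>t y. t \<in> space A \<Longrightarrow> y \<in> cube R \<Longrightarrow> \<phi> t y = (\<Sum>n. a n t * ennreal (mon (\<kappa> n) y))"
    using assms(1) unfolding nonneg_series_def by blast
  show ?thesis
    unfolding nonneg_series_def
  proof (intro exI conjI allI ballI)
    show "(\<lambda>t. if \<forall>i. i \<notin> S \<longrightarrow> \<kappa> n i = 0 then a n t else 0) \<in> borel_measurable A" for n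
      using a(1)[of n] by (cases "\<forall>i. i \<notin> S \<longrightarrow> \<kappa> n i = 0") auto
    fix t and y :: "real ^ 'n" assume "t \<in> space A" "y \<in> cube R"
    then show "\<phi> t (restrict_vec S y)
        = (\<Sum>n. (if \<forall>i. i \<notin> S \<longrightarrow> \<kappa> n i = 0 then a n t else 0) * ennreal (mon (\<kappa> n) y))"
      using assms(2) by (auto simp: a(2) restrict_vec_cube mon_restrict_vec intro!: suminf_cong)
  qed
qed

text \<open>For \<open>u\<close> and \<open>\<rho>\<close> independent of \<open>y\<^sub>i\<close>, the exponents of \<open>y\<^sub>i\<close> in \<open>u / (1 - y\<^sub>i \<rho>)\<close> are
  visible, which gives \<open>u / (1 - y\<^sub>i \<rho>)\<^sup>2\<close> by weighting the coefficients.\<close>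

lemma nonneg_series_geometric:
  fixes u \<rho> :: "'a \<Rightarrow> real ^ 'n \<Rightarrow> ennreal"
  assumes u: "nonneg_series A (cube R) u" and \<rho>: "nonneg_series A (cube R) \<rho>" and R: "0 \<le> R"
  obtains a :: "nat \<Rightarrow> 'a \<Rightarrow> ennreal" and \<kappa> :: "nat \<Rightarrow> 'n \<Rightarrow> nat"
  where "\<And>n. a n \<in> borel_measurable A"
    "\<And>w t y. t \<in> space A \<Longrightarrow> y \<in> cube R \<Longrightarrow> 
      (\<Sum>n. a n t * w (\<kappa> n i) * ennreal (mon (\<kappa> n) y))
      = (\<Sum>p. u t (restrict_vec (- {i}) y) * \<rho> t (restrict_vec (- {i}) y) ^ p * w p * ennreal (y $ i ^ p))"
proof -
  define f where "f p t y = u t y * \<rho> t y ^ p" for p t y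
  have "nonneg_series A (cube R) (f p)" for p
    unfolding f_def by (intro nonneg_series_mult[of _ _ _ _ R] nonneg_series_power[of _ _ _ R] u \<rho>) auto
  then have "\<forall>p. \<exists>a \<kappa>. (\<forall>n::nat. a n \<in> borel_measurable A) \<and>
     (\<forall>t\<in>space A. \<forall>y\<in>cube R. f p t y = (\<Sum>n. a n t * ennreal (mon (\<kappa> n) y)))"
    unfolding nonneg_series_def by blast
  then obtain a :: "nat \<Rightarrow> nat \<Rightarrow> 'a \<Rightarrow> ennreal" and \<kappa> :: "nat \<Rightarrow> nat \<Rightarrow> 'n \<Rightarrow> nat"
    where a: "\<And>p n. a p n \<in> borel_measurable A"
      "\<And>p t y. t \<in> space A \<Longrightarrow> y \<in> cube R \<Longrightarrow> f p t y = (\<Sum>n. a p n t * ennreal (mon (\<kappa> p n) y))"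
    by metis
  \<comment> \<open>Terms that contain \<open>y $ i\<close> are dropped, which evaluates
    \<open>f p\<close> at \<open>restrict_vec (- {i}) y\<close>; the exponent of
    \<open>y $ i\<close> can then be set to \<open>p\<close> itself.\<close>
  define b where "b p n t = (if \<kappa> p n i = 0 then a p n t else 0)" for p n t
  define \<mu> where "\<mu> p n = (\<kappa> p n)(i := p)" for p n
  show thesis
  proof (rule that[of "\<lambda>m t. b (fst (prod_decode m)) (snd (prod_decode m)) t"
        "\<lambda>m. \<mu> (fst (prod_decode m)) (snd (prod_decode m))"])
    show "b p n \<in> borel_measurable A" for p n
      unfolding b_def[abs_def] using a(1)[of p n] by (cases "\<kappa> p n i = 0") auto
    fix w :: "nat \<Rightarrow> ennreal" and t and y :: "real ^ 'n" assume t: "t \<in> space A" and y: "y \<in> cube R"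
    define z where "z = restrict_vec (- {i}) y"
    have z: "z \<in> cube R"
      using y R by (simp add: z_def restrict_vec_cube)
    have "mon (\<kappa> p n) z = (if \<kappa> p n i = 0 then mon (\<kappa> p n) y else 0)" for p n
      by (simp add: z_def mon_restrict_vec)
    then have "b p n t * ennreal (mon (\<mu> p n) y) = a p n t * ennreal (mon (\<kappa> p n) z) * ennreal (y $ i ^ p)" for p n
      using y by (auto simp: b_def \<mu>_def mon_upd mon_remove[of "\<kappa> p n" y i] cube_def ennreal_mult prod_nonneg mult_ac)
    then have "b p n t * w (\<mu> p n i) * ennreal (mon (\<mu> p n) y)
        = a p n t * ennreal (mon (\<kappa> p n) z) * (w p * ennreal (y $ i ^ p))" for p n
      by (simp add: \<mu>_def mult_ac)
    moreover have "(\<Sum>m. (\<lambda>(p, n). b p n t * w (\<mu> p n i) * ennreal (mon (\<mu> p n) y)) (prod_decode m))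
        = (\<Sum>p. \<Sum>n. b p n t * w (\<mu> p n i) * ennreal (mon (\<mu> p n) y))"
      by (rule suminf_ennreal_2dimen) simp
    ultimately have "(\<Sum>m. (\<lambda>(p, n). b p n t * w (\<mu> p n i) * ennreal (mon (\<mu> p n) y)) (prod_decode m))
        = (\<Sum>p. f p t z * (w p * ennreal (y $ i ^ p)))"
      by (simp add: a(2)[OF t z] ennreal_suminf_multc)
    then show "(\<Sum>m. b (fst (prod_decode m)) (snd (prod_decode m)) t * w (\<mu> (fst (prod_decode m)) (snd (prod_decode m)) i) *
            ennreal (mon (\<mu> (fst (prod_decode m)) (snd (prod_decode m))) y))
      = (\<Sum>p. u t (restrict_vec (- {i}) y) * \<rho> t (restrict_vec (- {i}) y) ^ p * w p * ennreal (y $ i ^ p))"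
      by (simp add: f_def z_def case_prod_beta mult.assoc)
  qed
qed

section \<open>Neumann series and inverse determinants of a measurable family of nonnegative
  matrices\<close>

lemma diag_mult_nth [simp]: "(diag_matrix y ** Q) $ i $ j = y $ i * Q $ i $ j"
  by (simp add: diag_matrix_def matrix_matrix_mult_def if_distrib[of "\<lambda>a. a * _"] cong: if_cong)

lemma nonneg_series_matpow:
  fixes Q :: "'a \<Rightarrow> real ^ 'n ^ 'n"
  assumes Q: "\<And>i j. (\<lambda>t. Q t $ i $ j) \<in> borel_measurable A"
    and nn: "\<And>t i j. t \<in> space A \<Longrightarrow> 0 \<le> Q t $ i $ j"
  shows "nonneg_series A (cube R) (\<lambda>t y. ennreal (matpow (diag_matrix y ** Q t) p $ i $ j))"
proof (induction p arbitrary: i j)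
  case 0
  then show ?case
    by (auto simp: mat_def intro!: nonneg_series_const)
next
  case (Suc p)
  have "nonneg_series A (cube R) (\<lambda>t y. \<Sum>l\<in>UNIV. ennreal (y $ i) * ennreal (Q t $ i $ l) *
      ennreal (matpow (diag_matrix y ** Q t) p $ l $ j))"
    by (intro nonneg_series_sum nonneg_series_mult[of _ _ _ _ R] nonneg_series_coord nonneg_series_const Suc
        measurable_compose[OF Q measurable_ennreal]) auto
  then show ?case
  proof (rule nonneg_series_cong)
    fix t and y :: "real ^ 'n" assume "t \<in> space A" "y \<in> cube R"
    then have "0 \<le> y $ i" "0 \<le> Q t $ a $ b" "0 \<le> matpow (diag_matrix y ** Q t) p $ a $ b" for a b
      using nn by (auto simp: cube_def intro!: matpow_nonneg)
    then show "ennreal (matpow (diag_matrix y ** Q t) (Suc p) $ i $ j)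
      = (\<Sum>l\<in>UNIV. ennreal (y $ i) * ennreal (Q t $ i $ l) * ennreal (matpow (diag_matrix y ** Q t) p $ l $ j))"
      by (simp add: matrix_matrix_mult_def[of "diag_matrix y ** Q t"] ennreal_mult' sum_ennreal
          sum_ennreal[symmetric] del: sum_ennreal)
  qed
qed

locale matrix_family =
  fixes A :: "'a measure" and Q :: "'a \<Rightarrow> real ^ 'n ^ 'n" and R :: real
  assumes Q_meas: "\<And>i j. (\<lambda>t. Q t $ i $ j) \<in> borel_measurable A"
    and Q_nonneg: "\<And>t i j. t \<in> space A \<Longrightarrow> 0 \<le> Q t $ i $ j"
    and R_nonneg: "0 \<le> R"
    and summable_matpow_cube:
      "\<And>t y i j. t \<in> space A \<Longrightarrow> y \<in> cube R \<Longrightarrow> summable (\<lambda>p. matpow (diag_matrix y ** Q t) p $ i $ j)"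
begin

abbreviation pencil :: "'a \<Rightarrow> real ^ 'n \<Rightarrow> real ^ 'n ^ 'n" where
  "pencil t y \<equiv> mat 1 - diag_matrix y ** Q t"

definition N :: "'a \<Rightarrow> real ^ 'n \<Rightarrow> real ^ 'n ^ 'n" where
  "N t y = neumann (diag_matrix y ** Q t)"

definition W :: "'a \<Rightarrow> real ^ 'n \<Rightarrow> real" where
  "W t y = inverse (det (pencil t y))"

lemma N_nonneg: "t \<in> space A \<Longrightarrow> y \<in> cube R \<Longrightarrow> 0 \<le> N t y $ i $ j"
  unfolding N_def using Q_nonneg
  by (intro neumann_nonneg summable_matpow_cube) (auto simp: cube_def)

lemma N_inverse:
  assumes "t \<in> space A" "y \<in> cube R"
  shows "(pencil t y) ** N t y = mat 1" "N t y ** (pencil t y) = mat 1"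
  using neumann_inverse summable_matpow_cube[OF assms] unfolding N_def by blast+

lemma N_unfold:
  assumes "t \<in> space A" "y \<in> cube R"
  shows "N t y $ i $ j = mat 1 $ i $ j + y $ i * (Q t ** N t y) $ i $ j"
proof -
  have "N t y = mat 1 + diag_matrix y ** (Q t ** N t y)"
    using neumann_unfold[OF summable_matpow_cube[OF assms]] unfolding N_def by (simp add: matrix_mul_assoc)
  then show ?thesis
    by (metis diag_mult_nth vector_add_component)
qed

lemma N_diag_ge_1: "t \<in> space A \<Longrightarrow> y \<in> cube R \<Longrightarrow> 1 \<le> N t y $ i $ i"
  using Q_nonneg N_nonneg
  by (subst N_unfold) (auto simp: mat_def matrix_matrix_mult_def cube_def intro!: mult_nonneg_nonneg sum_nonneg)

lemma nonneg_series_N: "nonneg_series A (cube R) (\<lambda>t y. ennreal (N t y $ i $ j))"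
proof (rule nonneg_series_cong[OF nonneg_series_suminf])
  show "nonneg_series A (cube R) (\<lambda>t y. ennreal (matpow (diag_matrix y ** Q t) p $ i $ j))" for p
    by (intro nonneg_series_matpow Q_meas Q_nonneg)
  fix t and y :: "real ^ 'n" assume *: "t \<in> space A" "y \<in> cube R"
  then have "0 \<le> matpow (diag_matrix y ** Q t) p $ i $ j" for p
    using Q_nonneg by (intro matpow_nonneg) (auto simp: cube_def)
  then show "ennreal (N t y $ i $ j) = (\<Sum>p. ennreal (matpow (diag_matrix y ** Q t) p $ i $ j))"
    using suminf_ennreal2 summable_matpow_cube[OF *] by (simp add: N_def neumann_def)
qed

text \<open>Cramer's rule. Iterated over the coordinates, it writes the inverse determinant as a product
  of diagonal entries of Neumann series.\<close>

lemma det_restrict_vec: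
  assumes "t \<in> space A" "y \<in> cube R"
  shows "N t y $ i $ i * det (pencil t y)
    = det (pencil t (restrict_vec (- {i}) y))"
proof -
  have "replace_row (pencil t y) i (axis i 1)
      = pencil t (restrict_vec (- {i}) y)"
    by (auto simp: vec_eq_iff mat_def axis_def restrict_vec_def)
  then show ?thesis
    using left_inverse_entry[OF N_inverse(2)[OF assms], of i i] by simp
qed

text \<open>Adding \<open>i\<close> to \<open>S\<close> multiplies \<open>W\<close> by a diagonal
  entry of \<open>N\<close>, which is at least 1 and has a nonnegative series. Positivity is carried
  along in the induction because \<open>W\<close> is the inverse of the determinant; for
  \<open>S = {}\<close> the pencil is the identity.\<close>

lemma det_pos_nonneg_series_W:
  "(\<forall>t\<in>space A. \<forall>y\<in>cube R. 0 < det (pencil t (restrict_vec S y))) \<and>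
    nonneg_series A (cube R) (\<lambda>t y. ennreal (W t (restrict_vec S y)))"
proof (induction S rule: finite_induct[OF finite])
  case 1
  have "pencil t (restrict_vec {} y) = mat 1" for t and y :: "real ^ 'n"
    by (simp add: vec_eq_iff restrict_vec_def)
  then show ?case
    by (auto simp: W_def intro!: nonneg_series_const)
next
  case (2 i S)
  define z where "z y = restrict_vec (insert i S) y" for y :: "real ^ 'n"
  have zc: "z y \<in> cube R" if "y \<in> cube R" for y
    using that R_nonneg by (simp add: z_def restrict_vec_cube)
  have "restrict_vec (- {i}) (z y) = restrict_vec S y" for y
    using 2(2) by (auto simp: z_def restrict_vec_def vec_eq_iff)
  then have *: "N t (z y) $ i $ i * det (pencil t (z y))
      = det (pencil t (restrict_vec S y))" if "t \<in> space A" "y \<in> cube R" for t y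
    using det_restrict_vec[OF that(1) zc[OF that(2)], of i] by simp
  have pos: "0 < det (pencil t (z y))" if "t \<in> space A" "y \<in> cube R" for t y
    using *[OF that] 2(3) N_diag_ge_1[OF that(1) zc[OF that(2)], of i] that
    by (metis less_le_trans zero_less_mult_pos zero_less_one)
  have "nonneg_series A (cube R) (\<lambda>t y. ennreal (N t (z y) $ i $ i) * ennreal (W t (restrict_vec S y)))"
    unfolding z_def
    by (intro nonneg_series_mult[of _ _ _ _ R] nonneg_series_restrict_vec[OF nonneg_series_N] R_nonneg)
      (use 2 in auto)
  then have "nonneg_series A (cube R) (\<lambda>t y. ennreal (W t (z y)))"
  proof (rule nonneg_series_cong)
    fix t and y :: "real ^ 'n" assume a: "t \<in> space A" "y \<in> cube R"
    have "W t (z y) = N t (z y) $ i $ i * W t (restrict_vec S y)"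
      using pos[OF a] N_diag_ge_1[OF a(1) zc[OF a(2)], of i]
      unfolding W_def *[OF a, symmetric] by (simp add: field_simps)
    then show "ennreal (W t (z y)) = ennreal (N t (z y) $ i $ i) * ennreal (W t (restrict_vec S y))"
      using N_nonneg[OF a(1) zc[OF a(2)]] by (simp add: ennreal_mult')
  qed
  then show ?case
    using pos by (auto simp: z_def)
qed

lemma restrict_vec_UNIV [simp]: "restrict_vec UNIV y = y"
  by (simp add: restrict_vec_def vec_eq_iff)

lemma det_pos: "t \<in> space A \<Longrightarrow> y \<in> cube R \<Longrightarrow> 0 < det (pencil t y)"
  using det_pos_nonneg_series_W[of UNIV] by simp

lemma W_pos: "t \<in> space A \<Longrightarrow> y \<in> cube R \<Longrightarrow> 0 < W t y"
  using det_pos by (simp add: W_def)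

lemma nonneg_series_W: "nonneg_series A (cube R) (\<lambda>t y. ennreal (W t y))"
  using det_pos_nonneg_series_W[of UNIV] by simp

lemma QN_nonneg: "t \<in> space A \<Longrightarrow> y \<in> cube R \<Longrightarrow> 0 \<le> (Q t ** N t y) $ i $ j"
  using Q_nonneg N_nonneg by (auto simp: matrix_matrix_mult_def intro!: sum_nonneg mult_nonneg_nonneg)

lemma nonneg_series_QN: "nonneg_series A (cube R) (\<lambda>t y. ennreal ((Q t ** N t y) $ i $ j))"
proof (rule nonneg_series_cong)
  show "nonneg_series A (cube R) (\<lambda>t y. \<Sum>l\<in>UNIV. ennreal (Q t $ i $ l) * ennreal (N t y $ l $ j))"
    by (intro nonneg_series_sum nonneg_series_mult[of _ _ _ _ R] nonneg_series_const nonneg_series_N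
        measurable_compose[OF Q_meas measurable_ennreal]) auto
  fix t and y :: "real ^ 'n" assume a: "t \<in> space A" "y \<in> cube R"
  show "ennreal ((Q t ** N t y) $ i $ j) = (\<Sum>l\<in>UNIV. ennreal (Q t $ i $ l) * ennreal (N t y $ l $ j))"
    using Q_nonneg[OF a(1)] N_nonneg[OF a]
    by (simp add: matrix_matrix_mult_def ennreal_mult' sum_ennreal[symmetric] del: sum_ennreal)
qed

lemma nonneg_series_QN_W: "nonneg_series A (cube R) (\<lambda>t y. ennreal ((Q t ** N t y) $ i $ j * W t y))"
proof (rule nonneg_series_cong[OF nonneg_series_mult[OF nonneg_series_QN nonneg_series_W]])
  fix t and y :: "real ^ 'n" assume a: "t \<in> space A" "y \<in> cube R"
  show "ennreal ((Q t ** N t y) $ i $ j * W t y) = ennreal ((Q t ** N t y) $ i $ j) * ennreal (W t y)"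
    using QN_nonneg[OF a] by (simp add: ennreal_mult')
qed auto

text \<open>First-return decomposition: with \<open>z\<close> the vector \<open>y\<close> after setting \<open>y\<^sub>i = 0\<close>, the resolvent
  identity reads \<open>N\<^sub>i\<^sub>i(y) = 1 / (1 - y\<^sub>i (Q N(z))\<^sub>i\<^sub>i)\<close>.\<close>

lemma N_diag_return:
  fixes y :: "real ^ 'n" and i :: 'n
  assumes a: "t \<in> space A" and y: "y \<in> cube R"
  defines "z \<equiv> restrict_vec (- {i}) y"
  shows "N t y $ i $ i * (1 - y $ i * (Q t ** N t z) $ i $ i) = 1"
proof -
  have z: "z \<in> cube R"
    using y R_nonneg by (simp add: z_def restrict_vec_cube)
  define r where "r = (Q t ** N t z) $ i $ i"
  have "N t y = N t y ** ((pencil t z) ** N t z)"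
    by (simp add: N_inverse(1)[OF a z])
  also have "pencil t z = (pencil t y) + diag_matrix (y - z) ** Q t"
    by (simp add: vec_eq_iff algebra_simps)
  also have "N t y ** (((pencil t y) + diag_matrix (y - z) ** Q t) ** N t z)
      = (N t y ** (pencil t y)) ** N t z + N t y ** (diag_matrix (y - z) ** (Q t ** N t z))"
    by (simp add: matrix_add_rdistrib matrix_add_ldistrib matrix_mul_assoc)
  also have "\<dots> = N t z + N t y ** (diag_matrix (y - z) ** (Q t ** N t z))"
    by (simp add: N_inverse(2)[OF a y])
  finally have "N t y $ i $ i = N t z $ i $ i + (N t y ** (diag_matrix (y - z) ** (Q t ** N t z))) $ i $ i"
    by (metis vector_add_component)
  \<comment> \<open>Row \<open>i\<close> of \<open>diag_matrix z ** Q t\<close> is zero.\<close>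
  also have "N t z $ i $ i = 1"
    using N_unfold[OF a z, of i i] by (simp add: z_def restrict_vec_def mat_def)
  also have "(N t y ** (diag_matrix (y - z) ** (Q t ** N t z))) $ i $ i
      = (\<Sum>l\<in>UNIV. N t y $ i $ l * ((y - z) $ l * (Q t ** N t z) $ l $ i))"
    by (subst matrix_matrix_mult_def) (simp del: vector_minus_component)
  also have "\<dots> = (\<Sum>l\<in>UNIV. if l = i then N t y $ i $ i * (y $ i * r) else 0)"
    by (rule sum.cong) (auto simp: z_def restrict_vec_def r_def)
  also have "\<dots> = N t y $ i $ i * (y $ i * r)"
    by simp
  finally have "N t y $ i $ i = 1 + N t y $ i $ i * (y $ i * r)" .
  then show ?thesis
    unfolding r_def right_diff_distrib by linarith
qed

text \<open>With x = y_i r, where u and r are free of y_i, the two functions are u / (1 - x) and u /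
  (1 - x)^2. The second is the derivative of y_i W in y_i, so its coefficients are those of W times
  k_i + 1.\<close>

lemma nonneg_series_W_weighted:
  obtains a :: "nat \<Rightarrow> 'a \<Rightarrow> ennreal" and \<kappa> :: "nat \<Rightarrow> 'n \<Rightarrow> nat"
  where "\<And>n. a n \<in> borel_measurable A"
    "\<And>t y. t \<in> space A \<Longrightarrow> y \<in> cube R \<Longrightarrow>
      ennreal (W t y) = (\<Sum>n. a n t * ennreal (mon (\<kappa> n) y))"
    "\<And>t y. t \<in> space A \<Longrightarrow> y \<in> cube R \<Longrightarrow>
      ennreal (N t y $ i $ i * W t y) = (\<Sum>n. a n t * ennreal (real (Suc (\<kappa> n i)) * mon (\<kappa> n) y))"
proof (rule nonneg_series_geometric[OF nonneg_series_W nonneg_series_QN[of i i] R_nonneg, where i = i])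
  fix a :: "nat \<Rightarrow> 'a \<Rightarrow> ennreal" and \<kappa> :: "nat \<Rightarrow> 'n \<Rightarrow> nat"
  assume meas: "\<And>n. a n \<in> borel_measurable A"
  assume eq: "\<And>w t y. t \<in> space A \<Longrightarrow> y \<in> cube R \<Longrightarrow> 
      (\<Sum>n. a n t * w (\<kappa> n i) * ennreal (mon (\<kappa> n) y))
      = (\<Sum>p. ennreal (W t (restrict_vec (- {i}) y)) *
          ennreal ((Q t ** N t (restrict_vec (- {i}) y)) $ i $ i) ^ p * w p * ennreal (y $ i ^ p))"
  have main: "ennreal (W t y) = (\<Sum>n. a n t * ennreal (mon (\<kappa> n) y)) \<and>
      ennreal (N t y $ i $ i * W t y) = (\<Sum>n. a n t * ennreal (real (Suc (\<kappa> n i)) * mon (\<kappa> n) y))"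
    if al: "t \<in> space A" and y: "y \<in> cube R" for t y
  proof -
    define z where "z = restrict_vec (- {i}) y"
    have z: "z \<in> cube R"
      using y R_nonneg by (simp add: z_def restrict_vec_cube)
    define u where "u = W t z"
    define r where "r = (Q t ** N t z) $ i $ i"
    define x where "x = y $ i * r"
    have u: "0 < u" and r: "0 \<le> r" and yi: "0 \<le> y $ i"
      using W_pos[OF al z] QN_nonneg[OF al z] y by (auto simp: u_def r_def cube_def)
    have Nx: "N t y $ i $ i * (1 - x) = 1"
      using N_diag_return[OF al y, of i] by (simp add: x_def r_def z_def)
    then have x1: "x < 1"
      using N_diag_ge_1[OF al y, of i] by (smt (verit) zero_less_mult_iff)
    have x0: "0 \<le> x"
      using r yi by (simp add: x_def)
    have N: "N t y $ i $ i = 1 / (1 - x)"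
      using Nx x1 by (simp add: field_simps)
    have "W t y = u * N t y $ i $ i"
      using det_pos[OF al y] N_diag_ge_1[OF al y, of i]
      unfolding W_def u_def z_def det_restrict_vec[OF al y, of i, symmetric] by (simp add: field_simps)
    then have Wy: "W t y = u * (1 / (1 - x))"
      by (simp add: N)
    have s1: "(\<lambda>p. u * r ^ p * y $ i ^ p) sums (u * (1 / (1 - x)))"
      using sums_mult[OF geometric_sums[of x], of u] x0 x1 by (simp add: x_def power_mult_distrib mult_ac)
    have s2: "(\<lambda>p. u * r ^ p * real (Suc p) * y $ i ^ p) sums (u * (1 / (1 - x)^2))"
      using sums_mult[OF geometric_deriv_sums[of x], of u] x0 x1 by (simp add: x_def power_mult_distrib mult_ac)
    have tm: "ennreal u * ennreal r ^ p * ennreal c * ennreal (y $ i ^ p) = ennreal (u * r ^ p * c * y $ i ^ p)"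
      if "0 \<le> c" for p c
      using u r yi that by (simp add: ennreal_mult ennreal_power)
    have "(\<Sum>n. a n t * ennreal 1 * ennreal (mon (\<kappa> n) y)) = (\<Sum>p. ennreal (u * r ^ p * 1 * y $ i ^ p))"
      using eq[OF al y, of "\<lambda>_. ennreal 1"] by (simp only: tm z_def[symmetric] u_def[symmetric] r_def[symmetric] zero_le_one)
    also have "\<dots> = ennreal (u * (1 / (1 - x)))"
      using s1 u r yi by (intro suminf_ennreal_eq) auto
    finally have 1: "ennreal (W t y) = (\<Sum>n. a n t * ennreal (mon (\<kappa> n) y))"
      by (simp add: Wy)
    have "(\<Sum>n. a n t * ennreal (real (Suc (\<kappa> n i))) * ennreal (mon (\<kappa> n) y))
        = (\<Sum>p. ennreal (u * r ^ p * real (Suc p) * y $ i ^ p))"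
      using eq[OF al y, of "\<lambda>p. ennreal (real (Suc p))"]
      by (simp only: tm z_def[symmetric] u_def[symmetric] r_def[symmetric] of_nat_0_le_iff)
    also have "\<dots> = ennreal (u * (1 / (1 - x)^2))"
      using s2 u r yi by (intro suminf_ennreal_eq) auto
    also have "u * (1 / (1 - x)^2) = N t y $ i $ i * W t y"
      by (simp add: Wy N power2_eq_square)
    finally have 2: "(\<Sum>n. a n t * ennreal (real (Suc (\<kappa> n i))) * ennreal (mon (\<kappa> n) y))
      = ennreal (N t y $ i $ i * W t y)" .
    have "a n t * ennreal (real (Suc (\<kappa> n i))) * ennreal (mon (\<kappa> n) y)
        = a n t * ennreal (real (Suc (\<kappa> n i)) * mon (\<kappa> n) y)" for n
      by (subst ennreal_mult') (auto simp: mult.assoc)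
    then show ?thesis
      using 1 2 by simp
  qed
  show thesis
    using that[of a \<kappa>] meas main by blast
qed

end

section \<open>Expectations under products of Gamma distributions\<close>

abbreviation coord_sum :: "real ^ 'n \<Rightarrow> real" where
  "coord_sum l \<equiv> \<Sum>i\<in>UNIV. l $ i"

abbreviation multideg :: "('n::finite \<Rightarrow> nat) \<Rightarrow> nat" where
  "multideg k \<equiv> \<Sum>i\<in>UNIV. k i"

abbreviation lborel_prod :: "('n::finite \<Rightarrow> real) measure" where
  "lborel_prod \<equiv> \<Pi>\<^sub>M i\<in>UNIV. lborel"

text \<open>A bound \<open>c\<close> in the norm with weight exp (\<epsilon> sum l_i). As a relation
  it carries the constant along and spares a normed space; continuity provides both measurability
  and approximation by polynomials.\<close>

definition wbounded :: "real \<Rightarrow> real \<Rightarrow> (real ^ 'n \<Rightarrow> real) \<Rightarrow> bool" where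
  "wbounded \<epsilon> c f \<longleftrightarrow> continuous_on nonneg_orthant f \<and>
     (\<forall>l\<in>nonneg_orthant. \<bar>f l\<bar> \<le> c * exp (\<epsilon> * coord_sum l))"

definition posvec :: "('n \<Rightarrow> real) \<Rightarrow> real ^ 'n" where
  "posvec x = (\<chi> i. max 0 (x i))"

definition update :: "real ^ 'n \<Rightarrow> 'n \<Rightarrow> real \<Rightarrow> real ^ 'n" where
  "update l i t = (\<chi> j. if j = i then t else l $ j)"

text \<open>\<open>erlang_density m\<close> has shape m + 1, hence the exponents
  \<open>Suc (k i)\<close> in all transforms and the extra power \<open>CARD('n)\<close> in the
  bounds.\<close>

definition gamma_density :: "real \<Rightarrow> ('n \<Rightarrow> nat) \<Rightarrow> ('n \<Rightarrow> real) \<Rightarrow> real" where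
  "gamma_density s k x = (\<Prod>i\<in>UNIV. erlang_density (k i) s (x i))"

text \<open>The densities vanish outside the orthant; the positive part makes sure that only values of
  \<open>f\<close> on the orthant enter.\<close>

definition gamma_mean :: "real \<Rightarrow> (real ^ 'n \<Rightarrow> real) \<Rightarrow> ('n::finite \<Rightarrow> nat) \<Rightarrow> real" where
  "gamma_mean s f k = (\<integral>x. gamma_density s k x * f (posvec x) \<partial>lborel_prod)"

text \<open>On means under Gamma distributions, these differences correspond to \<open>\<partial>\<^sub>i\<^sub>jf\<close> for \<open>i \<noteq> j\<close>
  and to \<open>\<partial>\<^sub>if + l\<^sub>i \<partial>\<^sub>i\<^sub>if\<close> for \<open>i = j\<close>. For \<open>k\<^sub>i = 0\<close>, the truncated \<open>k\<^sub>i - 1\<close> has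
  coefficient 0.\<close>

definition second_diff :: "'n \<Rightarrow> 'n \<Rightarrow> (('n \<Rightarrow> nat) \<Rightarrow> real) \<Rightarrow> ('n \<Rightarrow> nat) \<Rightarrow> real" where
  "second_diff i j F k =
     (if i = j then real (Suc (k i)) * (F (k(i := Suc (k i))) - F k) - real (k i) * (F k - F (k(i := k i - 1)))
      else F (k(i := Suc (k i), j := Suc (k j))) - F (k(i := Suc (k i))) - F (k(j := Suc (k j))) + F k)"

section \<open>Measurability, Laplace transforms and weighted bounds\<close>

lemma posvec_in_orthant [simp]: "posvec x \<in> nonneg_orthant"
  by (simp add: posvec_def nonneg_orthant_def)

lemma update_nth [simp]: "update l i t $ j = (if j = i then t else l $ j)"
  by (simp add: update_def)

lemma update_in_orthant: "l \<in> nonneg_orthant \<Longrightarrow> 0 \<le> t \<Longrightarrow> update l i t \<in> nonneg_orthant"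
  by (simp add: nonneg_orthant_def)

lemma posvec_upd: "posvec (x(i := t)) = update (posvec x) i (max 0 t)"
  by (simp add: posvec_def vec_eq_iff)

lemma closed_nonneg_orthant: "closed (nonneg_orthant :: (real ^ 'n) set)"
proof -
  have "closed (\<Inter>i. {l :: real ^ 'n. 0 \<le> l $ i})"
    by (intro closed_INT ballI closed_Collect_le continuous_intros)
  also have "(\<Inter>i. {l :: real ^ 'n. 0 \<le> l $ i}) = nonneg_orthant"
    by (auto simp: nonneg_orthant_def)
  finally show ?thesis .
qed

text \<open>\<open>f\<close> may be arbitrary outside the orthant; its product with the indicator is
  Borel since the orthant is closed.\<close>

lemma borel_measurable_orthant:
  fixes f :: "real ^ 'n \<Rightarrow> real"
  assumes "continuous_on nonneg_orthant f" "X \<in> borel_measurable M" "\<And>w. w \<in> space M \<Longrightarrow> X w \<in> nonneg_orthant"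
  shows "(\<lambda>w. f (X w)) \<in> borel_measurable M"
proof -
  have "(\<lambda>l. indicator nonneg_orthant l *\<^sub>R f l) \<in> borel_measurable borel"
    by (intro borel_measurable_continuous_on_indicator assms(1) borel_closed closed_nonneg_orthant)
  from measurable_compose[OF assms(2) this] show ?thesis
    by (rule measurable_cong[THEN iffD1, rotated]) (simp add: assms(3))
qed

lemma borel_measurable_component:
  "(\<lambda>x. x i) \<in> borel_measurable lborel_prod"
  using measurable_component_singleton[of i UNIV "\<lambda>_. lborel"] by simp

lemma borel_measurable_posvec: "posvec \<in> borel_measurable (lborel_prod :: ('n::finite \<Rightarrow> real) measure)"
proof (rule borel_measurable_euclidean_space[THEN iffD2], rule ballI)
  fix b :: "real ^ 'n" assume "b \<in> Basis"
  then obtain i where b: "b = axis i 1"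
    by (auto simp: Basis_vec_def)
  have "(\<lambda>x. max 0 (x i :: real)) \<in> borel_measurable (lborel_prod :: ('n \<Rightarrow> real) measure)"
    by (intro borel_measurable_max borel_measurable_const borel_measurable_component)
  then show "(\<lambda>x. posvec x \<bullet> b) \<in> borel_measurable (lborel_prod :: ('n \<Rightarrow> real) measure)"
    by (simp add: b inner_axis posvec_def)
qed

lemma borel_measurable_f_posvec:
  fixes f :: "real ^ 'n \<Rightarrow> real"
  shows "continuous_on nonneg_orthant f \<Longrightarrow> (\<lambda>x. f (posvec x)) \<in> borel_measurable lborel_prod"
  by (rule borel_measurable_orthant[of f posvec, OF _ borel_measurable_posvec]) auto

lemma borel_measurable_gamma_density:
  "gamma_density s k \<in> borel_measurable lborel_prod"
  unfolding gamma_density_def[abs_def]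
  by (intro borel_measurable_prod measurable_compose[OF borel_measurable_component borel_measurable_erlang_density])

text \<open>Exponential tilting: the factor exp (- v t) turns rate \<open>s\<close> into rate
  \<open>s + v\<close> up to a constant. Negative \<open>v\<close> above \<open>- s\<close> are
  included because they give the exponential moments.\<close>

lemma erlang_laplace:
  assumes "0 < s" "- s < v"
  shows "has_bochner_integral lborel (\<lambda>t. erlang_density m s t * exp (- (v * max 0 t))) ((s / (s + v)) ^ Suc m)"
proof -
  have p: "(s / (s + v)) ^ Suc m * (s + v) ^ Suc m = s ^ Suc m"
    using assms by (simp only: power_mult_distrib[symmetric]) simp
  have "erlang_density m s t * exp (- (v * max 0 t)) = (s / (s + v)) ^ Suc m * erlang_density m (s + v) t" for t
  proof (cases "t < 0")
    case False
    have "exp (- s * t) * exp (- (v * t)) = exp (- (s + v) * t)"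
      by (simp add: exp_add[symmetric] algebra_simps)
    then have "erlang_density m s t * exp (- (v * max 0 t))
        = ((s / (s + v)) ^ Suc m * (s + v) ^ Suc m) * t ^ m * exp (- (s + v) * t) / fact m"
      unfolding p using False by (simp add: erlang_density_def del: power_Suc)
    then show ?thesis
      using False by (simp add: erlang_density_def del: power_Suc)
  qed (simp add: erlang_density_def)
  moreover have "has_bochner_integral lborel (erlang_density m (s + v)) 1"
    using nn_integral_erlang_ith_moment[of "s + v" m 0] assms
    by (intro has_bochner_integral_nn_integral) auto
  ultimately show ?thesis
    using has_bochner_integral_mult_right[of "(s / (s + v)) ^ Suc m" lborel "erlang_density m (s + v)" 1] by simp
qed

interpretation lborel_product: product_sigma_finite "\<lambda>_. lborel :: real measure"
  by standard

lemma gamma_laplace: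
  fixes v :: "real ^ 'n"
  assumes "0 < s" "\<And>i. - s < v $ i"
  shows "has_bochner_integral lborel_prod (\<lambda>x. gamma_density s k x * exp (- (v \<bullet> posvec x)))
    (\<Prod>i\<in>UNIV. (s / (s + v $ i)) ^ Suc (k i))"
proof -
  let ?g = "\<lambda>i t. erlang_density (k i) s t * exp (- (v $ i * max 0 t))"
  have g: "integrable lborel (?g i)" "integral\<^sup>L lborel (?g i) = (s / (s + v $ i)) ^ Suc (k i)" for i
    using erlang_laplace[OF assms(1) assms(2)[of i], where m = "k i"] by (auto simp: has_bochner_integral_iff)
  have "gamma_density s k x * exp (- (v \<bullet> posvec x)) = (\<Prod>i\<in>UNIV. ?g i (x i))" for x
    by (simp add: gamma_density_def inner_vec_def posvec_def prod.distrib exp_sum[symmetric] sum_negf)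
  then show ?thesis
    using lborel_product.product_integrable_prod[of UNIV ?g] lborel_product.product_integral_prod[of UNIV ?g] g
    by (simp add: has_bochner_integral_iff)
qed

lemma gamma_mean_exp:
  assumes "0 < s" "v \<in> nonneg_orthant"
  shows "gamma_mean s (\<lambda>l. exp (- (v \<bullet> l))) k = (\<Prod>i\<in>UNIV. (s / (s + v $ i)) ^ Suc (k i))"
proof -
  have "- s < v $ i" for i
    using assms by (auto simp: nonneg_orthant_def) (meson less_le_trans neg_less_0_iff_less)
  then show ?thesis
    using gamma_laplace[of s v k] assms by (simp add: gamma_mean_def has_bochner_integral_iff)
qed

lemma gamma_density_nonneg: "0 < s \<Longrightarrow> 0 \<le> gamma_density s k x"
  by (simp add: gamma_density_def prod_nonneg)

text \<open>Both parts compare \<open>f\<close> with the Laplace transform at the vector with all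
  entries - \<epsilon>, where each coordinate contributes a power of
  \<open>s / (s - \<epsilon>)\<close>.\<close>

lemma wbounded_gamma:
  fixes f :: "real ^ 'n \<Rightarrow> real"
  assumes s: "0 < s" "\<epsilon> < s" and f: "wbounded \<epsilon> c f"
  shows "integrable lborel_prod (\<lambda>x. gamma_density s k x * f (posvec x))"
    and "\<bar>gamma_mean s f k\<bar> \<le> c * (s / (s - \<epsilon>)) ^ (\<Sum>i\<in>UNIV. Suc (k i))"
proof -
  define v :: "real ^ 'n" where "v = (\<chi> i. - \<epsilon>)"
  have v: "- (v \<bullet> l) = \<epsilon> * coord_sum l" for l :: "real ^ 'n"
    by (simp add: v_def inner_vec_def sum_distrib_left sum_negf)
  have *: "has_bochner_integral lborel_prod (\<lambda>x. c * (gamma_density s k x * exp (- (v \<bullet> posvec x))))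
      (c * (\<Prod>i\<in>UNIV. (s / (s + v $ i)) ^ Suc (k i)))"
    using s by (intro has_bochner_integral_mult_right gamma_laplace) (auto simp: v_def)
  have b: "norm (gamma_density s k x * f (posvec x)) \<le> c * (gamma_density s k x * exp (- (v \<bullet> posvec x)))" for x
  proof -
    have "\<bar>f (posvec x)\<bar> \<le> c * exp (- (v \<bullet> posvec x))"
      using f by (simp add: wbounded_def v)
    then show ?thesis
      using mult_left_mono[OF _ gamma_density_nonneg[OF s(1), of k x]]
      by (fastforce simp: abs_mult gamma_density_nonneg[OF s(1)] mult_ac)
  qed
  show int: "integrable lborel_prod (\<lambda>x. gamma_density s k x * f (posvec x))"
  proof (rule Bochner_Integration.integrable_bound)
    show "integrable lborel_prod (\<lambda>x. c * (gamma_density s k x * exp (- (v \<bullet> posvec x))))"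
      using * by (simp add: has_bochner_integral_iff)
    show "(\<lambda>x. gamma_density s k x * f (posvec x)) \<in> borel_measurable lborel_prod"
      using f by (intro borel_measurable_times borel_measurable_gamma_density borel_measurable_f_posvec)
        (simp add: wbounded_def)
    show "AE x in lborel_prod. norm (gamma_density s k x * f (posvec x))
        \<le> norm (c * (gamma_density s k x * exp (- (v \<bullet> posvec x))))"
      using b by (intro AE_I2) (metis abs_ge_self order_trans real_norm_def)
  qed
  have "\<bar>gamma_mean s f k\<bar> \<le> (\<integral>x. c * (gamma_density s k x * exp (- (v \<bullet> posvec x))) \<partial>lborel_prod)"
    unfolding gamma_mean_def using int * b
    by (intro integral_abs_bound[THEN order_trans] integral_mono) (auto simp: has_bochner_integral_iff)
  also have "\<dots> = c * (s / (s - \<epsilon>)) ^ (\<Sum>i\<in>UNIV. Suc (k i))"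
    using * by (simp add: has_bochner_integral_iff v_def power_sum)
  finally show "\<bar>gamma_mean s f k\<bar> \<le> c * (s / (s - \<epsilon>)) ^ (\<Sum>i\<in>UNIV. Suc (k i))" .
qed

lemma wbounded_add:
  "wbounded \<epsilon> c f \<Longrightarrow> wbounded \<epsilon> d g \<Longrightarrow> wbounded \<epsilon> (c + d) (\<lambda>l. f l + g l)"
  unfolding wbounded_def
  by (auto intro!: continuous_intros simp: distrib_right intro: abs_triangle_ineq[THEN order_trans] add_mono)

lemma wbounded_cmult: "wbounded \<epsilon> c f \<Longrightarrow> wbounded \<epsilon> (\<bar>a\<bar> * c) (\<lambda>l. a * f l)"
  unfolding wbounded_def by (auto intro!: continuous_intros simp: abs_mult mult.assoc mult_left_mono)

lemma gamma_mean_add: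
  assumes "0 < s" "\<epsilon> < s" "wbounded \<epsilon> c f" "wbounded \<epsilon> d g"
  shows "gamma_mean s (\<lambda>l. f l + g l) k = gamma_mean s f k + gamma_mean s g k"
  using wbounded_gamma(1)[OF assms(1,2,3)] wbounded_gamma(1)[OF assms(1,2,4)]
  by (simp add: gamma_mean_def distrib_left)

lemma gamma_mean_cmult: "gamma_mean s (\<lambda>l. a * f l) k = a * gamma_mean s f k"
  unfolding gamma_mean_def by (subst integral_mult_right_zero[symmetric]) (simp add: mult_ac)

section \<open>Signs of the second differences of Gamma means\<close>

lemma erlang_tendsto_0:
  assumes "0 < s" "\<epsilon> < s"
  shows "((\<lambda>x. exp (\<epsilon> * x) * erlang_density m s x) \<longlongrightarrow> 0) at_top"
proof -
  define d where "d = s - \<epsilon>"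
  have d: "0 < d" using assms by (simp add: d_def)
  have "((\<lambda>x. (d * x) ^ m / exp (d * x)) \<longlongrightarrow> 0) at_top"
    using d by (intro filterlim_compose[OF tendsto_power_div_exp_0]
        filterlim_tendsto_pos_mult_at_top[OF tendsto_const] filterlim_ident)
  then have "((\<lambda>x. s ^ Suc m / (fact m * d ^ m) * ((d * x) ^ m / exp (d * x))) \<longlongrightarrow> 0) at_top"
    by (rule tendsto_mult_right_zero)
  moreover have "\<forall>\<^sub>F x in at_top. s ^ Suc m / (fact m * d ^ m) * ((d * x) ^ m / exp (d * x))
      = exp (\<epsilon> * x) * erlang_density m s x"
    using eventually_ge_at_top[of 0]
  proof eventually_elim
    case (elim x)
    have "exp (\<epsilon> * x) * exp (- s * x) * exp (d * x) = 1"
      by (simp add: exp_add[symmetric] d_def algebra_simps)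
    then have e: "1 / exp (d * x) = exp (\<epsilon> * x) * exp (- s * x)"
      by (simp add: field_simps)
    have "s ^ Suc m / (fact m * d ^ m) * ((d * x) ^ m / exp (d * x)) = s ^ Suc m * x ^ m / fact m * (1 / exp (d * x))"
      using d by (simp add: power_mult_distrib)
    also have "\<dots> = exp (\<epsilon> * x) * erlang_density m s x"
      unfolding e using elim by (simp add: erlang_density_def)
    finally show ?case .
  qed
  ultimately show ?thesis
    by (rule Lim_transform_eventually)
qed

text \<open>Up to a factor \<open>s\<close>, the weight below is the derivative of \<open>x g'\<^sub>m(x)\<close>, where \<open>g\<^sub>m\<close> is the Erlang
  density. Since \<open>x \<phi>'(x)\<close> is monotone and \<open>g'\<^sub>m\<close> changes sign only at \<open>m / s\<close>, integration by parts
  gives a nonnegative integral.\<close>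

lemma erlang_second_diff_nonneg:
  fixes \<phi> \<phi>' :: "real \<Rightarrow> real"
  assumes s: "0 < s" "\<epsilon> < s"
    and cont: "continuous_on {0..} \<phi>"
    and der: "\<And>x. 0 < x \<Longrightarrow> (\<phi> has_real_derivative \<phi>' x) (at x)"
    and mono: "\<And>x y. 0 \<le> x \<Longrightarrow> x \<le> y \<Longrightarrow> x * \<phi>' x \<le> y * \<phi>' y"
    and bound: "\<And>x. 0 \<le> x \<Longrightarrow> \<bar>\<phi> x\<bar> \<le> c * exp (\<epsilon> * x)"
    and int: "\<And>k. integrable lborel (\<lambda>t. erlang_density k s t * \<phi> (max 0 t))"
  shows "0 \<le> (\<integral>t. (real (Suc m) * (erlang_density (Suc m) s t - erlang_density m s t)
      - real m * (erlang_density m s t - erlang_density (m - 1) s t)) * \<phi> (max 0 t) \<partial>lborel)"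
proof -
  \<comment> \<open>Erlang densities continued smoothly to negative arguments, so that they can be
    differentiated at 0.\<close>
  define g where "g k x = s ^ Suc k * x ^ k * exp (- s * x) / fact k" for k :: nat and x :: real
  define \<gamma> where "\<gamma> k x = s * ((if k = 0 then 0 else g (k - 1) x) - g k x)" for k x
  define H where "H x = real m * g m x - real (Suc m) * g (Suc m) x" for x
  define \<omega> where "\<omega> x = real (Suc m) * (g (Suc m) x - g m x) - real m * (g m x - g (m - 1) x)" for x
  \<comment> \<open>The only positive zero of the derivative \<open>\<gamma> m\<close> if
    \<open>m > 0\<close>. For \<open>m = 0\<close> it is 0, and \<open>\<gamma> 0\<close> is nowhere
    positive. Either way \<open>(x * \<phi>' x - h0) * \<gamma> m x \<le> 0\<close> for
    \<open>x \<ge> 0\<close>.\<close>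
  define x0 where "x0 = real m / s"
  define h0 where "h0 = x0 * \<phi>' x0"
  \<comment> \<open>Since \<open>H x = x * \<gamma> m x\<close> has derivative
    \<open>s * \<omega> x\<close>, the derivative of \<open>Z\<close> is
    \<open>s * \<omega> x * \<phi> x\<close> plus a nonpositive term. Subtracting
    \<open>h0 * g m x\<close> centres \<open>x * \<phi>' x\<close> at the sign change and costs
    nothing at the two ends 0 and infinity, where \<open>Z\<close> still vanishes.\<close>
  define Z where "Z x = \<phi> x * H x - h0 * g m x" for x
  have erl: "erlang_density k s x = g k x" if "0 \<le> x" for k x
    using that by (simp add: erlang_density_def g_def)
  have dg: "(g k has_real_derivative \<gamma> k x) (at x)" for k x
  proof (cases k)
    case 0
    then show ?thesis
      unfolding g_def[abs_def] \<gamma>_def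
      by (auto intro!: derivative_eq_intros simp: power2_eq_square)
  next
    case (Suc k')
    define a where "a = s ^ Suc (Suc k') / fact (Suc k')"
    have a: "a * real (Suc k') = s * (s ^ Suc k' / fact k')"
      by (simp add: a_def del: of_nat_Suc)
    have gk: "g (Suc k') = (\<lambda>x. a * (x ^ Suc k' * exp (- s * x)))"
      by (simp add: g_def a_def fun_eq_iff)
    have "((\<lambda>x. a * (x ^ Suc k' * exp (- s * x))) has_real_derivative
        a * (real (Suc k') * x ^ k' * exp (- s * x) + (exp (- s * x) * (- s)) * x ^ Suc k')) (at x)"
    proof (intro DERIV_cmult DERIV_mult)
      show "((\<lambda>x. x ^ Suc k') has_real_derivative real (Suc k') * x ^ k') (at x)"
        using DERIV_pow[of "Suc k'" x] by simp
      show "((\<lambda>x. exp (- s * x)) has_real_derivative exp (- s * x) * (- s)) (at x)"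
        by (auto intro!: derivative_eq_intros)
    qed
    moreover have "a * (real (Suc k') * x ^ k' * exp (- s * x) + (exp (- s * x) * (- s)) * x ^ Suc k')
        = (a * real (Suc k')) * (x ^ k' * exp (- s * x)) - s * (a * (x ^ Suc k' * exp (- s * x)))"
      by (simp add: algebra_simps)
    moreover have "\<dots> = \<gamma> (Suc k') x"
      unfolding a \<gamma>_def gk by (simp add: g_def algebra_simps)
    ultimately show ?thesis
      unfolding Suc gk by simp
  qed
  have xg: "x * g k x = real (Suc k) / s * g (Suc k) x" for k x
    using s by (simp add: g_def fact_Suc divide_simps del: of_nat_Suc)
  have x\<gamma>: "x * \<gamma> m x = H x" for x
  proof (cases m)
    case 0
    have "x * \<gamma> m x = - (s * (x * g 0 x))"
      by (simp add: \<gamma>_def 0)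
    then show ?thesis
      using s by (simp add: xg H_def 0)
  next
    case (Suc k)
    have "x * \<gamma> m x = s * (x * g k x) - s * (x * g (Suc k) x)"
      by (simp add: \<gamma>_def Suc algebra_simps)
    then show ?thesis
      using s by (simp add: xg H_def Suc del: of_nat_Suc)
  qed
  have dH: "(H has_real_derivative s * \<omega> x) (at x)" for x
  proof -
    have "(H has_real_derivative real m * \<gamma> m x - real (Suc m) * \<gamma> (Suc m) x) (at x)"
      unfolding H_def[abs_def] by (intro DERIV_diff DERIV_cmult dg)
    moreover have "real m * \<gamma> m x - real (Suc m) * \<gamma> (Suc m) x = s * \<omega> x"
      by (cases m) (simp_all add: \<gamma>_def \<omega>_def algebra_simps)
    ultimately show ?thesis by simp
  qed
  have sign: "(x * \<phi>' x - h0) * \<gamma> m x \<le> 0" if "0 \<le> x" for x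
  proof (cases m)
    case 0
    then have "\<gamma> m x \<le> 0" "h0 = 0"
      using s that by (auto simp: \<gamma>_def g_def h0_def x0_def)
    then show ?thesis
      using mono[of 0 x] that by (simp add: mult_nonneg_nonpos)
  next
    case (Suc k)
    have "g (Suc k) x = s / real (Suc k) * (x * g k x)"
      unfolding xg using s by simp
    then have "\<gamma> m x = s * g k x * (1 - s * x / real (Suc k))"
      by (simp add: \<gamma>_def Suc algebra_simps)
    also have "1 - s * x / real (Suc k) = s / real (Suc k) * (x0 - x)"
      using s by (simp add: x0_def Suc right_diff_distrib del: of_nat_Suc)
    also have "s * g k x * (s / real (Suc k) * (x0 - x)) = s * g k x * (s / real (Suc k)) * (x0 - x)"
      by (simp only: mult.assoc)
    finally have \<gamma>: "\<gamma> m x = s * g k x * (s / real (Suc k)) * (x0 - x)" .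
    have "0 \<le> s * g k x * (s / real (Suc k))"
      using s that by (simp add: g_def)
    moreover have "(x * \<phi>' x - h0) * (x0 - x) \<le> 0"
      using mono[of x x0] mono[of x0 x] that s
      by (cases "x \<le> x0") (auto simp: h0_def x0_def mult_le_0_iff)
    ultimately show ?thesis
      unfolding \<gamma> by (smt (verit, ccfv_SIG) mult.commute mult.left_commute mult_nonneg_nonpos)
  qed
  \<comment> \<open>For \<open>m = 0\<close>, \<open>g 0 0 = s\<close> is not zero, but
    \<open>x0 = 0\<close> gives \<open>h0 = 0\<close>.\<close>
  have Z0: "Z 0 = 0"
  proof (cases m)
    case 0
    then show ?thesis by (simp add: Z_def H_def h0_def x0_def g_def)
  next
    case (Suc k)
    then show ?thesis by (simp add: Z_def H_def g_def)
  qed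
  have cH: "continuous_on UNIV H" and cg: "continuous_on UNIV (g k)" for k
    using DERIV_isCont[OF dH] DERIV_isCont[OF dg] by (auto intro!: continuous_at_imp_continuous_on)
  have c\<omega>: "continuous_on UNIV \<omega>"
    unfolding \<omega>_def[abs_def] by (intro continuous_intros cg)
  define I where "I r = (\<integral>t. indicator {..r} t *\<^sub>R (\<omega> t * (indicator {0..} t * \<phi> (max 0 t))) \<partial>lborel)" for r
  have low: "Z r / s \<le> I r" if r: "0 \<le> r" for r
  proof -
    have cont': "continuous_on {0..r} (\<lambda>x. \<omega> x * \<phi> x)"
      using cont c\<omega> by (auto intro!: continuous_intros elim: continuous_on_subset)
    have "set_integrable lborel {0..r} (\<lambda>x. \<omega> x * \<phi> x)"
      by (rule borel_integrable_atLeastAtMost'[OF cont'])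
    from set_borel_integral_eq_integral(2)[OF this]
    have I: "I r = integral {0..r} (\<lambda>x. \<omega> x * \<phi> x)"
      unfolding I_def set_lebesgue_integral_def
      by (subst (asm) Bochner_Integration.integral_cong[OF refl, of _ _ "\<lambda>t. indicator {..r} t *\<^sub>R (\<omega> t * (indicator {0..} t * \<phi> (max 0 t)))"])
        (auto split: split_indicator)
    \<comment> \<open>Nothing is known of a derivative of \<open>\<phi>\<close> at 0; the value of
      \<open>Z'\<close> there is free and chosen to make the comparison below an equality.\<close>
    define Z' where "Z' x = (if 0 < x then \<phi>' x * H x + s * \<omega> x * \<phi> x - h0 * \<gamma> m x else s * \<omega> x * \<phi> x)" for x
    have "(Z' has_integral (Z r - Z 0)) {0..r}"
    proof (rule fundamental_theorem_of_calculus_interior[OF r])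
      show "continuous_on {0..r} Z"
        unfolding Z_def[abs_def] using cont cH cg[of m]
        by (auto intro!: continuous_intros elim: continuous_on_subset)
      show "(Z has_vector_derivative Z' x) (at x)" if "x \<in> {0<..<r}" for x
        unfolding Z_def[abs_def] has_real_derivative_iff_has_vector_derivative[symmetric]
        using that by (auto intro!: derivative_eq_intros der dH dg simp: Z'_def)
    qed
    moreover have "((\<lambda>x. s * (\<omega> x * \<phi> x)) has_integral s * I r) {0..r}"
      unfolding I using integrable_continuous_real[OF cont']
      by (intro has_integral_mult_right integrable_integral)
    moreover have "Z' x \<le> s * (\<omega> x * \<phi> x)" if "x \<in> {0..r}" for x
    proof (cases "0 < x")
      case True
      have "\<phi>' x * H x - h0 * \<gamma> m x = (x * \<phi>' x - h0) * \<gamma> m x"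
        by (simp add: x\<gamma>[symmetric] algebra_simps)
      then show ?thesis
        using sign[of x] True by (simp add: Z'_def)
    qed (simp add: Z'_def)
    ultimately have "Z r - Z 0 \<le> s * I r"
      by (rule has_integral_le)
    then show ?thesis
      using s by (simp add: Z0 field_simps)
  qed
  have "((\<lambda>x. exp (\<epsilon> * x) * g k x) \<longlongrightarrow> 0) at_top" "(g k \<longlongrightarrow> 0) at_top" for k
  proof -
    show "((\<lambda>x. exp (\<epsilon> * x) * g k x) \<longlongrightarrow> 0) at_top"
      by (rule Lim_transform_eventually[OF erlang_tendsto_0[OF s, of k]])
        (use eventually_ge_at_top[of 0] in eventually_elim, simp add: erl)
    show "(g k \<longlongrightarrow> 0) at_top"
      by (rule Lim_transform_eventually[OF erlang_tendsto_0[OF s(1) s(1), of k]])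
        (use eventually_ge_at_top[of 0] in eventually_elim, simp add: erl)
  qed note lim = this
  have "((\<lambda>x. exp (\<epsilon> * x) * H x) \<longlongrightarrow> 0) at_top"
  proof -
    have "((\<lambda>x. real m * (exp (\<epsilon> * x) * g m x) - real (Suc m) * (exp (\<epsilon> * x) * g (Suc m) x)) \<longlongrightarrow>
        real m * 0 - real (Suc m) * 0) at_top"
      by (intro tendsto_intros lim)
    then show ?thesis by (simp add: H_def algebra_simps)
  qed
  then have "((\<lambda>x. c * \<bar>exp (\<epsilon> * x) * H x\<bar>) \<longlongrightarrow> 0) at_top"
    by (intro tendsto_mult_right_zero tendsto_rabs_zero)
  then have "((\<lambda>x. \<phi> x * H x) \<longlongrightarrow> 0) at_top"
  proof (rule Lim_null_comparison[rotated])
    show "\<forall>\<^sub>F x in at_top. norm (\<phi> x * H x) \<le> c * \<bar>exp (\<epsilon> * x) * H x\<bar>"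
      using eventually_ge_at_top[of 0]
      by eventually_elim (use bound in \<open>simp add: abs_mult mult.assoc[symmetric] mult_right_mono\<close>)
  qed
  then have "((\<lambda>x. Z x / s) \<longlongrightarrow> (0 - h0 * 0) / s) at_top"
    unfolding Z_def using s by (intro tendsto_intros lim) auto
  then have limZ: "((\<lambda>x. Z x / s) \<longlongrightarrow> 0) at_top" by simp
  have eq: "(real (Suc m) * (erlang_density (Suc m) s t - erlang_density m s t)
      - real m * (erlang_density m s t - erlang_density (m - 1) s t)) * \<phi> (max 0 t)
      = \<omega> t * (indicator {0..} t * \<phi> (max 0 t))" for t
    by (cases "0 \<le> t") (auto simp: erl \<omega>_def, simp add: erlang_density_def)
  have "integrable lborel (\<lambda>t. real (Suc m) * (erlang_density (Suc m) s t * \<phi> (max 0 t) - erlang_density m s t * \<phi> (max 0 t))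
      - real m * (erlang_density m s t * \<phi> (max 0 t) - erlang_density (m - 1) s t * \<phi> (max 0 t)))"
    by (intro Bochner_Integration.integrable_diff integrable_mult_right int)
  then have "integrable lborel (\<lambda>t. (real (Suc m) * (erlang_density (Suc m) s t - erlang_density m s t)
      - real m * (erlang_density m s t - erlang_density (m - 1) s t)) * \<phi> (max 0 t))"
    by (simp add: algebra_simps)
  then have "(I \<longlongrightarrow> (\<integral>t. \<omega> t * (indicator {0..} t * \<phi> (max 0 t)) \<partial>lborel)) at_top"
    unfolding I_def eq by (intro tendsto_integral_at_top) auto
  moreover have "\<forall>\<^sub>F r in at_top. Z r / s \<le> I r"
    using eventually_ge_at_top[of 0] by eventually_elim (rule low)
  ultimately have "0 \<le> (\<integral>t. \<omega> t * (indicator {0..} t * \<phi> (max 0 t)) \<partial>lborel)"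
    by (intro tendsto_le[OF _ _ limZ]) auto
  then show ?thesis
    by (simp only: eq)
qed

lemma gamma_density_upd:
  fixes k :: "'n::finite \<Rightarrow> nat"
  shows "gamma_density s (k(i := m)) (x(i := t)) = erlang_density m s t * (\<Prod>j\<in>UNIV - {i}. erlang_density (k j) s (x j))"
  unfolding gamma_density_def by (subst prod.remove[of UNIV i]) (auto intro!: prod.cong)

lemma lborel_product_slice:
  fixes g :: "('n::finite \<Rightarrow> real) \<Rightarrow> real"
  assumes "integrable lborel_prod g"
  shows "integral\<^sup>L lborel_prod g = (\<integral>x. (\<integral>t. g (x(i := t)) \<partial>lborel) \<partial>(\<Pi>\<^sub>M i\<in>UNIV - {i}. lborel))"
proof -
  have "insert i (UNIV - {i}) = (UNIV :: 'n set)" by auto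
  then show ?thesis
    using lborel_product.product_integral_insert[of "UNIV - {i}" i g] assms by simp
qed

lemma update_eq: "update l i t = l + (t - l $ i) *\<^sub>R axis i 1"
  by (simp add: vec_eq_iff axis_def)

lemma continuous_on_update [continuous_intros]:
  "continuous_on S g \<Longrightarrow> continuous_on S h \<Longrightarrow> continuous_on S (\<lambda>x. update (g x) i (h x))"
  unfolding update_eq by (intro continuous_intros)

lemma sum_update: "(\<Sum>j\<in>UNIV. update l i t $ j) = coord_sum l - l $ i + t"
  by (simp add: sum.remove[of UNIV i])

lemma continuous_on_slice:
  assumes "continuous_on nonneg_orthant f" "l \<in> nonneg_orthant"
  shows "continuous_on {0..} (\<lambda>t. f (update l i t))"
  by (rule continuous_on_compose2[OF assms(1)]) (auto intro!: continuous_intros update_in_orthant assms(2))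

lemma integrable_erlang:
  fixes \<phi> :: "real \<Rightarrow> real"
  assumes s: "0 < s" "\<epsilon> < s" and cont: "continuous_on {0..} \<phi>"
    and bound: "\<And>x. 0 \<le> x \<Longrightarrow> \<bar>\<phi> x\<bar> \<le> c * exp (\<epsilon> * x)"
  shows "integrable lborel (\<lambda>t. erlang_density k s t * \<phi> (max 0 t))"
proof (rule Bochner_Integration.integrable_bound)
  show "integrable lborel (\<lambda>t. c * (erlang_density k s t * exp (- (- \<epsilon> * max 0 t))))"
    using erlang_laplace[of s "- \<epsilon>" k] s by (auto simp: has_bochner_integral_iff)
  have "continuous_on UNIV (\<lambda>t. \<phi> (max 0 t))"
    by (rule continuous_on_compose2[OF cont]) (auto intro!: continuous_intros)
  then show "(\<lambda>t. erlang_density k s t * \<phi> (max 0 t)) \<in> borel_measurable lborel"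
    using borel_measurable_continuous_onI[of "\<lambda>t. \<phi> (max 0 t)"] by simp
  show "AE t in lborel. norm (erlang_density k s t * \<phi> (max 0 t))
      \<le> norm (c * (erlang_density k s t * exp (- (- \<epsilon> * max 0 t))))"
  proof (intro AE_I2)
    fix t
    have "\<bar>\<phi> (max 0 t)\<bar> \<le> \<bar>c\<bar> * exp (\<epsilon> * max 0 t)"
      using bound[of "max 0 t"] by (smt (verit) exp_gt_zero max.cobounded1 mult_right_mono)
    then have "erlang_density k s t * \<bar>\<phi> (max 0 t)\<bar> \<le> erlang_density k s t * (\<bar>c\<bar> * exp (\<epsilon> * max 0 t))"
      using s by (intro mult_left_mono) auto
    then show "norm (erlang_density k s t * \<phi> (max 0 t))
      \<le> norm (c * (erlang_density k s t * exp (- (- \<epsilon> * max 0 t))))"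
      using s by (simp add: abs_mult mult_ac)
  qed
qed

lemma wbounded_slice:
  assumes "wbounded \<epsilon> c f" "l \<in> nonneg_orthant" "0 \<le> t"
  shows "\<bar>f (update l i t)\<bar> \<le> c * exp (\<epsilon> * (coord_sum l - l $ i)) * exp (\<epsilon> * t)"
proof -
  have "\<bar>f (update l i t)\<bar> \<le> c * exp (\<epsilon> * (coord_sum l - l $ i + t))"
    using assms update_in_orthant[of l t i] unfolding wbounded_def by (metis sum_update)
  then show ?thesis
    by (simp add: distrib_left exp_add mult_ac)
qed

text \<open>Fubini with coordinate \<open>i\<close> inside: along each line the densities share a
  nonnegative factor from the other coordinates, and their combination in \<open>t\<close> is the
  weight of \<open>erlang_second_diff_nonneg\<close>.\<close>

lemma second_diff_diag_nonneg:
  fixes f :: "real ^ 'n \<Rightarrow> real"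
  assumes s: "0 < s" "\<epsilon> < s" and f: "wbounded \<epsilon> c f"
    and der: "\<And>l t. l \<in> nonneg_orthant \<Longrightarrow> 0 < t \<Longrightarrow>
      ((\<lambda>t. f (update l i t)) has_real_derivative D (update l i t)) (at t)"
    and mono: "\<And>l x y. l \<in> nonneg_orthant \<Longrightarrow> 0 \<le> x \<Longrightarrow> x \<le> y \<Longrightarrow> x * D (update l i x) \<le> y * D (update l i y)"
  shows "0 \<le> second_diff i i (gamma_mean s f) k"
proof -
  define m where "m = k i"
  define d where "d n x = gamma_density s (k(i := n)) x * f (posvec x)" for n x
  have d: "integrable lborel_prod (d n)" for n
    unfolding d_def[abs_def] by (rule wbounded_gamma(1)[OF s f])
  define g where "g x = real (Suc m) * (d (Suc m) x - d m x) - real m * (d m x - d (m - 1) x)" for x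
  have gi: "integrable lborel_prod g"
    unfolding g_def[abs_def] by (intro Bochner_Integration.integrable_diff integrable_mult_right d)
  have dm: "integral\<^sup>L lborel_prod (d n) = gamma_mean s f (k(i := n))" for n
    by (simp add: gamma_mean_def d_def[abs_def])
  have "integral\<^sup>L lborel_prod g = real (Suc m) * (gamma_mean s f (k(i := Suc m)) - gamma_mean s f (k(i := m)))
      - real m * (gamma_mean s f (k(i := m)) - gamma_mean s f (k(i := m - 1)))"
    unfolding g_def[abs_def] dm[symmetric]
    by (subst Bochner_Integration.integral_diff) (auto simp: d)
  then have "second_diff i i (gamma_mean s f) k = integral\<^sup>L lborel_prod g"
    by (simp add: second_diff_def m_def)
  also have "\<dots> = (\<integral>x. (\<integral>t. g (x(i := t)) \<partial>lborel) \<partial>(\<Pi>\<^sub>M i\<in>UNIV - {i}. lborel))"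
    by (rule lborel_product_slice[OF gi])
  also have "\<dots> \<ge> 0"
  proof (rule Bochner_Integration.integral_nonneg)
    fix x :: "'n \<Rightarrow> real"
    define l where "l = posvec x"
    have l: "l \<in> nonneg_orthant" by (simp add: l_def)
    define r where "r = (\<Prod>j\<in>UNIV - {i}. erlang_density (k j) s (x j))"
    have r: "0 \<le> r"
      using s by (auto simp: r_def intro!: prod_nonneg)
    let ?w = "\<lambda>t. (real (Suc m) * (erlang_density (Suc m) s t - erlang_density m s t)
        - real m * (erlang_density m s t - erlang_density (m - 1) s t)) * f (update l i (max 0 t))"
    have "g (x(i := t)) = r * ?w t" for t
      unfolding g_def d_def gamma_density_upd posvec_upd r_def[symmetric] l_def[symmetric]
      by (simp add: algebra_simps)
    moreover have "0 \<le> integral\<^sup>L lborel ?w"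
    proof (rule erlang_second_diff_nonneg[OF s, where \<phi> = "\<lambda>t. f (update l i t)" and \<phi>' = "\<lambda>t. D (update l i t)"])
      show "continuous_on {0..} (\<lambda>t. f (update l i t))"
        using f l by (intro continuous_on_slice) (auto simp: wbounded_def)
      then show "integrable lborel (\<lambda>t. erlang_density n s t * f (update l i (max 0 t)))" for n
        by (rule integrable_erlang[OF s]) (rule wbounded_slice[OF f l])
    qed (use der mono wbounded_slice[OF f l] l in auto)
    ultimately show "0 \<le> (\<integral>t. g (x(i := t)) \<partial>lborel)"
      using r by simp
  qed
  finally show ?thesis .
qed

text \<open>Integrated out, coordinate \<open>i\<close> contributes only the mass 1 of its Erlang
  density.\<close>

lemma gamma_mean_indep:
  fixes f :: "real ^ 'n \<Rightarrow> real"
  assumes s: "0 < s" "\<epsilon> < s" and f: "wbounded \<epsilon> c f"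
    and indep: "\<And>l t. l \<in> nonneg_orthant \<Longrightarrow> 0 \<le> t \<Longrightarrow> f (update l i t) = f l"
  shows "gamma_mean s f (k(i := m)) = gamma_mean s f k"
proof -
  have "gamma_mean s f (k(i := n)) = (\<integral>x. (\<Prod>j\<in>UNIV - {i}. erlang_density (k j) s (x j)) * f (posvec x)
      \<partial>(\<Pi>\<^sub>M i\<in>UNIV - {i}. lborel))" for n
  proof -
    have "(\<integral>t. erlang_density n s t \<partial>lborel) = 1"
      using erlang_laplace[of s 0 n] s by (simp add: has_bochner_integral_iff)
    then show ?thesis
      unfolding gamma_mean_def lborel_product_slice[OF wbounded_gamma(1)[OF s f], of "k(i := n)" i]
        gamma_density_upd posvec_upd
      by (simp add: indep)
  qed
  from this[of m] this[of "k i"] show ?thesis by simp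
qed

lemma wbounded_update:
  assumes f: "wbounded \<epsilon> c f" and "0 \<le> \<epsilon>" "0 \<le> a"
  shows "wbounded \<epsilon> (c * exp (\<epsilon> * a)) (\<lambda>l. f (update l i a))"
  unfolding wbounded_def
proof
  show "continuous_on nonneg_orthant (\<lambda>l. f (update l i a))"
  proof (rule continuous_on_compose2[where g = f and t = nonneg_orthant and f = "\<lambda>l. update l i a"])
    show "continuous_on nonneg_orthant f"
      using f by (simp add: wbounded_def)
    show "continuous_on nonneg_orthant (\<lambda>l. update l i a)"
      by (intro continuous_intros)
    show "(\<lambda>l. update l i a) ` nonneg_orthant \<subseteq> nonneg_orthant"
      using update_in_orthant \<open>0 \<le> a\<close> by blast
  qed
  show "\<forall>l\<in>nonneg_orthant. \<bar>f (update l i a)\<bar> \<le> c * exp (\<epsilon> * a) * exp (\<epsilon> * coord_sum l)"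
  proof
    fix l :: "real ^ 'a" assume l: "l \<in> nonneg_orthant"
    have "0 \<in> (nonneg_orthant :: (real ^ 'a) set)"
      by (simp add: nonneg_orthant_def)
    then have "\<bar>f 0\<bar> \<le> c * exp (\<epsilon> * (\<Sum>i\<in>UNIV. (0 :: real ^ 'a) $ i))"
      using f unfolding wbounded_def by blast
    then have c: "0 \<le> c"
      by simp
    have "\<bar>f (update l i a)\<bar> \<le> c * exp (\<epsilon> * (coord_sum l - l $ i)) * exp (\<epsilon> * a)"
      by (rule wbounded_slice[OF f l assms(3)])
    also have "\<dots> \<le> c * exp (\<epsilon> * coord_sum l) * exp (\<epsilon> * a)"
      using l c assms(2) by (intro mult_right_mono mult_left_mono) (auto simp: nonneg_orthant_def intro!: mult_left_mono)
    finally show "\<bar>f (update l i a)\<bar> \<le> c * exp (\<epsilon> * a) * exp (\<epsilon> * coord_sum l)"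
      by (simp add: mult_ac)
  qed
qed

text \<open>The increments \<open>g\<^bsub>m+1\<^esub> - g\<^sub>m\<close> of Erlang densities have integral 0 and change sign only at
  \<open>(m + 1) / s\<close>. Subtracting from \<open>f\<close> its values on the hyperplanes \<open>l\<^sub>i = (k\<^sub>i + 1) / s\<close> and
  \<open>l\<^sub>j = (k\<^sub>j + 1) / s\<close> does not change the integral and makes the integrand nonnegative.\<close>

lemma second_diff_off_diag_nonneg:
  fixes f :: "real ^ 'n \<Rightarrow> real"
  assumes s: "0 < s" "\<epsilon> < s" and \<epsilon>: "0 \<le> \<epsilon>" and f: "wbounded \<epsilon> c f" and ij: "i \<noteq> j"
    and super: "\<And>l x x' y y'. l \<in> nonneg_orthant \<Longrightarrow> 0 \<le> x \<Longrightarrow> x \<le> x' \<Longrightarrow> 0 \<le> y \<Longrightarrow> y \<le> y' \<Longrightarrow>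
      f (update (update l i x') j y) + f (update (update l i x) j y')
      \<le> f (update (update l i x') j y') + f (update (update l i x) j y)"
  shows "0 \<le> second_diff i j (gamma_mean s f) k"
proof -
  define a where "a = real (Suc (k i)) / s"
  define b where "b = real (Suc (k j)) / s"
  have ab: "0 \<le> a" "0 \<le> b" using s by (auto simp: a_def b_def)
  define fa where "fa l = f (update l i a)" for l
  define fb where "fb l = f (update l j b)" for l
  define fab where "fab l = fb (update l i a)" for l
  define h where "h l = (f l + (- 1) * fa l) + ((- 1) * fb l + fab l)" for l
  obtain ca where fa: "wbounded \<epsilon> ca fa"
    unfolding fa_def[abs_def] using wbounded_update[OF f \<epsilon> ab(1)] by blast
  obtain cb where fb: "wbounded \<epsilon> cb fb"
    unfolding fb_def[abs_def] using wbounded_update[OF f \<epsilon> ab(2)] by blast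
  obtain cab where fab: "wbounded \<epsilon> cab fab"
    unfolding fab_def[abs_def] using wbounded_update[OF fb \<epsilon> ab(1)] by blast
  note w = wbounded_add[OF f wbounded_cmult[OF fa, of "- 1"]] wbounded_add[OF wbounded_cmult[OF fb, of "- 1"] fab]
  have h: "wbounded \<epsilon> (c + \<bar>- 1\<bar> * ca + (\<bar>- 1\<bar> * cb + cab)) h"
    unfolding h_def[abs_def] by (rule wbounded_add[OF w])
  have mean: "gamma_mean s h k = gamma_mean s f k - gamma_mean s fa k - gamma_mean s fb k + gamma_mean s fab k" for k
    unfolding h_def[abs_def]
    by (simp only: gamma_mean_add[OF s w] gamma_mean_add[OF s f wbounded_cmult[OF fa]]
        gamma_mean_add[OF s wbounded_cmult[OF fb] fab] gamma_mean_cmult)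
  have upd: "update (update l i x) i t = update l i t" "update (update l i x) j y = update (update l j y) i x" for l x t y
    using ij by (auto simp: vec_eq_iff)
  have ia: "gamma_mean s fa (k(i := m)) = gamma_mean s fa k" for m k
    by (rule gamma_mean_indep[OF s fa]) (simp add: fa_def upd)
  have iab: "gamma_mean s fab (k(i := m)) = gamma_mean s fab k" for m k
    by (rule gamma_mean_indep[OF s fab]) (simp add: fab_def upd)
  have jb: "gamma_mean s fb (k(j := m)) = gamma_mean s fb k" for m k
  proof (rule gamma_mean_indep[OF s fb])
    fix l :: "real ^ 'n" and t
    have "update (update l j t) j b = update l j b" by (simp add: vec_eq_iff)
    then show "fb (update l j t) = fb l" by (simp add: fb_def)
  qed
  have tw: "k(i := p, j := q) = k(j := q, i := p)" for p q
    using ij by (simp add: fun_upd_twist)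
  \<comment> \<open>A mean that does not depend on \<open>k i\<close> or on \<open>k j\<close> has
    no mixed difference, so that \<open>f\<close> may be replaced by \<open>h\<close>.\<close>
  have z: "second_diff i j (gamma_mean s fa) k = 0" "second_diff i j (gamma_mean s fab) k = 0"
      "second_diff i j (gamma_mean s fb) k = 0"
    using ij by (simp_all add: second_diff_def ia iab tw) (simp_all add: tw[symmetric] jb)
  have "second_diff i j (gamma_mean s f) k = second_diff i j (gamma_mean s f) k
     - second_diff i j (gamma_mean s fa) k - second_diff i j (gamma_mean s fb) k + second_diff i j (gamma_mean s fab) k"
    by (simp add: z)
  also have "\<dots> = second_diff i j (gamma_mean s h) k"
    using ij by (simp add: second_diff_def mean)
  also have "\<dots> = (\<integral>x. (gamma_density s (k(i := Suc (k i), j := Suc (k j))) x * h (posvec x) - gamma_density s (k(i := Suc (k i))) x * h (posvec x)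
      - gamma_density s (k(j := Suc (k j))) x * h (posvec x) + gamma_density s k x * h (posvec x)) \<partial>lborel_prod)"
    using ij wbounded_gamma(1)[OF s h] by (simp add: second_diff_def gamma_mean_def)
  also have "\<dots> \<ge> 0"
  proof (rule Bochner_Integration.integral_nonneg)
    fix x :: "'n \<Rightarrow> real"
    define r where "r = (\<Prod>a\<in>UNIV - {i} - {j}. erlang_density (k a) s (x a))"
    define l where "l = posvec x"
    define \<delta> where "\<delta> m t = erlang_density (Suc m) s t - erlang_density m s t" for m t
    have l: "l \<in> nonneg_orthant" by (simp add: l_def)
    have r: "0 \<le> r"
      using s by (auto simp: r_def intro!: prod_nonneg)
    have dens: "gamma_density s (k(i := p, j := q)) x = erlang_density p s (x i) * (erlang_density q s (x j) * r)" for p q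
    proof -
      have "gamma_density s (k(i := p, j := q)) x = erlang_density p s (x i) *
          (\<Prod>a\<in>UNIV - {i}. erlang_density ((k(i := p, j := q)) a) s (x a))"
        unfolding gamma_density_def using ij by (subst prod.remove[of UNIV i]) auto
      also have "(\<Prod>a\<in>UNIV - {i}. erlang_density ((k(i := p, j := q)) a) s (x a))
          = erlang_density q s (x j) * (\<Prod>a\<in>UNIV - {i} - {j}. erlang_density ((k(i := p, j := q)) a) s (x a))"
        using ij by (subst prod.remove[of "UNIV - {i}" j]) auto
      also have "(\<Prod>a\<in>UNIV - {i} - {j}. erlang_density ((k(i := p, j := q)) a) s (x a)) = r"
        unfolding r_def by (rule prod.cong) auto
      finally show ?thesis .
    qed
    \<comment> \<open>The quotient of consecutive Erlang densities is s t / (m + 1), so the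
      increment is the density of index m times s / (m + 1) times t - (m + 1) / s.\<close>
    have \<delta>: "\<exists>e\<ge>0. \<delta> m t = e * (max 0 t - real (Suc m) / s)" for m t
    proof (cases "t < 0")
      case True
      then show ?thesis by (intro exI[of _ 0]) (simp add: \<delta>_def erlang_density_def)
    next
      case False
      have "\<delta> m t = erlang_density m s t * (s / real (Suc m)) * (max 0 t - real (Suc m) / s)"
        using False s by (simp add: \<delta>_def erlang_density_def fact_Suc right_diff_distrib del: of_nat_Suc)
          (simp add: field_simps)
      then show ?thesis
        using s by (intro exI[of _ "erlang_density m s t * (s / real (Suc m))"]) auto
    qed
    obtain e1 where e1: "0 \<le> e1" "\<delta> (k i) (x i) = e1 * (l $ i - a)"
      using \<delta>[of "k i" "x i"] by (auto simp: l_def posvec_def a_def)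
    obtain e2 where e2: "0 \<le> e2" "\<delta> (k j) (x j) = e2 * (l $ j - b)"
      using \<delta>[of "k j" "x j"] by (auto simp: l_def posvec_def b_def)
    have "update (update l i (l $ i)) j (l $ j) = l" "update (update l i a) j (l $ j) = update l i a"
        "update (update l i (l $ i)) j b = update l j b"
      using ij by (auto simp: vec_eq_iff)
    then have hl: "h l = f (update (update l i (l $ i)) j (l $ j)) - f (update (update l i a) j (l $ j))
        - f (update (update l i (l $ i)) j b) + f (update (update l i a) j b)"
      by (simp add: h_def fa_def fb_def fab_def)
    have li: "0 \<le> l $ i" "0 \<le> l $ j" using l by (auto simp: nonneg_orthant_def)
    \<comment> \<open>\<open>h l\<close> is the mixed increment of \<open>f\<close> between (a, b)
      and (l_i, l_j). If one of the two intervals is reversed, the increment and the product of the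
      distances both change sign.\<close>
    have "0 \<le> (l $ i - a) * (l $ j - b) * h l"
    proof (cases "a \<le> l $ i"; cases "b \<le> l $ j")
      assume "a \<le> l $ i" "b \<le> l $ j"
      then show ?thesis
        using super[OF l ab(1) _ ab(2), of "l $ i" "l $ j"] by (simp add: hl)
    next
      assume "a \<le> l $ i" "\<not> b \<le> l $ j"
      then show ?thesis
        using super[OF l ab(1) _ li(2), of "l $ i" b] by (simp add: hl mult_nonpos_nonpos mult_nonneg_nonpos)
    next
      assume "\<not> a \<le> l $ i" "b \<le> l $ j"
      then show ?thesis
        using super[OF l li(1) _ ab(2), of a "l $ j"] by (simp add: hl mult_nonpos_nonpos mult_nonpos_nonneg)
    next
      assume "\<not> a \<le> l $ i" "\<not> b \<le> l $ j"
      then show ?thesis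
        using super[OF l li(1) _ li(2), of a b] by (simp add: hl mult_nonpos_nonpos)
    qed
    then have "0 \<le> (e1 * e2 * r) * ((l $ i - a) * (l $ j - b) * h l)"
      using mult_nonneg_nonneg[OF mult_nonneg_nonneg[OF e1(1) e2(1)] r] by (rule mult_nonneg_nonneg[rotated])
    also have "\<dots> = \<delta> (k i) (x i) * \<delta> (k j) (x j) * r * h l"
      by (simp add: e1 e2)
    also have "\<dots> = gamma_density s (k(i := Suc (k i), j := Suc (k j))) x * h (posvec x) - gamma_density s (k(i := Suc (k i))) x * h (posvec x)
      - gamma_density s (k(j := Suc (k j))) x * h (posvec x) + gamma_density s k x * h (posvec x)"
      using dens[of "Suc (k i)" "Suc (k j)"] dens[of "Suc (k i)" "k j"] dens[of "k i" "Suc (k j)"] dens[of "k i" "k j"] ij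
      by (simp add: \<delta>_def l_def fun_upd_idem algebra_simps)
    finally show "0 \<le> gamma_density s (k(i := Suc (k i), j := Suc (k j))) x * h (posvec x) - gamma_density s (k(i := Suc (k i))) x * h (posvec x)
      - gamma_density s (k(j := Suc (k j))) x * h (posvec x) + gamma_density s k x * h (posvec x)" .
  qed
  finally show ?thesis .
qed

section \<open>Functionals that vanish on exponentials\<close>

text \<open>Linearity and boundedness are required on weighted functions only, since the functionals
  are integrals and series that are controlled only there.\<close>

definition wfunctional :: "real \<Rightarrow> ((real ^ 'n \<Rightarrow> real) \<Rightarrow> real) \<Rightarrow> bool" where
  "wfunctional \<epsilon> L \<longleftrightarrow>
     (\<forall>c d f g. wbounded \<epsilon> c f \<longrightarrow> wbounded \<epsilon> d g \<longrightarrow> L (\<lambda>l. f l + g l) = L f + L g) \<and>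
     (\<forall>c a f. wbounded \<epsilon> c f \<longrightarrow> L (\<lambda>l. a * f l) = a * L f) \<and>
     (\<exists>B\<ge>0. \<forall>c f. wbounded \<epsilon> c f \<longrightarrow> \<bar>L f\<bar> \<le> B * c)"

inductive exp_sum :: "(real ^ 'n \<Rightarrow> real) \<Rightarrow> bool" where
  exp_sum_exp: "v \<in> nonneg_orthant \<Longrightarrow> exp_sum (\<lambda>l. exp (- (v \<bullet> l)))"
| exp_sum_cmult: "exp_sum f \<Longrightarrow> exp_sum (\<lambda>l. a * f l)"
| exp_sum_add: "exp_sum f \<Longrightarrow> exp_sum g \<Longrightarrow> exp_sum (\<lambda>l. f l + g l)"

lemma exp_sum_mult_exp:
  assumes "exp_sum f" "v \<in> nonneg_orthant"
  shows "exp_sum (\<lambda>l. exp (- (v \<bullet> l)) * f l)"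
  using assms(1)
proof induction
  case (exp_sum_exp w)
  have "exp (- (v \<bullet> l)) * exp (- (w \<bullet> l)) = exp (- ((v + w) \<bullet> l))" for l
    by (simp add: exp_add[symmetric] inner_add_left)
  moreover have "v + w \<in> nonneg_orthant"
    using assms(2) exp_sum_exp by (simp add: nonneg_orthant_def)
  ultimately show ?case
    using exp_sum.exp_sum_exp[of "v + w"] by simp
next
  case (exp_sum_cmult f a)
  then show ?case
    using exp_sum.exp_sum_cmult[of "\<lambda>l. exp (- (v \<bullet> l)) * f l" a] by (simp add: mult_ac)
next
  case (exp_sum_add f g)
  then show ?case
    using exp_sum.exp_sum_add[of "\<lambda>l. exp (- (v \<bullet> l)) * f l" "\<lambda>l. exp (- (v \<bullet> l)) * g l"]
    by (simp add: distrib_left)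
qed

lemma exp_sum_mult:
  assumes "exp_sum f" "exp_sum g"
  shows "exp_sum (\<lambda>l. f l * g l)"
  using assms(1)
proof induction
  case (exp_sum_exp w)
  then show ?case by (intro exp_sum_mult_exp assms(2))
next
  case (exp_sum_cmult f a)
  then show ?case
    using exp_sum.exp_sum_cmult[of "\<lambda>l. f l * g l" a] by (simp add: mult_ac)
next
  case (exp_sum_add f1 f2)
  then show ?case
    using exp_sum.exp_sum_add[of "\<lambda>l. f1 l * g l" "\<lambda>l. f2 l * g l"]
    by (simp add: distrib_right)
qed

lemma zero_in_orthant [simp]: "0 \<in> nonneg_orthant"
  by (simp add: nonneg_orthant_def)

lemma exp_sum_const: "exp_sum (\<lambda>l. a)"
  using exp_sum_cmult[OF exp_sum_exp[OF zero_in_orthant], of a] by simp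

lemma exp_sum_sum:
  "finite I \<Longrightarrow> (\<And>i. i \<in> I \<Longrightarrow> exp_sum (f i)) \<Longrightarrow> exp_sum (\<lambda>l. \<Sum>i\<in>I. f i l)"
  by (induction I rule: finite_induct) (auto intro: exp_sum_const exp_sum_add)

text \<open>The substitution u = exp (- l) takes coordinates to exponentials, and a product of
  exponentials is again one.\<close>

lemma exp_sum_polynomial:
  assumes "real_polynomial_function p"
  shows "exp_sum (\<lambda>l. p (\<chi> i. exp (- l $ i)))"
  using assms
proof induction
  case (linear p)
  have P: "p u = (\<Sum>i\<in>UNIV. p (axis i 1) * u $ i)" for u
  proof -
    have "u = (\<Sum>i\<in>UNIV. u $ i *\<^sub>R axis i 1)"
      by (simp add: vec_eq_iff axis_def if_distrib[of "\<lambda>a. _ * a"] cong: if_cong)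
    then have "p u = p (\<Sum>i\<in>UNIV. u $ i *\<^sub>R axis i 1)" by simp
    also have "\<dots> = (\<Sum>i\<in>UNIV. p (axis i 1) * u $ i)"
      using linear by (simp add: linear_sum linear_cmul bounded_linear.linear mult.commute)
    finally show ?thesis .
  qed
  have "exp_sum (\<lambda>l. \<Sum>i\<in>UNIV. p (axis i 1) * exp (- l $ i))"
  proof (intro exp_sum_sum exp_sum_cmult finite)
    fix i :: 'a
    have "exp_sum (\<lambda>l. exp (- (axis i 1 \<bullet> l)))"
      by (rule exp_sum_exp) (simp add: nonneg_orthant_def axis_def)
    then show "exp_sum (\<lambda>l. exp (- l $ i))"
      by (simp add: inner_axis' )
  qed
  moreover have "(\<lambda>l. p (\<chi> i. exp (- l $ i))) = (\<lambda>l. \<Sum>i\<in>UNIV. p (axis i 1) * exp (- l $ i))"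
    by (rule ext, subst P) (simp only: vec_lambda_beta)
  ultimately show ?case by simp
qed (auto intro: exp_sum_const exp_sum_add exp_sum_mult)

lemma sum_orthant_nonneg: "l \<in> nonneg_orthant \<Longrightarrow> 0 \<le> coord_sum l"
  by (auto simp: nonneg_orthant_def intro!: sum_nonneg)

lemma wbounded_exp:
  assumes "v \<in> nonneg_orthant" "0 \<le> \<epsilon>"
  shows "wbounded \<epsilon> 1 (\<lambda>l. exp (- (v \<bullet> l)))"
  unfolding wbounded_def
proof
  show "\<forall>l\<in>nonneg_orthant. \<bar>exp (- (v \<bullet> l))\<bar> \<le> 1 * exp (\<epsilon> * coord_sum l)"
  proof
    fix l :: "real ^ 'a" assume l: "l \<in> nonneg_orthant"
    have "0 \<le> v \<bullet> l"
      using l assms(1) by (auto simp: inner_vec_def nonneg_orthant_def intro!: sum_nonneg mult_nonneg_nonneg)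
    moreover have "0 \<le> \<epsilon> * coord_sum l"
      using sum_orthant_nonneg[OF l] assms(2) by simp
    ultimately show "\<bar>exp (- (v \<bullet> l))\<bar> \<le> 1 * exp (\<epsilon> * coord_sum l)"
      by simp
  qed
qed (intro continuous_intros)

lemma wfunctional_exp_sum:
  assumes L: "wfunctional \<epsilon> L" and "0 \<le> \<epsilon>" and e: "\<And>v. v \<in> nonneg_orthant \<Longrightarrow> L (\<lambda>l. exp (- (v \<bullet> l))) = 0"
    and p: "exp_sum p"
  shows "(\<exists>c. wbounded \<epsilon> c p) \<and> L p = 0"
  using p
proof induction
  case (exp_sum_exp v)
  then show ?case using wbounded_exp e assms(2) by blast
next
  case (exp_sum_cmult f a)
  then show ?case using L wbounded_cmult unfolding wfunctional_def by (metis mult_zero_right)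
next
  case (exp_sum_add f g)
  then show ?case using L wbounded_add unfolding wfunctional_def by (metis add_0)
qed

text \<open>After a cutoff, \<open>f\<close> is a continuous function of \<open>u = exp (- l)\<close> on the unit cube, hence
  uniformly close to a polynomial in \<open>u\<close>, that is, to a combination of exponentials of \<open>l\<close>.\<close>

lemma wfunctional_eq_0:
  fixes L :: "(real ^ 'n \<Rightarrow> real) \<Rightarrow> real" and f :: "real ^ 'n \<Rightarrow> real"
  assumes L: "wfunctional \<epsilon> L" and \<epsilon>: "0 \<le> \<epsilon>"
    and exp0: "\<And>v. v \<in> nonneg_orthant \<Longrightarrow> L (\<lambda>l. exp (- (v \<bullet> l))) = 0"
    and f: "wbounded \<epsilon> c f"
    and decay: "\<And>\<delta>. 0 < \<delta> \<Longrightarrow> \<exists>r. \<forall>l\<in>nonneg_orthant. r \<le> coord_sum l \<longrightarrow>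
      \<bar>f l\<bar> \<le> \<delta> * exp (\<epsilon> * coord_sum l)"
  shows "L f = 0"
proof -
  obtain B where B: "0 \<le> B" "\<And>c f. wbounded \<epsilon> c f \<Longrightarrow> \<bar>L f\<bar> \<le> B * c"
    using L unfolding wfunctional_def by blast
  have add: "L (\<lambda>l. f l + g l) = L f + L g" if "wbounded \<epsilon> c f" "wbounded \<epsilon> d g" for f g c d
    using L that unfolding wfunctional_def by blast
  have cmult: "L (\<lambda>l. a * f l) = a * L f" if "wbounded \<epsilon> c f" for a f c
    using L that unfolding wfunctional_def by blast
  have "\<bar>L f\<bar> \<le> B * (2 * \<delta>)" if \<delta>: "0 < \<delta>" for \<delta>
  proof -
    obtain r0 where r0: "\<And>l. l \<in> nonneg_orthant \<Longrightarrow> r0 \<le> coord_sum l \<Longrightarrow>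
      \<bar>f l\<bar> \<le> \<delta> * exp (\<epsilon> * coord_sum l)"
      using decay[OF \<delta>] by blast
    define r where "r = max 0 r0"
    define cut where "cut l = max 0 (min 1 (r + 1 - coord_sum l))" for l :: "real ^ 'n"
    define g where "g l = f l * cut l" for l
    have ccut: "continuous_on S cut" for S
      unfolding cut_def[abs_def] by (intro continuous_intros)
    have cf: "continuous_on nonneg_orthant f"
      using f by (simp add: wbounded_def)
    have cg: "continuous_on nonneg_orthant g"
      unfolding g_def[abs_def] by (intro continuous_intros cf ccut)
    \<comment> \<open>The inverse of l |-> exp (- l) with every coordinate capped at
      \<open>r + 1\<close>, which keeps it continuous up to \<open>u $ i = 0\<close>. The cap does
      not show in \<open>g\<close>, which vanishes on the orthant once a coordinate reaches
      \<open>r + 1\<close>.\<close>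
    define z where "z u = (\<chi> i. - ln (max (u $ i) (exp (- (r + 1)))))" for u :: "real ^ 'n"
    define C where "C = {u :: real ^ 'n. \<forall>i. 0 \<le> u $ i \<and> u $ i \<le> 1}"
    have "C = cbox 0 1"
      by (auto simp: C_def mem_box_cart)
    then have "compact C" by simp
    moreover have "continuous_on C (\<lambda>u. g (z u))"
    proof (rule continuous_on_compose2[OF cg])
      show "continuous_on C z"
        unfolding z_def by (intro continuous_intros) (auto simp: max_def)
      show "z ` C \<subseteq> nonneg_orthant"
      proof (rule image_subsetI)
        fix u :: "real ^ 'n" assume u: "u \<in> C"
        have "0 \<le> z u $ i" for i
        proof -
          have "max (u $ i) (exp (- (r + 1))) \<le> 1"
            using u by (auto simp: r_def C_def)
          moreover have "0 < max (u $ i) (exp (- (r + 1)))"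
            by (simp add: less_max_iff_disj)
          ultimately have "ln (max (u $ i) (exp (- (r + 1)))) \<le> 0"
            by (simp only: ln_le_zero_iff)
          then show ?thesis
            by (simp only: z_def vec_lambda_beta neg_0_le_iff_le)
        qed
        then show "z u \<in> nonneg_orthant"
          by (simp add: nonneg_orthant_def)
      qed
    qed
    ultimately obtain p where p: "real_polynomial_function p" "\<And>u. u \<in> C \<Longrightarrow> \<bar>g (z u) - p u\<bar> < \<delta>"
      using Stone_Weierstrass_real_polynomial_function \<delta> by blast
    define q where "q l = p (\<chi> i. exp (- l $ i))" for l
    have "exp_sum q"
      unfolding q_def[abs_def] by (rule exp_sum_polynomial[OF p(1)])
    from wfunctional_exp_sum[OF L \<epsilon> exp0 this]
    obtain d where d: "wbounded \<epsilon> d q" "L q = 0" by blast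
    have gq: "\<bar>g l - q l\<bar> \<le> \<delta>" if l: "l \<in> nonneg_orthant" for l
    proof -
      define u where "u = (\<chi> i. exp (- l $ i))"
      have "u \<in> C"
        using l by (auto simp: C_def u_def nonneg_orthant_def)
      have zu: "z u $ i = min (l $ i) (r + 1)" for i
        by (auto simp: z_def u_def max_def min_def)
      have "g (z u) = g l"
      proof (cases "\<exists>i. r + 1 \<le> l $ i")
        case True
        then obtain i where i: "r + 1 \<le> l $ i" by blast
        have r: "0 \<le> r" by (simp add: r_def)
        have "r + 1 \<le> coord_sum l"
          using member_le_sum[of i UNIV "\<lambda>i. l $ i"] i l by (auto simp: nonneg_orthant_def)
        moreover have "r + 1 \<le> (\<Sum>i\<in>UNIV. z u $ i)"
          using member_le_sum[of i UNIV "\<lambda>i. z u $ i"] i l r by (auto simp: nonneg_orthant_def zu)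
        ultimately show ?thesis
          by (simp add: g_def cut_def)
      next
        case False
        then have "l $ i \<le> r + 1" for i by (metis linear)
        then have "z u = l" by (simp add: vec_eq_iff zu min_def)
        then show ?thesis by simp
      qed
      then show ?thesis
        using p(2)[OF \<open>u \<in> C\<close>] by (simp add: q_def u_def)
    qed
    \<comment> \<open>One \<open>\<delta>\<close> comes from the cutoff, where \<open>f\<close> is
      already small, and one from the polynomial, as the weight is at least 1.\<close>
    have "wbounded \<epsilon> (2 * \<delta>) (\<lambda>l. f l + (- 1) * q l)"
      unfolding wbounded_def
    proof
      show "continuous_on nonneg_orthant (\<lambda>l. f l + - 1 * q l)"
        using d cf by (intro continuous_intros) (auto simp: wbounded_def)
      show "\<forall>l\<in>nonneg_orthant. \<bar>f l + - 1 * q l\<bar> \<le> 2 * \<delta> * exp (\<epsilon> * coord_sum l)"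
      proof
        fix l :: "real ^ 'n" assume l: "l \<in> nonneg_orthant"
        have cut: "0 \<le> cut l" "cut l \<le> 1" by (auto simp: cut_def)
        have "\<bar>f l - g l\<bar> \<le> \<delta> * exp (\<epsilon> * coord_sum l)"
        proof (cases "r \<le> coord_sum l")
          case True
          have "\<bar>f l - g l\<bar> = \<bar>f l\<bar> * (1 - cut l)"
            using cut abs_mult[of "f l" "1 - cut l"] by (simp add: g_def right_diff_distrib)
          also have "\<dots> \<le> \<bar>f l\<bar>"
            using cut by (simp add: mult_left_le)
          also have "\<dots> \<le> \<delta> * exp (\<epsilon> * coord_sum l)"
            using r0[OF l] True by (simp add: r_def)
          finally show ?thesis .
        next
          case False
          then have "cut l = 1" by (simp add: cut_def)
          then show ?thesis using \<delta> by (simp add: g_def)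
        qed
        moreover have "\<bar>g l - q l\<bar> \<le> \<delta> * exp (\<epsilon> * coord_sum l)"
        proof -
          have "1 \<le> exp (\<epsilon> * coord_sum l)"
            using \<epsilon> sum_orthant_nonneg[OF l] by simp
          then have "\<delta> * 1 \<le> \<delta> * exp (\<epsilon> * coord_sum l)"
            using \<delta> by (intro mult_left_mono) auto
          then show ?thesis
            using gq[OF l] by simp
        qed
        ultimately show "\<bar>f l + - 1 * q l\<bar> \<le> 2 * \<delta> * exp (\<epsilon> * coord_sum l)"
          by linarith
      qed
    qed
    from B(2)[OF this] show ?thesis
      using add[OF f wbounded_cmult[OF d(1), of "- 1"]] cmult[OF d(1), of "- 1"] d(2) by simp
  qed
  note bound = this
  have "\<bar>L f\<bar> \<le> 0 + e" if "0 < e" for e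
  proof -
    have "B * (2 * (e / (2 * (B + 1)))) = e * (B / (B + 1))"
      using B(1) by (simp add: field_simps)
    also have "\<dots> \<le> e * 1"
      using B(1) that by (intro mult_left_mono) auto
    finally show ?thesis
      using bound[of "e / (2 * (B + 1))"] B(1) that by simp
  qed
  then have "\<bar>L f\<bar> \<le> 0"
    by (rule field_le_epsilon)
  then show ?thesis by simp
qed

section \<open>Regularity of the test function\<close>

text \<open>The choice by \<open>THE\<close> is sound because 0 is a limit from the right of the
  admissible increments, which makes even the one-sided derivative unique.\<close>

lemma has_partial_derivative_partial_derivative:
  assumes "partially_differentiable i g" "l \<in> nonneg_orthant"
  shows "has_partial_derivative g i (partial_derivative i g l) l"
proof -
  obtain D where D: "has_partial_derivative g i D l"
    using assms unfolding partially_differentiable_def by blast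
  have S: "{t. l + t *\<^sub>R axis i 1 \<in> nonneg_orthant} = {- l $ i..}"
    using assms(2) by (auto simp: nonneg_orthant_def axis_def)
  have "at_right 0 \<le> at 0 within {- l $ i..}"
    using assms(2) by (intro at_le) (auto simp: nonneg_orthant_def intro: order_trans[of _ 0])
  then have nb: "at 0 within {- l $ i..} \<noteq> bot"
    by (metis bot.extremum_uniqueI trivial_limit_at_right_real)
  have "D' = D" if "has_partial_derivative g i D' l" for D'
    using that D nb unfolding has_partial_derivative_def S has_real_derivative_iff_has_vector_derivative
    by (rule vector_derivative_unique_within[rotated])
  with D show ?thesis
    unfolding partial_derivative_def by (rule theI)
qed

text \<open>Moving the base point to \<open>t\<close> turns increments in \<open>{- t..}\<close>
  into positions in \<open>{0..}\<close>, which reduces partial derivatives to calculus on the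
  half-line.\<close>

lemma slice_has_derivative:
  assumes g: "partially_differentiable i g" and l: "l \<in> nonneg_orthant" and t: "0 \<le> t"
  shows "((\<lambda>t. g (update l i t)) has_real_derivative partial_derivative i g (update l i t)) (at t within {0..})"
proof -
  define m where "m = update l i t"
  have m: "m \<in> nonneg_orthant"
    using l t by (simp add: m_def update_in_orthant)
  have S: "{u. m + u *\<^sub>R axis i 1 \<in> nonneg_orthant} = {- t..}"
    using l by (auto simp: nonneg_orthant_def axis_def m_def)
  have u: "m + u *\<^sub>R axis i 1 = update l i (t + u)" for u
    by (simp add: m_def vec_eq_iff axis_def)
  have "((\<lambda>u. g (update l i (t + u))) has_real_derivative partial_derivative i g m) (at 0 within {- t..})"
    using has_partial_derivative_partial_derivative[OF g m]
    unfolding has_partial_derivative_def S unfolding u .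
  then have "((\<lambda>t. g (update l i t)) has_real_derivative partial_derivative i g m) (at (t + 0) within (+) t ` {- t..})"
    by (subst DERIV_at_within_shift)
  then show ?thesis by (simp add: m_def)
qed

lemma nondecreasing_halfline:
  fixes \<phi> :: "real \<Rightarrow> real"
  assumes der: "\<And>t. 0 \<le> t \<Longrightarrow> (\<phi> has_real_derivative \<phi>' t) (at t within {0..})"
    and nn: "\<And>t. 0 < t \<Longrightarrow> 0 \<le> \<phi>' t" and "0 \<le> x" "x \<le> y"
  shows "\<phi> x \<le> \<phi> y"
proof (rule DERIV_nonneg_imp_increasing_open[OF \<open>x \<le> y\<close>])
  have "continuous_on {0..} \<phi>"
    using der by (intro DERIV_continuous_on) auto
  then show "continuous_on {x..y} \<phi>"
    by (rule continuous_on_subset) (use \<open>0 \<le> x\<close> in auto)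
  fix t assume "x < t" "t < y"
  then have t: "0 < t" using \<open>0 \<le> x\<close> by simp
  then have "(\<phi> has_real_derivative \<phi>' t) (at t)"
    using der[of t] at_within_interior[of t "{0..}"] by (simp add: interior_Ici)
  then show "\<exists>D. (\<phi> has_real_derivative D) (at t) \<and> 0 \<le> D"
    using nn[OF t] by blast
qed

lemma update_self [simp]: "update l i (l $ i) = l"
  by (simp add: vec_eq_iff)

text \<open>Young's theorem: squeeze the changed coordinate between two nearby values.\<close>

lemma continuous_on_orthant_if_monotone_slices:
  fixes f :: "real ^ 'n \<Rightarrow> real"
  assumes cont: "\<And>l i. l \<in> nonneg_orthant \<Longrightarrow> continuous_on {0..} (\<lambda>t. f (update l i t))"
    and mono: "\<And>i. (\<forall>l\<in>nonneg_orthant. \<forall>x y. 0 \<le> x \<longrightarrow> x \<le> y \<longrightarrow> f (update l i x) \<le> f (update l i y)) \<or>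
                    (\<forall>l\<in>nonneg_orthant. \<forall>x y. 0 \<le> x \<longrightarrow> x \<le> y \<longrightarrow> f (update l i y) \<le> f (update l i x))"
  shows "continuous_on nonneg_orthant f"
proof -
  \<comment> \<open>Induction over the set \<open>S\<close> of coordinates that are allowed to
    move.\<close>
  have main: "\<forall>l\<in>nonneg_orthant. \<forall>e>0. \<exists>d>0. \<forall>m\<in>nonneg_orthant.
      (\<forall>i\<in>S. \<bar>m $ i - l $ i\<bar> < d) \<and> (\<forall>i. i \<notin> S \<longrightarrow> m $ i = l $ i) \<longrightarrow> \<bar>f m - f l\<bar> < e" for S :: "'n set"
  proof (induction S rule: finite_induct[OF finite])
    case 1
    have "\<bar>f m - f l\<bar> < e" if "\<forall>i. m $ i = l $ i" "0 < e" for m l :: "real ^ 'n" and e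
    proof -
      have "m = l" using that by (simp add: vec_eq_iff)
      then show ?thesis using that by simp
    qed
    then show ?case by (auto intro!: exI[of _ 1])
  next
    case (2 i S)
    show ?case
    proof (intro ballI allI impI)
      fix l :: "real ^ 'n" and e :: real assume l: "l \<in> nonneg_orthant" and e: "0 < e"
      have li: "0 \<le> l $ i" using l by (simp add: nonneg_orthant_def)
      obtain d1 where d1: "0 < d1" "\<And>t. 0 \<le> t \<Longrightarrow> \<bar>t - l $ i\<bar> < d1 \<Longrightarrow> \<bar>f (update l i t) - f l\<bar> < e / 2"
      proof -
        have "\<exists>d>0. \<forall>t\<in>{0..}. dist t (l $ i) < d \<longrightarrow> dist (f (update l i t)) (f (update l i (l $ i))) < e / 2"
          using cont[OF l, of i] li half_gt_zero[OF e] unfolding continuous_on_iff by blast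
        then show thesis
          using that by (auto simp: dist_real_def)
      qed
      \<comment> \<open>The cutoff at 0 keeps \<open>lo\<close> in the orthant. For
        \<open>m $ i\<close> within \<open>d1 / 2\<close> of \<open>l $ i\<close>, monotonicity puts
        \<open>f m\<close> between the values at \<open>lo\<close> and \<open>hi\<close>; these are
        handled by the induction hypothesis, as only coordinates in \<open>S\<close> still
        move.\<close>
      define lo where "lo = max 0 (l $ i - d1 / 2)"
      define hi where "hi = l $ i + d1 / 2"
      have lohi: "0 \<le> lo" "0 \<le> hi" "\<bar>lo - l $ i\<bar> < d1" "\<bar>hi - l $ i\<bar> < d1"
        using li d1 by (auto simp: lo_def hi_def)
      have near: "\<exists>d>0. \<forall>m\<in>nonneg_orthant. (\<forall>j\<in>S. \<bar>m $ j - l $ j\<bar> < d) \<and> (\<forall>j. j \<notin> insert i S \<longrightarrow> m $ j = l $ j) \<longrightarrow>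
          \<bar>f (update m i t) - f l\<bar> < e" if t: "0 \<le> t" "\<bar>t - l $ i\<bar> < d1" for t
      proof -
        obtain d where d: "0 < d" "\<And>m. m \<in> nonneg_orthant \<Longrightarrow> \<forall>j\<in>S. \<bar>m $ j - update l i t $ j\<bar> < d \<Longrightarrow>
            \<forall>j. j \<notin> S \<longrightarrow> m $ j = update l i t $ j \<Longrightarrow> \<bar>f m - f (update l i t)\<bar> < e / 2"
          using 2(3) update_in_orthant[OF l t(1), of i] e half_gt_zero by metis
        show ?thesis
        proof (intro exI[of _ d] conjI ballI impI d(1))
          fix m :: "real ^ 'n" assume m: "m \<in> nonneg_orthant"
            "(\<forall>j\<in>S. \<bar>m $ j - l $ j\<bar> < d) \<and> (\<forall>j. j \<notin> insert i S \<longrightarrow> m $ j = l $ j)"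
          have "\<bar>f (update m i t) - f (update l i t)\<bar> < e / 2"
            using m 2(2) d(1) by (intro d(2) update_in_orthant m(1) t(1)) auto
          then show "\<bar>f (update m i t) - f l\<bar> < e"
            using d1(2)[OF t] by linarith
        qed
      qed
      obtain d2 where d2: "0 < d2" "\<And>m. m \<in> nonneg_orthant \<Longrightarrow> \<forall>j\<in>S. \<bar>m $ j - l $ j\<bar> < d2 \<Longrightarrow>
          \<forall>j. j \<notin> insert i S \<longrightarrow> m $ j = l $ j \<Longrightarrow> \<bar>f (update m i lo) - f l\<bar> < e"
        using near[OF lohi(1,3)] by blast
      obtain d3 where d3: "0 < d3" "\<And>m. m \<in> nonneg_orthant \<Longrightarrow> \<forall>j\<in>S. \<bar>m $ j - l $ j\<bar> < d3 \<Longrightarrow>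
          \<forall>j. j \<notin> insert i S \<longrightarrow> m $ j = l $ j \<Longrightarrow> \<bar>f (update m i hi) - f l\<bar> < e"
        using near[OF lohi(2,4)] by blast
      show "\<exists>d>0. \<forall>m\<in>nonneg_orthant. (\<forall>j\<in>insert i S. \<bar>m $ j - l $ j\<bar> < d) \<and>
          (\<forall>j. j \<notin> insert i S \<longrightarrow> m $ j = l $ j) \<longrightarrow> \<bar>f m - f l\<bar> < e"
      proof (intro exI[of _ "min (d1 / 2) (min d2 d3)"] conjI ballI impI)
        show "0 < min (d1 / 2) (min d2 d3)" using d1 d2 d3 by simp
        fix m :: "real ^ 'n" assume m: "m \<in> nonneg_orthant"
          "(\<forall>j\<in>insert i S. \<bar>m $ j - l $ j\<bar> < min (d1 / 2) (min d2 d3)) \<and> (\<forall>j. j \<notin> insert i S \<longrightarrow> m $ j = l $ j)"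
        then have "\<bar>f (update m i lo) - f l\<bar> < e" "\<bar>f (update m i hi) - f l\<bar> < e"
          by (auto intro!: d2(2) d3(2))
        moreover have "\<bar>m $ i - l $ i\<bar> < d1 / 2" "0 \<le> m $ i"
          using m by (auto simp: nonneg_orthant_def)
        then have "lo \<le> m $ i" "m $ i \<le> hi" "0 \<le> m $ i"
          unfolding lo_def hi_def by linarith+
        then have "f (update m i lo) \<le> f m \<and> f m \<le> f (update m i hi) \<or> f (update m i hi) \<le> f m \<and> f m \<le> f (update m i lo)"
          using mono[of i] m(1) lohi(1) by (metis update_self)
        ultimately show "\<bar>f m - f l\<bar> < e" by linarith
      qed
    qed
  qed
  show ?thesis
    unfolding continuous_on_iff
  proof (intro ballI allI impI)
    fix l :: "real ^ 'n" and e :: real assume l: "l \<in> nonneg_orthant" "0 < e"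
    obtain d where d: "0 < d" "\<And>m. m \<in> nonneg_orthant \<Longrightarrow> \<forall>i. \<bar>m $ i - l $ i\<bar> < d \<Longrightarrow> \<bar>f m - f l\<bar> < e"
      using main[of UNIV] l by (metis UNIV_I)
    show "\<exists>d>0. \<forall>m\<in>nonneg_orthant. dist m l < d \<longrightarrow> dist (f m) (f l) < e"
    proof (intro exI[of _ d] conjI ballI impI d(1))
      fix m assume m: "m \<in> nonneg_orthant" "dist m l < d"
      have "\<bar>m $ i - l $ i\<bar> < d" for i
        using dist_vec_nth_le[of m i l] m(2) by (simp add: dist_real_def)
      then show "dist (f m) (f l) < e"
        using d(2)[OF m(1)] by (simp add: dist_real_def)
    qed
  qed
qed

text \<open>Outside a ball the growth condition gives exp (\<epsilon> |l|), and on the orthant the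
  norm is at most the coordinate sum. Inside, continuity on a compact set bounds \<open>f\<close>.
  The radius is at least 1, so that the norm can be divided by outside.\<close>

lemma wbounded_if_subexponential:
  fixes f :: "real ^ 'n \<Rightarrow> real"
  assumes cont: "continuous_on nonneg_orthant f" and sub: "subexponential_growth f" and \<epsilon>: "0 < \<epsilon>"
  shows "\<exists>c. wbounded \<epsilon> c f"
proof -
  have "\<forall>\<^sub>F l in inf at_infinity (principal nonneg_orthant). dist (ln (1 + \<bar>f l\<bar>) / norm l) 0 < \<epsilon>"
    using sub \<epsilon> unfolding subexponential_growth_def by (rule tendstoD)
  then obtain r where r: "\<And>l. l \<in> nonneg_orthant \<Longrightarrow> r \<le> norm l \<Longrightarrow> \<bar>ln (1 + \<bar>f l\<bar>) / norm l\<bar> < \<epsilon>"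
    unfolding eventually_inf_principal eventually_at_infinity by (auto simp: dist_real_def)
  define K where "K = max 1 r"
  have "compact (cball 0 K \<inter> nonneg_orthant :: (real ^ 'n) set)"
    by (intro compact_Int_closed compact_cball closed_nonneg_orthant)
  moreover have "continuous_on (cball 0 K \<inter> nonneg_orthant) f"
    by (rule continuous_on_subset[OF cont]) auto
  ultimately have "bounded (f ` (cball 0 K \<inter> nonneg_orthant))"
    by (intro compact_imp_bounded compact_continuous_image)
  then obtain B where B: "\<And>l. l \<in> nonneg_orthant \<Longrightarrow> norm l \<le> K \<Longrightarrow> \<bar>f l\<bar> \<le> B"
    unfolding bounded_iff by (metis IntI image_eqI mem_cball_0 real_norm_def)
  define c where "c = max 1 B"
  have "\<bar>f l\<bar> \<le> c * exp (\<epsilon> * coord_sum l)" if l: "l \<in> nonneg_orthant" for l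
  proof (cases "norm l \<le> K")
    case True
    have "1 \<le> exp (\<epsilon> * coord_sum l)"
      using \<epsilon> sum_orthant_nonneg[OF l] by simp
    then have "c * 1 \<le> c * exp (\<epsilon> * coord_sum l)"
      by (intro mult_left_mono) (auto simp: c_def)
    then show ?thesis
      using B[OF l True] by (simp add: c_def)
  next
    case False
    then have n: "0 < norm l" "r \<le> norm l" by (auto simp: K_def)
    then have "ln (1 + \<bar>f l\<bar>) < \<epsilon> * norm l"
      using r[OF l n(2)] by (auto simp: abs_less_iff divide_less_eq)
    then have "1 + \<bar>f l\<bar> < exp (\<epsilon> * norm l)"
      by (metis add_pos_nonneg abs_ge_zero exp_less_mono exp_ln zero_less_one)
    also have "\<dots> \<le> exp (\<epsilon> * coord_sum l)"
      using norm_le_l1_cart[of l] l \<epsilon> by (auto simp: nonneg_orthant_def intro!: mult_left_mono)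
    also have "\<dots> \<le> c * exp (\<epsilon> * coord_sum l)"
      by (simp add: c_def)
    finally show ?thesis by simp
  qed
  then show ?thesis
    using cont unfolding wbounded_def by blast
qed

lemma wbounded_nonneg: "wbounded \<epsilon> c f \<Longrightarrow> 0 \<le> c"
  unfolding wbounded_def by (drule conjunct2, drule bspec[of _ _ 0]) auto

lemma wbounded_mono:
  assumes "wbounded \<epsilon> c f" "\<epsilon> \<le> \<epsilon>'"
  shows "wbounded \<epsilon>' c f"
  unfolding wbounded_def
proof
  show "\<forall>l\<in>nonneg_orthant. \<bar>f l\<bar> \<le> c * exp (\<epsilon>' * coord_sum l)"
  proof
    fix l :: "real ^ 'a" assume l: "l \<in> nonneg_orthant"
    have "\<bar>f l\<bar> \<le> c * exp (\<epsilon> * coord_sum l)"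
      using assms l by (simp add: wbounded_def)
    also have "\<dots> \<le> c * exp (\<epsilon>' * coord_sum l)"
      using assms wbounded_nonneg[OF assms(1)] sum_orthant_nonneg[OF l]
      by (intro mult_left_mono) (auto intro!: mult_right_mono)
    finally show "\<bar>f l\<bar> \<le> c * exp (\<epsilon>' * coord_sum l)" .
  qed
qed (use assms in \<open>simp add: wbounded_def\<close>)

text \<open>The gap between the two weights supplies the decay hypothesis of
  \<open>wfunctional_eq_0\<close>.\<close>

lemma wbounded_decay:
  assumes f: "wbounded \<epsilon> c f" and "\<epsilon> < \<epsilon>'" "0 < \<delta>"
  shows "\<exists>r. \<forall>l\<in>nonneg_orthant. r \<le> coord_sum l \<longrightarrow> \<bar>f l\<bar> \<le> \<delta> * exp (\<epsilon>' * coord_sum l)"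
\<comment> \<open>From this radius on, the gain exp ((\<epsilon>' - \<epsilon>) sum l_i) is at least
  (c + 1) / \<delta>; \<open>c + 1\<close> stands in for \<open>c\<close>, which may be 0, under the
  logarithm.\<close>
proof (intro exI[of _ "ln ((c + 1) / \<delta>) / (\<epsilon>' - \<epsilon>)"] ballI impI)
  fix l :: "real ^ 'a"
  assume l: "l \<in> nonneg_orthant" and r: "ln ((c + 1) / \<delta>) / (\<epsilon>' - \<epsilon>) \<le> coord_sum l"
  define S where "S = coord_sum l"
  have c: "0 < c + 1" using wbounded_nonneg[OF f] by simp
  have "ln ((c + 1) / \<delta>) \<le> (\<epsilon>' - \<epsilon>) * S"
    using r assms(2) by (simp add: S_def field_simps)
  then have "(c + 1) / \<delta> \<le> exp ((\<epsilon>' - \<epsilon>) * S)"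
    using c assms(3) by (metis divide_pos_pos exp_le_cancel_iff exp_ln)
  then have "c \<le> \<delta> * exp ((\<epsilon>' - \<epsilon>) * S)"
    using assms(3) by (simp add: field_simps)
  then have "c * exp (\<epsilon> * S) \<le> \<delta> * exp ((\<epsilon>' - \<epsilon>) * S) * exp (\<epsilon> * S)"
    by (intro mult_right_mono) auto
  also have "\<dots> = \<delta> * exp (\<epsilon>' * S)"
    by (simp add: mult.assoc exp_add[symmetric] algebra_simps)
  finally have "c * exp (\<epsilon> * S) \<le> \<delta> * exp (\<epsilon>' * S)" .
  moreover have "\<bar>f l\<bar> \<le> c * exp (\<epsilon> * S)"
    using f l by (simp add: wbounded_def S_def)
  ultimately show "\<bar>f l\<bar> \<le> \<delta> * exp (\<epsilon>' * coord_sum l)"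
    by (simp add: S_def)
qed

text \<open>The sign of \<open>\<partial>\<^sub>if + l\<^sub>i \<partial>\<^sub>i\<^sub>if\<close> makes \<open>l\<^sub>i \<partial>\<^sub>if\<close> monotone in \<open>l\<^sub>i\<close>; as it vanishes for \<open>l\<^sub>i = 0\<close>,
  \<open>\<partial>\<^sub>if\<close> has a constant sign as well.\<close>

lemma diag_monotone:
  fixes f :: "real ^ 'n \<Rightarrow> real" and \<sigma> :: real
  assumes f1: "partially_differentiable i f" and f2: "partially_differentiable i (partial_derivative i f)"
    and sgn: "\<And>l. l \<in> nonneg_orthant \<Longrightarrow> 0 \<le> \<sigma> * (partial_derivative i f l + l $ i * partial_derivative2 i i f l)"
    and l: "l \<in> nonneg_orthant" and xy: "0 \<le> x" "x \<le> y"
  shows "x * (\<sigma> * partial_derivative i f (update l i x)) \<le> y * (\<sigma> * partial_derivative i f (update l i y))"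
    and "\<sigma> * f (update l i x) \<le> \<sigma> * f (update l i y)"
proof -
  have *: "x * (\<sigma> * partial_derivative i f (update l i x)) \<le> y * (\<sigma> * partial_derivative i f (update l i y))"
    if "0 \<le> x" "x \<le> y" for x y
    using that
  proof (rule nondecreasing_halfline[rotated 2])
    fix t :: real
    show "((\<lambda>t. t * (\<sigma> * partial_derivative i f (update l i t))) has_real_derivative
        \<sigma> * (partial_derivative i f (update l i t) + t * partial_derivative2 i i f (update l i t))) (at t within {0..})" if "0 \<le> t"
      unfolding partial_derivative2_def
      by (auto intro!: derivative_eq_intros slice_has_derivative[OF f2 l that] simp: algebra_simps)
    show "0 \<le> \<sigma> * (partial_derivative i f (update l i t) + t * partial_derivative2 i i f (update l i t))" if "0 < t"
      using sgn[of "update l i t"] that l by (simp add: update_in_orthant)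
  qed
  then show "x * (\<sigma> * partial_derivative i f (update l i x)) \<le> y * (\<sigma> * partial_derivative i f (update l i y))"
    using xy .
  show "\<sigma> * f (update l i x) \<le> \<sigma> * f (update l i y)"
    using xy
  proof (rule nondecreasing_halfline[rotated 2])
    fix t :: real
    show "((\<lambda>t. \<sigma> * f (update l i t)) has_real_derivative \<sigma> * partial_derivative i f (update l i t)) (at t within {0..})" if "0 \<le> t"
      by (intro DERIV_cmult slice_has_derivative[OF f1 l that])
    show "0 \<le> \<sigma> * partial_derivative i f (update l i t)" if "0 < t"
      using *[of 0 t] that by (simp add: zero_le_mult_iff)
  qed
qed

text \<open>The sign of the mixed derivative makes \<open>\<sigma> * partial_derivative j f\<close>
  nondecreasing in l_i. Hence the increment of \<open>\<sigma> * f\<close> between l_i = x and l_i =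
  x' has a nonnegative derivative in l_j, and two applications of monotonicity replace a double
  integral.\<close>

lemma off_diag_supermodular:
  fixes f :: "real ^ 'n \<Rightarrow> real" and \<sigma> :: real
  assumes f1: "partially_differentiable j f" and f2: "partially_differentiable i (partial_derivative j f)"
    and sgn: "\<And>l. l \<in> nonneg_orthant \<Longrightarrow> 0 \<le> \<sigma> * partial_derivative2 i j f l"
    and l: "l \<in> nonneg_orthant" and x: "0 \<le> x" "x \<le> x'" and y: "0 \<le> y" "y \<le> y'" and ij: "i \<noteq> j"
  shows "\<sigma> * f (update (update l i x') j y) + \<sigma> * f (update (update l i x) j y')
      \<le> \<sigma> * f (update (update l i x') j y') + \<sigma> * f (update (update l i x) j y)"
proof -
  have mono: "\<sigma> * partial_derivative j f (update m i x) \<le> \<sigma> * partial_derivative j f (update m i x')"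
    if m: "m \<in> nonneg_orthant" for m
    using x
  proof (rule nondecreasing_halfline[rotated 2])
    fix t :: real
    show "((\<lambda>t. \<sigma> * partial_derivative j f (update m i t)) has_real_derivative
        \<sigma> * partial_derivative2 i j f (update m i t)) (at t within {0..})" if "0 \<le> t"
      unfolding partial_derivative2_def by (intro DERIV_cmult slice_has_derivative[OF f2 m that])
    show "0 \<le> \<sigma> * partial_derivative2 i j f (update m i t)" if "0 < t"
      using that m by (intro sgn update_in_orthant) auto
  qed
  have x': "0 \<le> x'" using x by simp
  have "\<sigma> * f (update (update l i x') j y) - \<sigma> * f (update (update l i x) j y)
      \<le> \<sigma> * f (update (update l i x') j y') - \<sigma> * f (update (update l i x) j y')"
    using y
  proof (rule nondecreasing_halfline[rotated 2])
    fix t :: real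
    show "((\<lambda>t. \<sigma> * f (update (update l i x') j t) - \<sigma> * f (update (update l i x) j t)) has_real_derivative
        \<sigma> * partial_derivative j f (update (update l i x') j t) - \<sigma> * partial_derivative j f (update (update l i x) j t))
        (at t within {0..})" if "0 \<le> t"
      using that x x' l by (intro DERIV_diff DERIV_cmult slice_has_derivative[OF f1] update_in_orthant)
    have "update (update l i z) j t = update (update l j t) i z" for z
      using ij by (auto simp: vec_eq_iff)
    then show "0 \<le> \<sigma> * partial_derivative j f (update (update l i x') j t) - \<sigma> * partial_derivative j f (update (update l i x) j t)"
      if "0 < t"
      using mono[of "update l j t"] that l by (simp add: update_in_orthant)
  qed
  then show ?thesis by simp
qed

section \<open>Expectations and series of second differences as bounded functionals\<close>

lemma wfunctionalI:
  assumes "\<And>c d f g. wbounded \<epsilon> c f \<Longrightarrow> wbounded \<epsilon> d g \<Longrightarrow> L (\<lambda>l. f l + g l) = L f + L g"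
    and "\<And>c a f. wbounded \<epsilon> c f \<Longrightarrow> L (\<lambda>l. a * f l) = a * L f"
    and "0 \<le> B" "\<And>c f. wbounded \<epsilon> c f \<Longrightarrow> \<bar>L f\<bar> \<le> B * c"
  shows "wfunctional \<epsilon> L"
  using assms unfolding wfunctional_def by blast

lemma wfunctionalD:
  assumes "wfunctional \<epsilon> L"
  obtains B where "0 \<le> B" "\<And>c f. wbounded \<epsilon> c f \<Longrightarrow> \<bar>L f\<bar> \<le> B * c"
    "\<And>c d f g. wbounded \<epsilon> c f \<Longrightarrow> wbounded \<epsilon> d g \<Longrightarrow> L (\<lambda>l. f l + g l) = L f + L g"
    "\<And>c a f. wbounded \<epsilon> c f \<Longrightarrow> L (\<lambda>l. a * f l) = a * L f"
  using assms unfolding wfunctional_def by blast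

lemma wfunctional_cmult:
  assumes "wfunctional \<epsilon> L"
  shows "wfunctional \<epsilon> (\<lambda>f. a * L f)"
proof -
  from assms obtain B where B: "0 \<le> B" "\<And>c f. wbounded \<epsilon> c f \<Longrightarrow> \<bar>L f\<bar> \<le> B * c"
    "\<And>c d f g. wbounded \<epsilon> c f \<Longrightarrow> wbounded \<epsilon> d g \<Longrightarrow> L (\<lambda>l. f l + g l) = L f + L g"
    "\<And>c a f. wbounded \<epsilon> c f \<Longrightarrow> L (\<lambda>l. a * f l) = a * L f"
    by (rule wfunctionalD) blast
  show ?thesis
  proof (rule wfunctionalI)
    show "0 \<le> \<bar>a\<bar> * B" using B(1) by simp
    show "\<bar>a * L f\<bar> \<le> (\<bar>a\<bar> * B) * c" if "wbounded \<epsilon> c f" for c f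
      using B(2)[OF that] by (simp add: abs_mult mult.assoc mult_left_mono)
    show "a * L (\<lambda>l. f l + g l) = a * L f + a * L g" if "wbounded \<epsilon> c f" "wbounded \<epsilon> d g" for c d f g
      using B(3)[OF that] by (simp add: distrib_left)
    show "a * L (\<lambda>l. b * f l) = b * (a * L f)" if "wbounded \<epsilon> c f" for c b f
      using B(4)[OF that] by simp
  qed
qed

lemma wfunctional_add:
  assumes "wfunctional \<epsilon> L" "wfunctional \<epsilon> K"
  shows "wfunctional \<epsilon> (\<lambda>f. L f + K f)"
proof -
  from assms(1) obtain B where B: "0 \<le> B" "\<And>c f. wbounded \<epsilon> c f \<Longrightarrow> \<bar>L f\<bar> \<le> B * c"
    "\<And>c d f g. wbounded \<epsilon> c f \<Longrightarrow> wbounded \<epsilon> d g \<Longrightarrow> L (\<lambda>l. f l + g l) = L f + L g"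
    "\<And>c a f. wbounded \<epsilon> c f \<Longrightarrow> L (\<lambda>l. a * f l) = a * L f"
    by (rule wfunctionalD) blast
  from assms(2) obtain C where C: "0 \<le> C" "\<And>c f. wbounded \<epsilon> c f \<Longrightarrow> \<bar>K f\<bar> \<le> C * c"
    "\<And>c d f g. wbounded \<epsilon> c f \<Longrightarrow> wbounded \<epsilon> d g \<Longrightarrow> K (\<lambda>l. f l + g l) = K f + K g"
    "\<And>c a f. wbounded \<epsilon> c f \<Longrightarrow> K (\<lambda>l. a * f l) = a * K f"
    by (rule wfunctionalD) blast
  show ?thesis
  proof (rule wfunctionalI)
    show "0 \<le> B + C" using B(1) C(1) by simp
    show "\<bar>L f + K f\<bar> \<le> (B + C) * c" if "wbounded \<epsilon> c f" for c f
      using B(2)[OF that] C(2)[OF that] by (simp add: distrib_right)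
    show "L (\<lambda>l. f l + g l) + K (\<lambda>l. f l + g l) = L f + K f + (L g + K g)"
      if "wbounded \<epsilon> c f" "wbounded \<epsilon> d g" for c d f g
      using B(3)[OF that] C(3)[OF that] by simp
    show "L (\<lambda>l. b * f l) + K (\<lambda>l. b * f l) = b * (L f + K f)" if "wbounded \<epsilon> c f" for c b f
      using B(4)[OF that] C(4)[OF that] by (simp add: distrib_left)
  qed
qed

lemma wfunctional_diff:
  "wfunctional \<epsilon> L \<Longrightarrow> wfunctional \<epsilon> K \<Longrightarrow> wfunctional \<epsilon> (\<lambda>f. L f - K f)"
  using wfunctional_add[OF _ wfunctional_cmult[of \<epsilon> K "- 1"], of L] by simp

lemma wfunctional_sum:
  "finite I \<Longrightarrow> (\<And>i. i \<in> I \<Longrightarrow> wfunctional \<epsilon> (L i)) \<Longrightarrow> wfunctional \<epsilon> (\<lambda>f. \<Sum>i\<in>I. L i f)"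
proof (induction I rule: finite_induct)
  case empty
  show ?case by (rule wfunctionalI[where B = 0]) auto
qed (auto intro: wfunctional_add)

lemma integrable_wbounded:
  assumes X: "X \<in> borel_measurable M" "\<And>w. w \<in> space M \<Longrightarrow> X w \<in> nonneg_orthant"
    and int: "integrable M (\<lambda>w. exp (\<epsilon> * coord_sum (X w)))"
    and f: "wbounded \<epsilon> c f"
  shows "integrable M (\<lambda>w. f (X w))"
    and "\<bar>\<integral>w. f (X w) \<partial>M\<bar> \<le> (\<integral>w. exp (\<epsilon> * coord_sum (X w)) \<partial>M) * c"
proof -
  have b: "\<bar>f (X w)\<bar> \<le> c * exp (\<epsilon> * coord_sum (X w))" if "w \<in> space M" for w
    using f X(2)[OF that] by (simp add: wbounded_def)
  show i: "integrable M (\<lambda>w. f (X w))"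
  proof (rule Bochner_Integration.integrable_bound)
    show "integrable M (\<lambda>w. c * exp (\<epsilon> * coord_sum (X w)))"
      by (intro integrable_mult_right int)
    show "(\<lambda>w. f (X w)) \<in> borel_measurable M"
      using f X by (intro borel_measurable_orthant) (auto simp: wbounded_def)
    show "AE w in M. norm (f (X w)) \<le> norm (c * exp (\<epsilon> * coord_sum (X w)))"
      using b by (intro AE_I2) (metis abs_ge_self order_trans real_norm_def)
  qed
  have "\<bar>\<integral>w. f (X w) \<partial>M\<bar> \<le> (\<integral>w. c * exp (\<epsilon> * coord_sum (X w)) \<partial>M)"
    using i int b by (intro integral_abs_bound[THEN order_trans] integral_mono) auto
  then show "\<bar>\<integral>w. f (X w) \<partial>M\<bar> \<le> (\<integral>w. exp (\<epsilon> * coord_sum (X w)) \<partial>M) * c"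
    by (simp add: mult.commute)
qed

lemma wfunctional_expectation:
  assumes X: "X \<in> borel_measurable M" "\<And>w. w \<in> space M \<Longrightarrow> X w \<in> nonneg_orthant"
    and int: "integrable M (\<lambda>w. exp (\<epsilon> * coord_sum (X w)))"
  shows "wfunctional \<epsilon> (\<lambda>f. \<integral>w. f (X w) \<partial>M)"
proof (rule wfunctionalI)
  show "(\<integral>w. f (X w) + g (X w) \<partial>M) = (\<integral>w. f (X w) \<partial>M) + (\<integral>w. g (X w) \<partial>M)"
    if "wbounded \<epsilon> c f" "wbounded \<epsilon> d g" for c d f g
    by (rule Bochner_Integration.integral_add[OF integrable_wbounded(1)[OF X int that(1)]
        integrable_wbounded(1)[OF X int that(2)]])
  show "0 \<le> (\<integral>w. exp (\<epsilon> * coord_sum (X w)) \<partial>M)"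
    by simp
qed (use integrable_wbounded(2)[OF X int] in auto)

text \<open>The size of the coefficients in \<open>second_diff i j\<close>: on the diagonal they
  grow like \<open>k i + 1\<close>, and a series of second differences is controlled by summability
  against this factor.\<close>

definition diff_weight :: "'n \<Rightarrow> 'n \<Rightarrow> ('n \<Rightarrow> nat) \<Rightarrow> real" where
  "diff_weight i j k = (if i = j then real (Suc (k i)) else 1)"

abbreviation growth :: "real \<Rightarrow> 'n::finite \<Rightarrow> 'n \<Rightarrow> ('n \<Rightarrow> nat) \<Rightarrow> real" where
  "growth R i j k \<equiv> diff_weight i j k * R ^ multideg k"

text \<open>The constant 4 counts the values of \<open>F\<close> that enter, and
  \<open>R ^ 2\<close> allows for their degree, which exceeds that of \<open>k\<close> by at most
  2.\<close>

lemma abs_second_diff_le: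
  fixes F :: "('n::finite \<Rightarrow> nat) \<Rightarrow> real"
  assumes F: "\<And>k. \<bar>F k\<bar> \<le> C * R ^ multideg k" and R: "1 \<le> R" and C: "0 \<le> C"
  shows "\<bar>second_diff i j F k\<bar> \<le> 4 * C * R ^ 2 * growth R i j k"
proof -
  define S where "S = multideg k"
  define K where "K = C * R ^ (S + 2)"
  have K: "\<bar>F m\<bar> \<le> K" if "(\<Sum>a\<in>UNIV. m a) \<le> S + 2" for m
    using F[of m] power_increasing[OF that R] C unfolding K_def
    by (meson mult_left_mono order_trans)
  have upd: "(\<Sum>a\<in>UNIV. (m(b := p)) a) = (\<Sum>a\<in>UNIV. m a) - m b + p" for m :: "'n \<Rightarrow> nat" and b p
  proof -
    have "(\<Sum>a\<in>UNIV. (m(b := p)) a) = p + (\<Sum>a\<in>UNIV - {b}. m a)"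
      by (subst sum.remove[of UNIV b]) (auto intro!: sum.cong)
    moreover have "(\<Sum>a\<in>UNIV. m a) = m b + (\<Sum>a\<in>UNIV - {b}. m a)"
      by (subst sum.remove[of UNIV b]) auto
    ultimately show ?thesis by simp
  qed
  have le: "m b \<le> (\<Sum>a\<in>UNIV. m a)" for m :: "'n \<Rightarrow> nat" and b
    using member_le_sum[of b UNIV m] by simp
  have "\<bar>second_diff i j F k\<bar> \<le> 4 * (diff_weight i j k * K)"
  proof (cases "i = j")
    case True
    have "(\<Sum>a\<in>UNIV. (k(i := Suc (k i))) a) \<le> S + 2" "(\<Sum>a\<in>UNIV. (k(i := k i - 1)) a) \<le> S + 2"
      using le[where m = k and b = i] upd[of k i "Suc (k i)"] upd[of k i "k i - 1"] unfolding S_def by linarith+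
    then have b: "\<bar>F (k(i := Suc (k i)))\<bar> \<le> K" "\<bar>F k\<bar> \<le> K" "\<bar>F (k(i := k i - 1))\<bar> \<le> K"
      by (blast intro: K, simp add: K S_def, blast intro: K)
    have "\<bar>second_diff i j F k\<bar> \<le> real (Suc (k i)) * \<bar>F (k(i := Suc (k i))) - F k\<bar> + real (k i) * \<bar>F k - F (k(i := k i - 1))\<bar>"
      using True abs_triangle_ineq4[of "real (Suc (k i)) * (F (k(i := Suc (k i))) - F k)" "real (k i) * (F k - F (k(i := k i - 1)))"]
      by (simp add: second_diff_def abs_mult del: of_nat_Suc)
    also have "\<dots> \<le> real (Suc (k i)) * (2 * K) + real (Suc (k i)) * (2 * K)"
      using b by (intro add_mono mult_mono) auto
    finally show ?thesis
      using True by (simp add: diff_weight_def mult.commute)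
  next
    case False
    have "(\<Sum>a\<in>UNIV. (k(i := Suc (k i))) a) \<le> S + 2" "(\<Sum>a\<in>UNIV. (k(j := Suc (k j))) a) \<le> S + 2"
      using le[where m = k and b = i] upd[of k i "Suc (k i)"] le[where m = k and b = j] upd[of k j "Suc (k j)"]
      unfolding S_def by linarith+
    moreover have "(\<Sum>a\<in>UNIV. (k(i := Suc (k i), j := Suc (k j))) a) \<le> S + 2"
    proof -
      have "(k(i := Suc (k i))) j = k j" using False by simp
      then show ?thesis
        using le[where m = k and b = i] le[where m = "k(i := Suc (k i))" and b = j]
          upd[of k i "Suc (k i)"] upd[of "k(i := Suc (k i))" j "Suc (k j)"]
        unfolding S_def by linarith
    qed
    ultimately have b: "\<bar>F (k(i := Suc (k i), j := Suc (k j)))\<bar> \<le> K" "\<bar>F (k(i := Suc (k i)))\<bar> \<le> K"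
        "\<bar>F (k(j := Suc (k j)))\<bar> \<le> K" "\<bar>F k\<bar> \<le> K"
      by (blast intro: K, blast intro: K, blast intro: K, simp add: K S_def)
    show ?thesis
      using False b by (simp add: second_diff_def diff_weight_def)
  qed
  also have "\<dots> = 4 * C * R ^ 2 * (diff_weight i j k * R ^ S)"
    by (simp add: K_def power_add power2_eq_square)
  finally show ?thesis by (simp add: S_def)
qed

lemma second_diff_add: "second_diff i j (\<lambda>k. F k + H k) k = second_diff i j F k + second_diff i j H k"
  by (simp add: second_diff_def distrib_left right_diff_distrib)

lemma second_diff_cmult: "second_diff i j (\<lambda>k. a * F k) k = a * second_diff i j F k"
  by (simp add: second_diff_def distrib_left right_diff_distrib mult.left_commute)

text \<open>\<open>s * (1 - 1 / R)\<close> is the weight \<epsilon> for which s / (s - \<epsilon>)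
  equals \<open>R\<close>; the factor \<open>R ^ CARD('n)\<close> comes from the shapes
  \<open>k i + 1\<close>.\<close>

lemma abs_gamma_mean_le:
  fixes f :: "real ^ 'n \<Rightarrow> real"
  assumes s: "0 < s" and R: "1 \<le> R" and f: "wbounded (s * (1 - 1 / R)) c f"
  shows "\<bar>gamma_mean s f k\<bar> \<le> c * R ^ CARD('n) * R ^ multideg k"
proof -
  have "s * (1 - 1 / R) < s" "s / (s - s * (1 - 1 / R)) = R"
    using s R by (auto simp: field_simps)
  moreover have "(\<Sum>i\<in>UNIV. Suc (k i)) = CARD('n) + multideg k"
    using sum.distrib[of "\<lambda>_. 1" k UNIV] by simp
  ultimately show ?thesis
    using wbounded_gamma(2)[OF s _ f, of k] by (simp only: power_add mult.assoc)
qed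

lemma wfunctional_suminf:
  fixes L :: "nat \<Rightarrow> (real ^ 'n \<Rightarrow> real) \<Rightarrow> real"
  assumes add: "\<And>n c d f g. wbounded \<epsilon> c f \<Longrightarrow> wbounded \<epsilon> d g \<Longrightarrow> L n (\<lambda>l. f l + g l) = L n f + L n g"
    and cmult: "\<And>n c a f. wbounded \<epsilon> c f \<Longrightarrow> L n (\<lambda>l. a * f l) = a * L n f"
    and B: "\<And>n c f. wbounded \<epsilon> c f \<Longrightarrow> \<bar>L n f\<bar> \<le> B n * c" "\<And>n. 0 \<le> B n" "summable B"
  shows "wfunctional \<epsilon> (\<lambda>f. \<Sum>n. L n f)"
proof -
  have sabs: "summable (\<lambda>n. \<bar>L n f\<bar>)" if f: "wbounded \<epsilon> c f" for f c
    by (rule summable_comparison_test'[OF summable_mult2[OF B(3), of c]]) (use B(1)[OF f] in simp)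
  have sf: "summable (\<lambda>n. L n f)" if f: "wbounded \<epsilon> c f" for f c
    using sabs[OF f] by (rule summable_rabs_cancel)
  show ?thesis
  proof (rule wfunctionalI)
    show "(\<Sum>n. L n (\<lambda>l. f l + g l)) = (\<Sum>n. L n f) + (\<Sum>n. L n g)"
      if "wbounded \<epsilon> c f" "wbounded \<epsilon> d g" for c d f g
      using suminf_add[OF sf[OF that(1)] sf[OF that(2)]] add[OF that] by simp
    show "(\<Sum>n. L n (\<lambda>l. a * f l)) = a * (\<Sum>n. L n f)" if "wbounded \<epsilon> c f" for a c f
      using suminf_mult[OF sf[OF that], of a] cmult[OF that] by simp
    show "0 \<le> suminf B"
      by (rule suminf_nonneg[OF B(3,2)])
    show "\<bar>\<Sum>n. L n f\<bar> \<le> suminf B * c" if f: "wbounded \<epsilon> c f" for c f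
    proof -
      have "\<bar>\<Sum>n. L n f\<bar> \<le> (\<Sum>n. \<bar>L n f\<bar>)"
        by (rule summable_rabs[OF sabs[OF f]])
      also have "\<dots> \<le> (\<Sum>n. B n * c)"
        by (intro suminf_le B(1)[OF f] sabs[OF f] summable_mult2 B(3))
      also have "\<dots> = suminf B * c"
        by (rule suminf_mult2[OF B(3), symmetric])
      finally show ?thesis .
    qed
  qed
qed

lemma wfunctional_second_diff_series:
  fixes \<kappa> :: "nat \<Rightarrow> 'n::finite \<Rightarrow> nat"
  assumes s: "0 < s" and R: "1 \<le> R" and r: "\<And>n. 0 \<le> r n"
    and sm: "summable (\<lambda>n. r n * growth R i j (\<kappa> n))"
  shows "wfunctional (s * (1 - 1 / R)) (\<lambda>f. \<Sum>n. r n * second_diff i j (gamma_mean s f) (\<kappa> n))"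
proof (rule wfunctional_suminf)
  let ?\<epsilon> = "s * (1 - 1 / R)"
  let ?w = "\<lambda>n. growth R i j (\<kappa> n)"
  have \<epsilon>: "?\<epsilon> < s" using s R by (auto simp: field_simps)
  show "\<bar>r n * second_diff i j (gamma_mean s f) (\<kappa> n)\<bar> \<le> (4 * R ^ CARD('n) * R ^ 2 * (r n * ?w n)) * c"
    if f: "wbounded ?\<epsilon> c f" for f c n
  proof -
    have "0 \<le> c * R ^ CARD('n)"
      using wbounded_nonneg[OF f] R by simp
    from abs_second_diff_le[OF abs_gamma_mean_le[OF s R f] R this, of i j "\<kappa> n"]
    have "r n * \<bar>second_diff i j (gamma_mean s f) (\<kappa> n)\<bar> \<le> r n * (4 * (c * R ^ CARD('n)) * R ^ 2 * ?w n)"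
      by (intro mult_left_mono r)
    then show ?thesis
      using r[of n] by (simp add: abs_mult mult_ac)
  qed
  show "0 \<le> 4 * R ^ CARD('n) * R ^ 2 * (r n * ?w n)" for n
    using r[of n] R by (simp add: diff_weight_def)
  show "summable (\<lambda>n. 4 * R ^ CARD('n) * R ^ 2 * (r n * ?w n))"
    by (intro summable_mult sm)
  show "r n * second_diff i j (gamma_mean s (\<lambda>l. f l + g l)) (\<kappa> n)
      = r n * second_diff i j (gamma_mean s f) (\<kappa> n) + r n * second_diff i j (gamma_mean s g) (\<kappa> n)"
    if "wbounded ?\<epsilon> c f" "wbounded ?\<epsilon> d g" for n c d f g
  proof -
    have "gamma_mean s (\<lambda>l. f l + g l) = (\<lambda>k. gamma_mean s f k + gamma_mean s g k)"
      using gamma_mean_add[OF s \<epsilon> that] by blast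
    then show ?thesis by (simp add: second_diff_add distrib_left)
  qed
  show "r n * second_diff i j (gamma_mean s (\<lambda>l. a * f l)) (\<kappa> n) = a * (r n * second_diff i j (gamma_mean s f) (\<kappa> n))"
    for n a f
  proof -
    have "gamma_mean s (\<lambda>l. a * f l) = (\<lambda>k. a * gamma_mean s f k)"
      using gamma_mean_cmult by blast
    then show ?thesis by (simp add: second_diff_cmult)
  qed
qed

text \<open>Compactly supported truncations of the exponential have the same mean under both laws; then
  apply Fatou's lemma.\<close>

lemma integrable_exp_if_gamma_mixture:
  fixes X :: "'w \<Rightarrow> real ^ 'n" and \<kappa> :: "nat \<Rightarrow> 'n \<Rightarrow> nat"
  assumes M: "prob_space M" and X: "X \<in> borel_measurable M" "\<And>w. w \<in> space M \<Longrightarrow> X w \<in> nonneg_orthant"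
    and s: "0 < s" and R: "1 \<le> R" and r: "\<And>n. 0 \<le> r n"
    and sm: "summable (\<lambda>n. r n * R ^ multideg (\<kappa> n))"
    and lap: "\<And>v. v \<in> nonneg_orthant \<Longrightarrow>
      (\<integral>w. exp (- (v \<bullet> X w)) \<partial>M) = (\<Sum>n. r n * gamma_mean s (\<lambda>l. exp (- (v \<bullet> l))) (\<kappa> n))"
  shows "integrable M (\<lambda>w. exp (s * (1 - 1 / R) * coord_sum (X w)))"
proof -
  interpret prob_space M by (rule M)
  let ?\<epsilon> = "s * (1 - 1 / R)"
  have \<epsilon>: "0 \<le> ?\<epsilon>" "?\<epsilon> < s" using s R by (auto simp: field_simps)
  have sm1: "summable r"
  proof (rule summable_comparison_test'[OF sm])
    fix n
    have "r n * 1 \<le> r n * R ^ multideg (\<kappa> n)"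
      using r R by (intro mult_left_mono one_le_power) auto
    then show "norm (r n) \<le> r n * R ^ multideg (\<kappa> n)"
      using r[of n] by simp
  qed
  \<comment> \<open>The weight of this functional is 0, since so far only bounded functions are
    known to be integrable.\<close>
  define L where "L f = (\<integral>w. f (X w) \<partial>M) - (\<Sum>n. r n * gamma_mean s f (\<kappa> n))" for f
  have L: "wfunctional 0 L"
    unfolding L_def[abs_def]
  proof (rule wfunctional_diff)
    show "wfunctional 0 (\<lambda>f. \<integral>w. f (X w) \<partial>M)"
      by (rule wfunctional_expectation[OF X]) auto
    show "wfunctional 0 (\<lambda>f. \<Sum>n. r n * gamma_mean s f (\<kappa> n))"
    proof (rule wfunctional_suminf[OF _ _ _ r sm1])
      fix n c d a and f g :: "real ^ 'n \<Rightarrow> real" assume f: "wbounded 0 c f"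
      show "r n * gamma_mean s (\<lambda>l. a * f l) (\<kappa> n) = a * (r n * gamma_mean s f (\<kappa> n))"
        by (simp add: gamma_mean_cmult)
      have "\<bar>gamma_mean s f (\<kappa> n)\<bar> \<le> c"
        using wbounded_gamma(2)[OF s s f, of "\<kappa> n"] s by simp
      then show "\<bar>r n * gamma_mean s f (\<kappa> n)\<bar> \<le> r n * c"
        using r[of n] by (simp add: abs_mult mult_left_mono)
      assume g: "wbounded 0 d g"
      show "r n * gamma_mean s (\<lambda>l. f l + g l) (\<kappa> n) = r n * gamma_mean s f (\<kappa> n) + r n * gamma_mean s g (\<kappa> n)"
        by (simp add: gamma_mean_add[OF s s f g] distrib_left)
    qed
  qed
  have L0: "L (\<lambda>l. exp (- (v \<bullet> l))) = 0" if "v \<in> nonneg_orthant" for v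
    using lap[OF that] by (simp add: L_def)
  \<comment> \<open>These truncations vanish for large \<open>coord_sum l\<close>, so they satisfy
    the decay condition for weight 0, while their bound 1 for the weight \<open>?\<epsilon>\<close>
    does not depend on \<open>m\<close>.\<close>
  define f where "f m l = exp (?\<epsilon> * coord_sum l) * max 0 (min 1 (real m - coord_sum l))"
    for m and l :: "real ^ 'n"
  have fc: "continuous_on S (f m)" for m S
    unfolding f_def[abs_def] by (intro continuous_intros)
  have f0: "0 \<le> f m l" for m l by (simp add: f_def)
  have f1: "f m l \<le> exp (?\<epsilon> * coord_sum l)" for m l
    unfolding f_def by (rule mult_left_le) auto
  have fz: "f m l = 0" if "real m \<le> coord_sum l" for m l
    using that by (simp add: f_def)
  have wf: "wbounded ?\<epsilon> 1 (f m)" for m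
    unfolding wbounded_def using fc f0 f1 by auto
  have wf0: "wbounded 0 (exp (?\<epsilon> * real m)) (f m)" for m
    unfolding wbounded_def
  proof (intro conjI ballI fc)
    fix l :: "real ^ 'n"
    show "\<bar>f m l\<bar> \<le> exp (?\<epsilon> * real m) * exp (0 * coord_sum l)"
    proof (cases "real m \<le> coord_sum l")
      case False
      then have "?\<epsilon> * coord_sum l \<le> ?\<epsilon> * real m"
        using \<epsilon>(1) by (intro mult_left_mono) auto
      then have "exp (?\<epsilon> * coord_sum l) \<le> exp (?\<epsilon> * real m)"
        by (simp only: exp_le_cancel_iff)
      with f1[of m l] have "f m l \<le> exp (?\<epsilon> * real m)"
        by (rule order_trans)
      then show ?thesis using f0[of m l] by simp
    qed (simp add: fz)
  qed
  define K where "K = (\<Sum>n. r n * (R ^ CARD('n) * R ^ multideg (\<kappa> n)))"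
  have smK: "summable (\<lambda>n. r n * (R ^ CARD('n) * R ^ multideg (\<kappa> n)))"
    using summable_mult[OF sm, of "R ^ CARD('n)"] by (simp add: mult_ac)
  have mean: "(\<integral>w. f m (X w) \<partial>M) \<le> K" for m
  proof -
    have "L (f m) = 0"
      by (rule wfunctional_eq_0[OF L order.refl L0 wf0]) (use fz in \<open>fastforce intro!: exI[of _ "real m"]\<close>)+
    then have "(\<integral>w. f m (X w) \<partial>M) = (\<Sum>n. r n * gamma_mean s (f m) (\<kappa> n))"
      by (simp add: L_def)
    also have "\<dots> \<le> K"
      unfolding K_def
    proof (rule suminf_le[OF _ _ smK])
      fix n
      have "\<bar>gamma_mean s (f m) (\<kappa> n)\<bar> \<le> R ^ CARD('n) * R ^ multideg (\<kappa> n)"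
        using abs_gamma_mean_le[OF s R wf, of m "\<kappa> n"] by simp
      then have b: "\<bar>r n * gamma_mean s (f m) (\<kappa> n)\<bar> \<le> r n * (R ^ CARD('n) * R ^ multideg (\<kappa> n))" for n
        using abs_gamma_mean_le[OF s R wf, of m "\<kappa> n"] r[of n] by (simp add: abs_mult mult_left_mono)
      show "r n * gamma_mean s (f m) (\<kappa> n) \<le> r n * (R ^ CARD('n) * R ^ multideg (\<kappa> n))"
        using b[of n] by linarith
      show "summable (\<lambda>n. r n * gamma_mean s (f m) (\<kappa> n))"
        by (rule summable_comparison_test'[OF smK]) (use b in simp)
    qed
    finally show ?thesis .
  qed
  have fm: "(\<lambda>w. f m (X w)) \<in> borel_measurable M" for m
    by (rule borel_measurable_orthant[OF fc X])
  have em: "(\<lambda>w. exp (?\<epsilon> * coord_sum (X w))) \<in> borel_measurable M"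
    by (rule borel_measurable_orthant[where f = "\<lambda>l. exp (?\<epsilon> * coord_sum l)", OF _ X])
      (intro continuous_intros)
  have "(\<integral>\<^sup>+w. ennreal (f m (X w)) \<partial>M) \<le> ennreal K" for m
  proof -
    have "integrable M (\<lambda>w. f m (X w))"
      by (rule integrable_wbounded(1)[where \<epsilon> = 0, OF X _ wf0[of m]]) auto
    then have "(\<integral>\<^sup>+w. ennreal (f m (X w)) \<partial>M) = ennreal (\<integral>w. f m (X w) \<partial>M)"
      using f0 by (intro nn_integral_eq_integral) auto
    then show ?thesis using mean[of m] by (simp add: ennreal_leI)
  qed
  then have "liminf (\<lambda>m. \<integral>\<^sup>+w. ennreal (f m (X w)) \<partial>M) \<le> ennreal K"
    by (intro Liminf_le) (auto simp: eventually_sequentially)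
  moreover have "(\<integral>\<^sup>+w. liminf (\<lambda>m. ennreal (f m (X w))) \<partial>M) \<le> liminf (\<lambda>m. \<integral>\<^sup>+w. ennreal (f m (X w)) \<partial>M)"
    using fm by (intro nn_integral_liminf) simp
  moreover have "liminf (\<lambda>m. ennreal (f m l)) = ennreal (exp (?\<epsilon> * coord_sum l))" for l
  proof -
    have "\<forall>\<^sub>F m in sequentially. exp (?\<epsilon> * coord_sum l) = f m l"
      using filterlim_real_sequentially[THEN filterlim_at_top_dense[THEN iffD1], rule_format, of "coord_sum l + 1"]
      by eventually_elim (simp add: f_def)
    then have "(\<lambda>m. f m l) \<longlonglongrightarrow> exp (?\<epsilon> * coord_sum l)"
      by (rule Lim_transform_eventually[OF tendsto_const])
    then have "(\<lambda>m. ennreal (f m l)) \<longlonglongrightarrow> ennreal (exp (?\<epsilon> * coord_sum l))"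
      by (rule tendsto_ennrealI)
    then show ?thesis
      by (intro lim_imp_Liminf) auto
  qed
  ultimately have "(\<integral>\<^sup>+w. ennreal (exp (?\<epsilon> * coord_sum (X w))) \<partial>M) \<le> ennreal K"
    by simp
  then show ?thesis
    using em by (intro integrableI_bounded) (auto intro: le_less_trans ennreal_less_top)
qed

text \<open>The weighted partial sums are all at most \<open>K\<close>; integrating them bounds the
  partial sums of the integrated series, which gives summability. A sequence \<open>b\<close>
  dominated by \<open>w\<close> can then be integrated term by term. \<open>1 \<le> w n\<close>
  bounds each \<open>h n\<close> by \<open>K\<close> and so makes it integrable.\<close>

lemma integral_weighted_series:
  fixes h :: "nat \<Rightarrow> 'a \<Rightarrow> real"
  assumes M: "finite_measure M" and h: "\<And>n. h n \<in> borel_measurable M" "\<And>n x. x \<in> space M \<Longrightarrow> 0 \<le> h n x"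
    and w: "\<And>n. 1 \<le> w n" and sm: "\<And>x. x \<in> space M \<Longrightarrow> summable (\<lambda>n. h n x * w n)"
    and K: "\<And>x. x \<in> space M \<Longrightarrow> (\<Sum>n. h n x * w n) \<le> K"
  shows "summable (\<lambda>n. (\<integral>x. h n x \<partial>M) * w n)"
    and "(\<And>n. \<bar>b n\<bar> \<le> c * w n) \<Longrightarrow> (\<integral>x. (\<Sum>n. h n x * b n) \<partial>M) = (\<Sum>n. (\<integral>x. h n x \<partial>M) * b n)"
proof -
  interpret finite_measure M by (rule M)
  have w0: "0 \<le> w n" for n using w[of n] by simp
  have hK: "(\<Sum>n<m. h n x * w n) \<le> K" if "x \<in> space M" for x m
  proof -
    have "(\<Sum>n<m. h n x * w n) \<le> (\<Sum>n. h n x * w n)"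
      by (rule sum_le_suminf[OF sm[OF that]]) (use h(2)[OF that] w0 in auto)
    then show ?thesis using K[OF that] by linarith
  qed
  have int: "integrable M (h n)" for n
  proof (rule integrable_const_bound[of _ K])
    show "AE x in M. norm (h n x) \<le> K"
    proof (rule AE_I2)
      fix x assume x: "x \<in> space M"
      have "h n x * 1 \<le> h n x * w n"
        using h(2)[OF x] w by (intro mult_left_mono) auto
      also have "\<dots> \<le> (\<Sum>n<Suc n. h n x * w n)"
        using h(2)[OF x] w0 by (intro member_le_sum) auto
      also have "\<dots> \<le> K" by (rule hK[OF x])
      finally show "norm (h n x) \<le> K" using h(2)[OF x] by simp
    qed
  qed (rule h)
  show s: "summable (\<lambda>n. (\<integral>x. h n x \<partial>M) * w n)"
  proof (rule bounded_imp_summable)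
    show "0 \<le> (\<integral>x. h n x \<partial>M) * w n" for n
      using h(2) w0 by (intro mult_nonneg_nonneg Bochner_Integration.integral_nonneg) auto
    fix m
    have "(\<Sum>n\<le>m. (\<integral>x. h n x \<partial>M) * w n) = (\<integral>x. (\<Sum>n<Suc m. h n x * w n) \<partial>M)"
      using int by (subst Bochner_Integration.integral_sum) (auto simp: lessThan_Suc_atMost)
    also have "\<dots> \<le> (\<integral>x. K \<partial>M)"
      using int hK by (intro integral_mono Bochner_Integration.integrable_sum integrable_mult_left)
        (auto simp del: sum.lessThan_Suc)
    finally show "(\<Sum>n\<le>m. (\<integral>x. h n x \<partial>M) * w n) \<le> (\<integral>x. K \<partial>M)" .
  qed
  assume b: "\<And>n. \<bar>b n\<bar> \<le> c * w n"
  have bb: "\<bar>h n x * b n\<bar> \<le> c * (h n x * w n)" if "x \<in> space M" for n x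
    using mult_left_mono[OF b[of n] h(2)[OF that, of n]] h(2)[OF that, of n] by (simp add: abs_mult mult_ac)
  have "(\<integral>x. (\<Sum>n. h n x * b n) \<partial>M) = (\<Sum>n. (\<integral>x. h n x * b n \<partial>M))"
  proof (rule integral_suminf)
    show "integrable M (\<lambda>x. h n x * b n)" for n
      by (intro integrable_mult_left int)
    show "AE x in M. summable (\<lambda>n. norm (h n x * b n))"
    proof (rule AE_I2)
      fix x assume x: "x \<in> space M"
      show "summable (\<lambda>n. norm (h n x * b n))"
        by (rule summable_comparison_test'[OF summable_mult[OF sm[OF x], of c]]) (use bb[OF x] in simp)
    qed
    have nn: "(\<integral>x. norm (h n x * b n) \<partial>M) \<le> c * ((\<integral>x. h n x \<partial>M) * w n)" for n
    proof -
      have "(\<integral>x. norm (h n x * b n) \<partial>M) \<le> (\<integral>x. c * (h n x * w n) \<partial>M)"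
        using int bb by (intro integral_mono integrable_norm integrable_mult_left integrable_mult_right) auto
      then show ?thesis by simp
    qed
    show "summable (\<lambda>n. \<integral>x. norm (h n x * b n) \<partial>M)"
      by (rule summable_comparison_test'[OF summable_mult[OF s, of c]]) (use nn in simp)
  qed
  then show "(\<integral>x. (\<Sum>n. h n x * b n) \<partial>M) = (\<Sum>n. (\<integral>x. h n x \<partial>M) * b n)"
    by simp
qed

section \<open>Uniform contraction along the interpolation\<close>

abbreviation unit_interval :: "real measure" where
  "unit_interval \<equiv> restrict_space lborel {0..1}"

lemma space_unit_interval [simp]: "space unit_interval = {0..1}"
  by (simp add: space_restrict_space)

lemma finite_measure_unit_interval: "finite_measure unit_interval"
  by (rule finite_measureI) (simp add: emeasure_restrict_space space_restrict_space)

lemma measurable_unit_interval: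
  fixes f :: "real \<Rightarrow> real"
  assumes "continuous_on {0..1} f"
  shows "f \<in> borel_measurable unit_interval"
proof -
  have "f \<in> borel_measurable (restrict_space borel {0..1})"
    by (rule borel_measurable_continuous_on_restrict[OF assms])
  moreover have "sets unit_interval = sets (restrict_space borel {0..1})"
    by (rule sets_restrict_space_cong) simp
  ultimately show ?thesis
    using measurable_cong_sets[of unit_interval "restrict_space borel {0..1}" borel borel] by blast
qed

lemma bounded_above_unit_interval:
  fixes f :: "real \<Rightarrow> real"
  assumes "continuous_on {0..1} f"
  obtains b where "\<And>t. t \<in> {0..1} \<Longrightarrow> f t \<le> b"
proof -
  have "bounded (f ` {0..1})"
    using assms by (intro compact_imp_bounded compact_continuous_image) auto
  then obtain b where "\<And>t. t \<in> {0..1} \<Longrightarrow> \<bar>f t\<bar> \<le> b"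
    unfolding bounded_iff by (metis image_eqI real_norm_def)
  then show thesis
    by (intro that[of b]) (meson abs_le_D1)
qed

text \<open>The vector \<open>x = G 1\<close> satisfies \<open>A x = 1\<close>, hence \<open>(1 - A / s) x = x - 1 / s\<close>, which is a
  contraction uniformly in \<open>t\<close>.\<close>

lemma uniform_contraction:
  fixes G :: "real \<Rightarrow> real ^ 'n ^ 'n"
  assumes cont: "\<And>i j. continuous_on {0..1} (\<lambda>t. G t $ i $ j)"
    and inv_M: "\<And>t. t \<in> {0..1} \<Longrightarrow> inverse_M_matrix (G t)"
    and pos_def: "\<And>t. t \<in> {0..1} \<Longrightarrow> pos_definite (sym_part (G t))"
  obtains A s R where "0 < s" "1 < R"
    "\<And>t. t \<in> {0..1} \<Longrightarrow> A t ** G t = mat 1"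
    "\<And>t i j. t \<in> {0..1} \<Longrightarrow> 0 \<le> (mat 1 - (1 / s) *\<^sub>R A t) $ i $ j"
    "\<And>t y i j. t \<in> {0..1} \<Longrightarrow> y \<in> cube R \<Longrightarrow>
      summable (\<lambda>p. matpow (diag_matrix y ** (mat 1 - (1 / s) *\<^sub>R A t)) p $ i $ j)"
proof -
  have "\<forall>t. \<exists>A. t \<in> {0..1} \<longrightarrow> A ** G t = mat 1 \<and> (\<forall>i j. i \<noteq> j \<longrightarrow> A $ i $ j \<le> 0) \<and>
      (\<forall>i j. 0 \<le> G t $ i $ j)"
    using inverse_M_matrix_inverse_nonneg inv_M pos_def by metis
  then obtain A where A: "\<And>t. t \<in> {0..1} \<Longrightarrow> A t ** G t = mat 1"
      "\<And>t i j. t \<in> {0..1} \<Longrightarrow> i \<noteq> j \<Longrightarrow> A t $ i $ j \<le> 0" "\<And>t i j. t \<in> {0..1} \<Longrightarrow> 0 \<le> G t $ i $ j"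
    by metis
  have cA: "continuous_on {0..1} (\<lambda>t. A t $ i $ j)" for i j
    by (rule continuous_on_left_inverse[OF cont A(1)])
  have "continuous_on {0..1} (\<lambda>t. \<Sum>i\<in>UNIV. \<bar>A t $ i $ i\<bar>)"
    by (intro continuous_intros cA)
  then obtain s0 where s0: "\<And>t. t \<in> {0..1} \<Longrightarrow> (\<Sum>i\<in>UNIV. \<bar>A t $ i $ i\<bar>) \<le> s0"
    by (rule bounded_above_unit_interval) blast
  \<comment> \<open>Above all diagonal entries of \<open>A t\<close> for every \<open>t\<close>, so
    that the diagonal of \<open>Q t\<close> is nonnegative.\<close>
  define s where "s = max 1 s0"
  have s: "0 < s" by (simp add: s_def)
  have As: "A t $ i $ i \<le> s" if "t \<in> {0..1}" for t i
    using s0[OF that] member_le_sum[of i UNIV "\<lambda>i. \<bar>A t $ i $ i\<bar>"] by (simp add: s_def)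
  have "continuous_on {0..1} (\<lambda>t. \<Sum>i\<in>UNIV. \<Sum>j\<in>UNIV. G t $ i $ j)"
    by (intro continuous_intros cont)
  then obtain K0 where K0: "\<And>t. t \<in> {0..1} \<Longrightarrow> (\<Sum>i\<in>UNIV. \<Sum>j\<in>UNIV. G t $ i $ j) \<le> K0"
    by (rule bounded_above_unit_interval) blast
  define K where "K = max (1 / s) K0"
  have K: "1 / s \<le> K" "0 < K"
    using s by (auto simp: K_def less_max_iff_disj)
  define Q where "Q t = mat 1 - (1 / s) *\<^sub>R A t" for t
  have Q: "0 \<le> Q t $ i $ j" if "t \<in> {0..1}" for t i j
    using A(2)[OF that, of i j] As[OF that, of i] s
    by (cases "i = j") (auto simp: Q_def mat_def divide_le_0_iff)
  define x where "x t = G t *v 1" for t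
  have x0: "0 \<le> x t $ i" and xK: "x t $ i \<le> K" if t: "t \<in> {0..1}" for t i
  proof -
    have xi: "x t $ i = (\<Sum>j\<in>UNIV. G t $ i $ j)"
      by (simp add: x_def matrix_vector_mult_def)
    show "0 \<le> x t $ i"
      unfolding xi by (intro sum_nonneg A(3) t)
    have "x t $ i \<le> (\<Sum>i\<in>UNIV. \<Sum>j\<in>UNIV. G t $ i $ j)"
      unfolding xi by (rule member_le_sum) (auto intro!: sum_nonneg A(3)[OF t])
    then show "x t $ i \<le> K"
      using K0[OF t] by (simp add: K_def)
  qed
  have Qx: "(Q t *v x t) $ i = x t $ i - 1 / s" if t: "t \<in> {0..1}" for t i
  proof -
    have "A t *v x t = 1"
      by (simp add: x_def matrix_vector_mul_assoc A(1)[OF t])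
    then show ?thesis
      by (simp add: Q_def matrix_vector_mult_diff_rdistrib scaleR_matrix_vector_assoc[symmetric])
  qed
  have Qx0: "0 \<le> (Q t *v x t) $ i" if t: "t \<in> {0..1}" for t i
    using Q[OF t] x0[OF t] by (auto simp: matrix_vector_mult_def intro!: sum_nonneg)
  \<comment> \<open>Nonnegativity of \<open>Q t *v x t\<close>, whose entries are
    \<open>x t $ i - 1 / s\<close>, bounds \<open>x t\<close> away from 0.\<close>
  have xs: "1 / s \<le> x t $ i" if t: "t \<in> {0..1}" for t i
    using Qx0[OF t, of i] Qx[OF t, of i] by simp
  \<comment> \<open>As \<open>x t $ i \<le> K\<close>, subtracting \<open>1 / s\<close> from it
    removes at least the fraction \<open>1 / (s * K)\<close>; \<open>1 / s \<le> K\<close> keeps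
    \<open>q\<close> nonnegative.\<close>
  define q where "q = 1 - 1 / (s * K)"
  have q: "0 \<le> q" "q < 1"
    using K s by (auto simp: q_def field_simps)
  \<comment> \<open>The harmonic mean of 1 and \<open>1 / q\<close>, in a form that also covers
    \<open>q = 0\<close>; it exceeds 1 and satisfies \<open>R * q < 1\<close>.\<close>
  define R where "R = 2 / (1 + q)"
  have R: "1 < R" "R * q < 1" "0 \<le> R"
    using q by (auto simp: R_def field_simps)
  have sm: "summable (\<lambda>p. matpow (diag_matrix y ** Q t) p $ i $ j)" if t: "t \<in> {0..1}" and y: "y \<in> cube R" for t y i j
  proof (rule summable_matpow)
    show "0 \<le> (diag_matrix y ** Q t) $ i $ j" for i j
      using Q[OF t] y by (simp add: cube_def)
    show "0 < x t $ i" for i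
      using xs[OF t, of i] s by (meson divide_pos_pos less_le_trans zero_less_one)
    show "0 \<le> R * q" "R * q < 1"
      using R q by auto
    fix i
    have "x t $ i / K \<le> 1"
      using xK[OF t, of i] K by simp
    then have "1 / s * (x t $ i / K) \<le> 1 / s * 1"
      using s by (intro mult_left_mono) auto
    then have Qq: "(Q t *v x t) $ i \<le> q * x t $ i"
      unfolding Qx[OF t] q_def by (simp add: left_diff_distrib)
    have "((diag_matrix y ** Q t) *v x t) $ i = y $ i * (Q t *v x t) $ i"
      by (simp add: matrix_vector_mult_def sum_distrib_left mult.assoc)
    also have "\<dots> \<le> R * (q * x t $ i)"
      using y Qq Qx0[OF t, of i] R by (intro mult_mono) (auto simp: cube_def)
    finally show "((diag_matrix y ** Q t) *v x t) $ i \<le> R * q * x t $ i"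
      by (simp add: mult.assoc)
  qed
  show thesis
    using that[OF s R(1) A(1)] Q sm unfolding Q_def by blast
qed

section \<open>Differentiating the Laplace transform\<close>

lemma det_diag_matrix: "det (diag_matrix c) = (\<Prod>i\<in>UNIV. c $ i)"
  by (subst det_diagonal) (auto simp: diag_matrix_def)

lemma mult_diag_nth: "(B ** diag_matrix c) $ i $ j = B $ i $ j * c $ j"
  by (simp add: diag_matrix_def matrix_matrix_mult_def if_distrib[of "\<lambda>a. _ * a"] cong: if_cong)

text \<open>In the application, \<open>A\<close>, \<open>s\<close> and \<open>R\<close> come from
  \<open>uniform_contraction\<close>, and \<open>det_kernel_pos\<close> holds because the
  determinant is the reciprocal of a Laplace transform.\<close>

locale kernel_path =
  fixes G G' A :: "real \<Rightarrow> real ^ 'n ^ 'n" and s R :: real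
  assumes s_pos: "0 < s" and R_gt_1: "1 < R"
    and AG: "\<And>t. t \<in> {0..1} \<Longrightarrow> A t ** G t = mat 1"
    and nonneg: "\<And>t i j. t \<in> {0..1} \<Longrightarrow> 0 \<le> (mat 1 - (1 / s) *\<^sub>R A t) $ i $ j"
    and summable_matpow_path: "\<And>t y i j. t \<in> {0..1} \<Longrightarrow> y \<in> cube R \<Longrightarrow>
      summable (\<lambda>p. matpow (diag_matrix y ** (mat 1 - (1 / s) *\<^sub>R A t)) p $ i $ j)"
    and deriv_G: "\<And>i j t. t \<in> {0..1} \<Longrightarrow>
      ((\<lambda>a. G a $ i $ j) has_real_derivative G' t $ i $ j) (at t within {0..1})"
    and cont_G': "\<And>i j. continuous_on {0..1} (\<lambda>t. G' t $ i $ j)"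
    and det_kernel_pos: "\<And>t v. t \<in> {0..1} \<Longrightarrow> v \<in> nonneg_orthant \<Longrightarrow> 0 < det (mat 1 + diag_matrix v ** G t)"
begin

abbreviation kernel :: "real ^ 'n \<Rightarrow> real \<Rightarrow> real ^ 'n ^ 'n" where
  "kernel v t \<equiv> mat 1 + diag_matrix v ** G t"

definition Q :: "real \<Rightarrow> real ^ 'n ^ 'n" where
  "Q t = mat 1 - (1 / s) *\<^sub>R A t"

lemma cont_G: "continuous_on {0..1} (\<lambda>t. G t $ i $ j)"
  using deriv_G by (rule DERIV_continuous_on)

lemma cont_Q: "continuous_on {0..1} (\<lambda>t. Q t $ i $ j)"
proof -
  have "continuous_on {0..1} (\<lambda>t. mat 1 $ i $ j - (1 / s) * A t $ i $ j)"
    by (intro continuous_on_diff continuous_on_mult continuous_on_const continuous_on_left_inverse[OF cont_G AG])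
  moreover have "Q t $ i $ j = mat 1 $ i $ j - (1 / s) * A t $ i $ j" for t
    by (simp add: Q_def)
  ultimately show ?thesis by simp
qed

sublocale matrix_family unit_interval Q R
proof
  show "(\<lambda>t. Q t $ i $ j) \<in> borel_measurable unit_interval" for i j
    by (rule measurable_unit_interval[OF cont_Q])
qed (use nonneg summable_matpow_path R_gt_1 in \<open>auto simp: Q_def\<close>)

text \<open>For \<open>t\<close> in the unit interval this is det (1 - Q), the normalisation that
  makes the mixture weights sum to 1.\<close>

definition \<theta> :: "real \<Rightarrow> real" where
  "\<theta> t = inverse (det (G t)) / s ^ CARD('n)"

definition ratio :: "real ^ 'n \<Rightarrow> real ^ 'n" where
  "ratio v = (\<chi> i. s / (s + v $ i))"

lemma ratio:
  assumes "v \<in> nonneg_orthant"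
  shows "0 < ratio v $ i" "ratio v $ i \<le> 1" "(s + v $ i) * ratio v $ i = s" "v $ i / (s + v $ i) = 1 - ratio v $ i"
    "0 < s + v $ i"
proof -
  have "0 \<le> v $ i" using assms by (simp add: nonneg_orthant_def)
  then show "0 < s + v $ i" "0 < ratio v $ i" "ratio v $ i \<le> 1" "(s + v $ i) * ratio v $ i = s"
      "v $ i / (s + v $ i) = 1 - ratio v $ i"
    using s_pos by (auto simp: ratio_def field_simps)
qed

lemma ratio_cube: "v \<in> nonneg_orthant \<Longrightarrow> ratio v \<in> cube 1"
  using ratio(1,2) by (auto simp: cube_def less_imp_le)

lemma cube_1_R: "y \<in> cube 1 \<Longrightarrow> y \<in> cube R"
  using R_gt_1 by (auto simp: cube_def) (meson less_imp_le order_trans)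

text \<open>By the definition of \<open>Q\<close>, diag (s + v) - s Q = diag v + A; multiplication
  by \<open>G\<close> on the right turns \<open>A\<close> into the identity.\<close>

lemma kernel_factorization:
  assumes "t \<in> {0..1}" and v: "v \<in> nonneg_orthant"
  shows "kernel v t
    = diag_matrix (\<chi> i. s + v $ i) ** (pencil t (ratio v)) ** G t"
proof -
  have "(diag_matrix (\<chi> i. s + v $ i) ** (pencil t (ratio v))) $ i $ j
      = (diag_matrix v + A t) $ i $ j" for i j
  proof -
    have "(s + v $ i) * (mat 1 $ i $ j - ratio v $ i * Q t $ i $ j)
        = (s + v $ i) * mat 1 $ i $ j - ((s + v $ i) * ratio v $ i) * Q t $ i $ j"
      by (simp only: right_diff_distrib mult.assoc)
    also have "\<dots> = (diag_matrix v + A t) $ i $ j"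
      unfolding ratio(3)[OF v] using s_pos by (simp add: Q_def diag_matrix_def mat_def algebra_simps)
    finally show ?thesis by simp
  qed
  then have "diag_matrix (\<chi> i. s + v $ i) ** (pencil t (ratio v)) = diag_matrix v + A t"
    by (simp add: vec_eq_iff)
  then show ?thesis
    by (simp add: matrix_add_rdistrib AG[OF assms(1)] add.commute)
qed

lemma inverse_det_kernel:
  assumes t: "t \<in> {0..1}" and v: "v \<in> nonneg_orthant"
  shows "inverse (det (kernel v t)) = \<theta> t * ((\<Prod>i\<in>UNIV. ratio v $ i) * W t (ratio v))"
proof -
  have "(\<Prod>i\<in>UNIV. inverse (s + v $ i)) = (\<Prod>i\<in>UNIV. ratio v $ i / s)"
    using s_pos by (intro prod.cong) (auto simp: ratio_def inverse_eq_divide)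
  then show ?thesis
    by (simp add: kernel_factorization[OF assms] det_mul det_diag_matrix W_def \<theta>_def prod_inversef[symmetric]
        prod_dividef)
qed

text \<open>The sign is read off from \<open>inverse_det_kernel\<close> at \<open>v = 0\<close>,
  where the kernel determinant and all other factors are positive.\<close>

lemma \<theta>_pos: "t \<in> {0..1} \<Longrightarrow> 0 < \<theta> t"
proof -
  assume t: "t \<in> {0..1}"
  have v: "(0 :: real ^ 'n) \<in> nonneg_orthant" by simp
  have "0 < \<theta> t * ((\<Prod>i\<in>UNIV. ratio 0 $ i) * W t (ratio 0))"
    using det_kernel_pos[OF t v] by (simp add: inverse_det_kernel[OF t v, symmetric])
  moreover have "0 < (\<Prod>i\<in>UNIV. ratio 0 $ i) * W t (ratio 0)"
    using ratio(1)[OF v] W_pos[of t "ratio 0"] t cube_1_R[OF ratio_cube[OF v]] by (auto intro!: mult_pos_pos prod_pos)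
  ultimately show ?thesis
    by (simp add: zero_less_mult_iff)
qed

lemma cont_\<theta>: "continuous_on {0..1} \<theta>"
proof -
  have "det (G t) \<noteq> 0" if "t \<in> {0..1}" for t
    using AG[OF that] by (metis invertible_det_nz invertible_left_inverse)
  then show ?thesis
    unfolding \<theta>_def[abs_def] using s_pos by (intro continuous_intros continuous_on_det cont_G) auto
qed

text \<open>The coefficient of \<open>G'\<^sub>i\<^sub>j\<close> in the derivative of \<open>1 / det (1 + diag v G)\<close>; the form below,
  obtained from the one in the next lemma, has a series representation of known sign.\<close>

definition T :: "real ^ 'n \<Rightarrow> 'n \<Rightarrow> 'n \<Rightarrow> real \<Rightarrow> real" where
  "T v i j t = s * ((1 - ratio v $ i) * (1 - ratio v $ j) * (Q t ** N t (ratio v)) $ j $ i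
      - (if i = j then 1 - ratio v $ i else 0)) * inverse (det (kernel v t))"

text \<open>\<open>V\<close> is the inverse of the kernel, computed from the factorisation; by
  Cramer's rule its entry (j, i) is a cofactor over the determinant. The cofactor form serves for
  continuity and for the derivative in \<open>t\<close>, the form in \<open>T\<close> for the
  series.\<close>

lemma T_eq_cofactor:
  assumes t: "t \<in> {0..1}" and v: "v \<in> nonneg_orthant"
  defines "M \<equiv> kernel v t"
  shows "T v i j t = - (v $ i * det (replace_row M i (axis j 1))) * inverse (det M ^ 2)"
proof -
  let ?y = "ratio v"
  have y: "?y \<in> cube R" and a: "t \<in> space unit_interval"
    using cube_1_R[OF ratio_cube[OF v]] t by auto
  define c where "c = (\<chi> i. 1 / (s + v $ i))"
  define V where "V = A t ** N t ?y ** diag_matrix c"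
  have cc: "diag_matrix c ** diag_matrix (\<chi> i. s + v $ i) = mat 1"
  proof -
    have "(diag_matrix c ** diag_matrix (\<chi> i. s + v $ i)) $ i $ j = mat 1 $ i $ j" for i j
      unfolding diag_mult_nth using ratio(5)[OF v, of i] by (cases "i = j") (auto simp: c_def diag_matrix_def mat_def)
    then show ?thesis by (simp only: vec_eq_iff) simp
  qed
  have "V ** M = A t ** (N t ?y ** ((diag_matrix c ** diag_matrix (\<chi> i. s + v $ i)) ** (pencil t ?y))) ** G t"
    unfolding V_def M_def kernel_factorization[OF t v] by (simp only: matrix_mul_assoc)
  also have "\<dots> = mat 1"
    unfolding cc by (simp add: N_inverse(2)[OF a y] AG[OF t])
  finally have VM: "V ** M = mat 1" .
  have "A t = s *\<^sub>R (mat 1 - Q t)"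
    using s_pos by (simp add: Q_def)
  then have "A t ** N t ?y = s *\<^sub>R ((mat 1 - Q t) ** N t ?y)"
    by (simp add: vec_eq_iff matrix_matrix_mult_def sum_distrib_left mult.assoc)
  also have "(mat 1 - Q t) ** N t ?y = N t ?y - Q t ** N t ?y"
    unfolding eq_diff_eq matrix_add_rdistrib[symmetric] by simp
  finally have AN: "A t ** N t ?y = s *\<^sub>R (N t ?y - Q t ** N t ?y)" .
  have "V $ j $ i * v $ i = s * (N t ?y $ j $ i - (Q t ** N t ?y) $ j $ i) * (v $ i / (s + v $ i))"
    by (simp add: V_def mult_diag_nth c_def AN)
  \<comment> \<open>Substituting N = 1 + diag y Q N and v_i / (s + v_i) = 1 - y_i leaves Q N with
    the factor (1 - y_i) (1 - y_j).\<close>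
  also have "\<dots> = - s * ((1 - ?y $ i) * (1 - ?y $ j) * (Q t ** N t ?y) $ j $ i - (if i = j then 1 - ?y $ i else 0))"
    unfolding ratio(4)[OF v] N_unfold[OF a y, of j i] by (simp add: mat_def algebra_simps)
  finally have "T v i j t = - (V $ j $ i * v $ i) * inverse (det M)"
    by (simp add: T_def M_def)
  moreover have "V $ j $ i = det (replace_row M i (axis j 1)) * inverse (det M)"
    using left_inverse_entry[OF VM, of j i] det_kernel_pos[OF t v] by (simp add: M_def field_simps)
  ultimately show ?thesis
    by (simp add: power2_eq_square mult_ac)
qed

lemma cont_kernel: "continuous_on {0..1} (\<lambda>t. (kernel v t) $ i $ j)"
  by (simp add: cont_G continuous_on_add continuous_on_mult continuous_on_const)

lemma cont_T:
  assumes v: "v \<in> nonneg_orthant"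
  shows "continuous_on {0..1} (T v i j)"
proof -
  let ?M = "\<lambda>t. kernel v t"
  have "continuous_on {0..1} (\<lambda>t. replace_row (?M t) i (axis j 1) $ a $ b)" for a b
    using cont_kernel[of v a b] by (cases "a = i") simp_all
  then have r: "continuous_on {0..1} (\<lambda>t. det (replace_row (?M t) i (axis j 1)))"
    by (rule continuous_on_det)
  have d: "continuous_on {0..1} (\<lambda>t. det (?M t))"
    by (rule continuous_on_det[OF cont_kernel])
  have "continuous_on {0..1} (\<lambda>t. - (v $ i * det (replace_row (?M t) i (axis j 1))) * inverse (det (?M t) ^ 2))"
    by (intro continuous_on_mult continuous_on_minus continuous_on_const continuous_on_inverse continuous_on_power r d)
      (use det_kernel_pos[OF _ v] in force)
  then show ?thesis
    by (rule continuous_on_eq) (simp add: T_eq_cofactor[OF _ v])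
qed

lemma inverse_det_kernel_has_derivative:
  assumes t: "t \<in> {0..1}" and v: "v \<in> nonneg_orthant"
  shows "((\<lambda>t. inverse (det (kernel v t))) has_real_derivative
    (\<Sum>i\<in>UNIV. \<Sum>j\<in>UNIV. G' t $ i $ j * T v i j t)) (at t within {0..1})"
proof -
  let ?M = "\<lambda>t. kernel v t"
  have "((\<lambda>t. ?M t $ i $ j) has_real_derivative (diag_matrix v ** G' t) $ i $ j) (at t within {0..1})" for i j
    using deriv_G[OF t, of i j] by (auto intro!: derivative_eq_intros)
  then have "((\<lambda>t. det (?M t)) has_real_derivative
      (\<Sum>i\<in>UNIV. \<Sum>j\<in>UNIV. (diag_matrix v ** G' t) $ i $ j * det (replace_row (?M t) i (axis j 1)))) (at t within {0..1})"
    by (rule det_has_real_derivative)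
  then have "((\<lambda>t. inverse (det (?M t))) has_real_derivative
      - ((\<Sum>i\<in>UNIV. \<Sum>j\<in>UNIV. (diag_matrix v ** G' t) $ i $ j * det (replace_row (?M t) i (axis j 1))) * inverse (det (?M t) ^ Suc (Suc 0))))
      (at t within {0..1})"
    by (rule DERIV_inverse_fun) (use det_kernel_pos[OF t v] in simp)
  moreover have "- ((\<Sum>i\<in>UNIV. \<Sum>j\<in>UNIV. (diag_matrix v ** G' t) $ i $ j * det (replace_row (?M t) i (axis j 1))) * inverse (det (?M t) ^ Suc (Suc 0)))
      = (\<Sum>i\<in>UNIV. \<Sum>j\<in>UNIV. G' t $ i $ j * T v i j t)"
    unfolding T_eq_cofactor[OF t v] sum_distrib_right sum_negf[symmetric]
    by (intro sum.cong refl) (simp add: numeral_2_eq_2 mult_ac)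
  ultimately show ?thesis by simp
qed

lemma integrable_G'_T:
  assumes v: "v \<in> nonneg_orthant"
  shows "integrable unit_interval (\<lambda>t. G' t $ i $ j * T v i j t)"
proof -
  have "set_integrable lborel {0..1} (\<lambda>t. G' t $ i $ j * T v i j t)"
    by (intro borel_integrable_atLeastAtMost' continuous_on_mult cont_G' cont_T v)
  then show ?thesis
    by (simp add: integrable_restrict_space set_integrable_def)
qed

lemma laplace_difference:
  assumes v: "v \<in> nonneg_orthant"
  shows "inverse (det (kernel v 1)) - inverse (det (kernel v 0))
    = (\<Sum>i\<in>UNIV. \<Sum>j\<in>UNIV. (\<integral>t. G' t $ i $ j * T v i j t \<partial>unit_interval))"
proof -
  let ?d = "\<lambda>t. \<Sum>i\<in>UNIV. \<Sum>j\<in>UNIV. G' t $ i $ j * T v i j t"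
  have "(\<integral>t. indicator {0..1} t *\<^sub>R ?d t \<partial>lborel)
    = inverse (det (kernel v 1)) - inverse (det (kernel v 0))"
  proof (rule integral_FTC_Icc)
    show "continuous_on {0..1} ?d"
      by (intro continuous_intros cont_G' cont_T v)
    show "((\<lambda>t. inverse (det (kernel v t))) has_vector_derivative ?d t) (at t within {0..1})"
      if "0 \<le> t" "t \<le> 1" for t
      using inverse_det_kernel_has_derivative[OF _ v, of t] that
      by (simp add: has_real_derivative_iff_has_vector_derivative)
  qed simp
  moreover have "(\<integral>t. indicator {0..1} t *\<^sub>R ?d t \<partial>lborel) = (\<integral>t. ?d t \<partial>unit_interval)"
    by (simp add: integral_restrict_space)
  moreover have "(\<integral>t. ?d t \<partial>unit_interval) = (\<Sum>i\<in>UNIV. \<Sum>j\<in>UNIV. (\<integral>t. G' t $ i $ j * T v i j t \<partial>unit_interval))"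
    by (simp add: Bochner_Integration.integral_sum Bochner_Integration.integrable_sum integrable_G'_T[OF v])
  ultimately show ?thesis by simp
qed

end

section \<open>Series representation of the derivative\<close>

lemma ennreal_series_finite:
  fixes a :: "nat \<Rightarrow> ennreal"
  assumes "ennreal x = (\<Sum>n. a n * ennreal (b n))" and b: "0 < b n"
  shows "a n < top"
proof -
  have "a n * ennreal (b n) \<le> (\<Sum>n. a n * ennreal (b n))"
    using sum_le_suminf[of "\<lambda>n. a n * ennreal (b n)" "{n}"] by simp
  then have "a n * ennreal (b n) < top"
    by (simp add: assms(1)[symmetric] le_less_trans[OF _ ennreal_less_top])
  then show ?thesis
    using b by (cases "a n = top") (auto simp: ennreal_top_mult less_top)
qed

lemma ennreal_series_sums:
  fixes a :: "nat \<Rightarrow> ennreal"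
  assumes eq: "ennreal x = (\<Sum>n. a n * ennreal (b n))" and a: "\<And>n. a n < top" and b: "\<And>n. 0 \<le> b n" and x: "0 \<le> x"
  shows "(\<lambda>n. enn2real (a n) * b n) sums x"
proof -
  have "a n * ennreal (b n) = ennreal (enn2real (a n) * b n)" for n
    using a[of n] b[of n] by (simp add: ennreal_mult ennreal_enn2real)
  then have "(\<lambda>n. ennreal (enn2real (a n) * b n)) sums ennreal x"
    using eq summable_sums[OF summableI, of "\<lambda>n. a n * ennreal (b n)"] by simp
  then show ?thesis
    using b x by (subst (asm) sums_ennreal) auto
qed

lemma mon_const: "mon k (\<chi> i. c) = c ^ multideg k"
  by (simp add: mon_def power_sum)

lemma mon_Suc: "mon (k(i := Suc (k i))) y = y $ i * mon k y"
  by (simp add: mon_upd mon_remove[of k y i])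

lemma prod_Suc_eq_mon: "(\<Prod>i\<in>UNIV. y $ i ^ Suc (k i)) = (\<Prod>i\<in>UNIV. y $ i) * mon k y"
  by (simp add: mon_def prod.distrib)

lemma second_diff_mon_off_diag:
  assumes "i \<noteq> j"
  shows "second_diff i j (\<lambda>k. c * mon k y) k = (1 - y $ i) * (1 - y $ j) * (c * mon k y)"
proof -
  have "mon (k(i := Suc (k i), j := Suc (k j))) y = y $ j * (y $ i * mon k y)"
    using mon_Suc[of "k(i := Suc (k i))" j y] mon_Suc[of k i y] assms by simp
  then show ?thesis
    using assms by (simp add: second_diff_def mon_Suc algebra_simps)
qed

text \<open>The lowered monomial is eliminated at the price of a division by y_i. What remains are
  the monomial itself and its multiple by k_i + 1, the terms of the series for W and for N_ii
  W.\<close>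

lemma second_diff_mon_diag:
  assumes "y $ i \<noteq> 0"
  shows "second_diff i i (\<lambda>k. c * mon k y) k
    = (1 - y $ i) / y $ i * ((1 - y $ i) * (c * (real (Suc (k i)) * mon k y)) - c * mon k y)"
proof -
  define m where "m = mon (k(i := k i - 1)) y"
  have m: "mon (k(i := k i - Suc 0)) y = m"
    by (simp add: m_def)
  \<comment> \<open>For \<open>k i = 0\<close> both sides vanish, whatever \<open>m\<close>
    is.\<close>
  have km: "real (k i) * mon k y = real (k i) * (y $ i * m)"
  proof (cases "k i")
    case (Suc p)
    have "mon k y = y $ i * m"
      using mon_Suc[of "k(i := p)" i y] Suc by (simp add: m_def fun_upd_idem)
    then show ?thesis by simp
  qed simp
  have "y $ i * second_diff i i (\<lambda>k. c * mon k y) k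
      = y $ i * real (Suc (k i)) * c * (y $ i * mon k y - mon k y) - c * (y $ i * (real (k i) * mon k y) - real (k i) * (y $ i * m))"
    by (simp add: second_diff_def mon_Suc m algebra_simps)
  also have "\<dots> = (1 - y $ i) * ((1 - y $ i) * (c * (real (Suc (k i)) * mon k y)) - c * mon k y)"
    unfolding km[symmetric] by (simp add: algebra_simps)
  finally show ?thesis
    using assms by (simp add: field_simps)
qed

context kernel_path
begin

lemma const_R_cube: "(\<chi> i. R) \<in> cube R"
  using R_gt_1 by (simp add: cube_def)

lemma cont_kernel_y: "continuous_on {0..1} (\<lambda>t. (pencil t y) $ i $ j)"
  by (simp add: cont_Q continuous_on_diff continuous_on_mult continuous_on_const)

lemma cont_N: "y \<in> cube R \<Longrightarrow> continuous_on {0..1} (\<lambda>t. N t y $ i $ j)"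
  by (rule continuous_on_left_inverse[OF cont_kernel_y N_inverse(2)]) auto

lemma cont_W: "y \<in> cube R \<Longrightarrow> continuous_on {0..1} (\<lambda>t. W t y)"
  unfolding W_def using det_pos
  by (intro continuous_on_inverse continuous_on_det cont_kernel_y) force

lemma cont_QN: "y \<in> cube R \<Longrightarrow> continuous_on {0..1} (\<lambda>t. (Q t ** N t y) $ i $ j)"
  unfolding matrix_matrix_mult_def by (simp add: continuous_on_sum continuous_on_mult cont_Q cont_N)

text \<open>Second differences of k |-> y^(k+1) multiply the terms of a series by factors in y. For
  \<open>i \<noteq> j\<close> the coefficients are those of (Q N)_ji W. For \<open>i = j\<close>
  they are those of W, and N_ii = 1 + y_i (Q N)_ii converts the combination of W and N_ii W. The
  bound \<open>C\<close> comes from continuity in \<open>t\<close> of the sum at y = (R, ...,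
  R).\<close>

lemma series_representation:
  obtains r :: "nat \<Rightarrow> real \<Rightarrow> real" and \<kappa> :: "nat \<Rightarrow> 'n \<Rightarrow> nat" and C :: real
  where "\<And>n. r n \<in> borel_measurable unit_interval" "\<And>n t. 0 \<le> r n t"
    "\<And>t. t \<in> {0..1} \<Longrightarrow> summable (\<lambda>n. r n t * growth R i j (\<kappa> n))"
    "\<And>t. t \<in> {0..1} \<Longrightarrow> (\<Sum>n. r n t * growth R i j (\<kappa> n)) \<le> C"
    "\<And>t y. t \<in> {0..1} \<Longrightarrow> y \<in> cube 1 \<Longrightarrow> (\<And>a. 0 < y $ a) \<Longrightarrow>
      (\<lambda>n. r n t * second_diff i j (\<lambda>k. \<Prod>a\<in>UNIV. y $ a ^ Suc (k a)) (\<kappa> n)) sums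
      (((1 - y $ i) * (1 - y $ j) * (Q t ** N t y) $ j $ i - (if i = j then 1 - y $ i else 0))
        * ((\<Prod>a\<in>UNIV. y $ a) * W t y))"
proof (cases "i = j")
  case False
  have "nonneg_series unit_interval (cube R) (\<lambda>t y. ennreal ((Q t ** N t y) $ j $ i * W t y))"
    by (rule nonneg_series_QN_W)
  then obtain a :: "nat \<Rightarrow> real \<Rightarrow> ennreal" and \<kappa> where a: "\<And>n. a n \<in> borel_measurable unit_interval"
    "\<And>t y. t \<in> space unit_interval \<Longrightarrow> y \<in> cube R \<Longrightarrow>
      ennreal ((Q t ** N t y) $ j $ i * W t y) = (\<Sum>n. a n t * ennreal (mon (\<kappa> n) y))"
    unfolding nonneg_series_def by blast
  have nn: "0 \<le> (Q t ** N t y) $ j $ i * W t y" if "t \<in> {0..1}" "y \<in> cube R" for t y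
    using QN_nonneg[of t y] W_pos[of t y] that by (simp add: less_imp_le)
  have fin: "a n t < top" if "t \<in> {0..1}" for t n
    using ennreal_series_finite[OF a(2)[OF _ const_R_cube]] that R_gt_1 by (simp add: mon_const)
  have sums: "(\<lambda>n. enn2real (a n t) * mon (\<kappa> n) y) sums ((Q t ** N t y) $ j $ i * W t y)"
    if "t \<in> {0..1}" "y \<in> cube R" for t y
    using ennreal_series_sums[OF a(2) fin mon_nonneg nn] that by simp
  obtain C where C: "\<And>t. t \<in> {0..1} \<Longrightarrow> (Q t ** N t (\<chi> i. R)) $ j $ i * W t (\<chi> i. R) \<le> C"
    by (rule bounded_above_unit_interval[of "\<lambda>t. (Q t ** N t (\<chi> i. R)) $ j $ i * W t (\<chi> i. R)"])
      (auto intro!: continuous_on_mult cont_QN cont_W const_R_cube)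
  have sR: "(\<lambda>n. enn2real (a n t) * growth R i j (\<kappa> n))
      sums ((Q t ** N t (\<chi> i. R)) $ j $ i * W t (\<chi> i. R))" if "t \<in> {0..1}" for t
    using sums[OF that const_R_cube] False by (simp add: mon_const diff_weight_def)
  show thesis
  proof (rule that[of "\<lambda>n t. enn2real (a n t)" \<kappa> C])
    show "(\<lambda>t. enn2real (a n t)) \<in> borel_measurable unit_interval" for n
      using a(1) by simp
    show "summable (\<lambda>n. enn2real (a n t) * growth R i j (\<kappa> n))"
      "(\<Sum>n. enn2real (a n t) * growth R i j (\<kappa> n)) \<le> C" if "t \<in> {0..1}" for t
      using sR[OF that] C[OF that] by (auto simp: sums_iff)
    fix t :: real and y :: "real ^ 'n" assume t: "t \<in> {0..1}" and y: "y \<in> cube 1"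
    let ?c = "\<Prod>a\<in>UNIV. y $ a"
    from sums_mult[OF sums[OF t cube_1_R[OF y]], of "(1 - y $ i) * (1 - y $ j) * ?c"]
    show "(\<lambda>n. enn2real (a n t) * second_diff i j (\<lambda>k. \<Prod>a\<in>UNIV. y $ a ^ Suc (k a)) (\<kappa> n)) sums
      (((1 - y $ i) * (1 - y $ j) * (Q t ** N t y) $ j $ i - (if i = j then 1 - y $ i else 0)) * (?c * W t y))"
      using False unfolding prod_Suc_eq_mon second_diff_mon_off_diag[OF False] by (simp add: mult_ac)
  qed simp
next
  case True
  obtain a :: "nat \<Rightarrow> real \<Rightarrow> ennreal" and \<kappa> where a: "\<And>n. a n \<in> borel_measurable unit_interval"
    "\<And>t y. t \<in> space unit_interval \<Longrightarrow> y \<in> cube R \<Longrightarrow> ennreal (W t y) = (\<Sum>n. a n t * ennreal (mon (\<kappa> n) y))"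
    "\<And>t y. t \<in> space unit_interval \<Longrightarrow> y \<in> cube R \<Longrightarrow>
      ennreal (N t y $ i $ i * W t y) = (\<Sum>n. a n t * ennreal (real (Suc (\<kappa> n i)) * mon (\<kappa> n) y))"
    by (rule nonneg_series_W_weighted[of i]) blast
  have nn: "0 \<le> W t y" "0 \<le> N t y $ i $ i * W t y" if "t \<in> {0..1}" "y \<in> cube R" for t y
    using N_nonneg[of t y] W_pos[of t y] that by (simp_all add: less_imp_le)
  have fin: "a n t < top" if "t \<in> {0..1}" for t n
    using ennreal_series_finite[OF a(2)[OF _ const_R_cube]] that R_gt_1 by (simp add: mon_const)
  have sums1: "(\<lambda>n. enn2real (a n t) * mon (\<kappa> n) y) sums (W t y)"
    if "t \<in> {0..1}" "y \<in> cube R" for t y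
    using ennreal_series_sums[OF a(2) fin mon_nonneg nn(1)] that by simp
  have sums2: "(\<lambda>n. enn2real (a n t) * (real (Suc (\<kappa> n i)) * mon (\<kappa> n) y)) sums (N t y $ i $ i * W t y)"
    if "t \<in> {0..1}" "y \<in> cube R" for t y
    by (rule ennreal_series_sums[OF a(3) fin _ nn(2)])
      (use that mon_nonneg[OF that(2)] in \<open>auto simp del: of_nat_Suc\<close>)
  obtain C where C: "\<And>t. t \<in> {0..1} \<Longrightarrow> N t (\<chi> i. R) $ i $ i * W t (\<chi> i. R) \<le> C"
    by (rule bounded_above_unit_interval[of "\<lambda>t. N t (\<chi> i. R) $ i $ i * W t (\<chi> i. R)"])
      (auto intro!: continuous_on_mult cont_N cont_W const_R_cube)
  have sR: "(\<lambda>n. enn2real (a n t) * growth R i j (\<kappa> n))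
      sums (N t (\<chi> i. R) $ i $ i * W t (\<chi> i. R))" if "t \<in> {0..1}" for t
    using sums2[OF that const_R_cube] True by (simp add: mon_const diff_weight_def)
  show thesis
  proof (rule that[of "\<lambda>n t. enn2real (a n t)" \<kappa> C])
    show "(\<lambda>t. enn2real (a n t)) \<in> borel_measurable unit_interval" for n
      using a(1) by simp
    show "summable (\<lambda>n. enn2real (a n t) * growth R i j (\<kappa> n))"
      "(\<Sum>n. enn2real (a n t) * growth R i j (\<kappa> n)) \<le> C" if "t \<in> {0..1}" for t
      using sR[OF that] C[OF that] by (auto simp: sums_iff)
    fix t :: real and y :: "real ^ 'n" assume t: "t \<in> {0..1}" and y: "y \<in> cube 1" and pos: "\<And>a. 0 < y $ a"
    let ?c = "\<Prod>a\<in>UNIV. y $ a"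
    have yi: "y $ i \<noteq> 0" using pos[of i] by simp
    have "(\<lambda>n. (1 - y $ i) / y $ i * ((1 - y $ i) * (?c * (enn2real (a n t) * (real (Suc (\<kappa> n i)) * mon (\<kappa> n) y)))
          - ?c * (enn2real (a n t) * mon (\<kappa> n) y))) sums
        ((1 - y $ i) / y $ i * ((1 - y $ i) * (?c * (N t y $ i $ i * W t y)) - ?c * W t y))"
      by (intro sums_mult sums_diff sums1[OF t cube_1_R[OF y]] sums2[OF t cube_1_R[OF y]])
    moreover have "(1 - y $ i) / y $ i * ((1 - y $ i) * (?c * (enn2real (a n t) * (real (Suc (\<kappa> n i)) * mon (\<kappa> n) y)))
          - ?c * (enn2real (a n t) * mon (\<kappa> n) y))
        = enn2real (a n t) * second_diff i j (\<lambda>k. \<Prod>a\<in>UNIV. y $ a ^ Suc (k a)) (\<kappa> n)" for n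
      unfolding prod_Suc_eq_mon True[symmetric] second_diff_mon_diag[OF yi]
      by (simp add: right_diff_distrib mult_ac del: of_nat_Suc)
    moreover have "(1 - y $ i) / y $ i * ((1 - y $ i) * (?c * (N t y $ i $ i * W t y)) - ?c * W t y)
        = ((1 - y $ i) * (1 - y $ j) * (Q t ** N t y) $ j $ i - (if i = j then 1 - y $ i else 0)) * (?c * W t y)"
    proof -
      define p where "p = (Q t ** N t y) $ i $ i"
      have "N t y $ i $ i = 1 + y $ i * p"
        using N_unfold[of t y i i] t cube_1_R[OF y] by (simp add: p_def mat_def)
      then have "(1 - y $ i) * (?c * (N t y $ i $ i * W t y)) - ?c * W t y
          = y $ i * (((1 - y $ i) * p - 1) * (?c * W t y))"
        by (simp only:) (simp add: algebra_simps)
      then have h1: "(1 - y $ i) / y $ i * ((1 - y $ i) * (?c * (N t y $ i $ i * W t y)) - ?c * W t y)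
          = (1 - y $ i) * (((1 - y $ i) * p - 1) * (?c * W t y))"
        using yi by simp
      have h2: "(1 - y $ i) * (((1 - y $ i) * p - 1) * (?c * W t y))
          = ((1 - y $ i) * (1 - y $ i) * p - (1 - y $ i)) * (?c * W t y)"
        by (simp add: algebra_simps)
      show ?thesis
        unfolding True[symmetric] p_def[symmetric] by (simp only: h1 h2 simp_thms if_True)
    qed
    ultimately show "(\<lambda>n. enn2real (a n t) * second_diff i j (\<lambda>k. \<Prod>a\<in>UNIV. y $ a ^ Suc (k a)) (\<kappa> n)) sums
      (((1 - y $ i) * (1 - y $ j) * (Q t ** N t y) $ j $ i - (if i = j then 1 - y $ i else 0)) * (?c * W t y))"
      by simp
  qed simp
qed

lemma gamma_mean_exp_ratio:
  "v \<in> nonneg_orthant \<Longrightarrow> gamma_mean s (\<lambda>l. exp (- (v \<bullet> l))) = (\<lambda>k. \<Prod>a\<in>UNIV. ratio v $ a ^ Suc (k a))"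
  by (rule ext) (simp add: gamma_mean_exp[OF s_pos] ratio_def)

text \<open>The constant sign is factored out as \<open>\<sigma>\<close>, which leaves coefficients
  that stay nonnegative under the integral. The \<open>\<rho> n\<close> do not depend on
  \<open>v\<close>, so that a single functional represents the integral for all \<open>v\<close> at
  once.\<close>

lemma integral_G'_T_series:
  assumes sgn: "\<And>t. t \<in> {0..1} \<Longrightarrow> G' t $ i $ j = \<sigma> * \<bar>G' t $ i $ j\<bar>"
  obtains \<rho> :: "nat \<Rightarrow> real" and \<kappa> :: "nat \<Rightarrow> 'n \<Rightarrow> nat"
  where "\<And>n. 0 \<le> \<rho> n" "summable (\<lambda>n. \<rho> n * growth R i j (\<kappa> n))"
    "\<And>v. v \<in> nonneg_orthant \<Longrightarrow> (\<integral>t. G' t $ i $ j * T v i j t \<partial>unit_interval)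
      = \<sigma> * (\<Sum>n. \<rho> n * second_diff i j (gamma_mean s (\<lambda>l. exp (- (v \<bullet> l)))) (\<kappa> n))"
proof -
  obtain r :: "nat \<Rightarrow> real \<Rightarrow> real" and \<kappa> :: "nat \<Rightarrow> 'n \<Rightarrow> nat" and C :: real
    where r: "\<And>n. r n \<in> borel_measurable unit_interval" "\<And>n t. 0 \<le> r n t"
    "\<And>t. t \<in> {0..1} \<Longrightarrow> summable (\<lambda>n. r n t * growth R i j (\<kappa> n))"
    "\<And>t. t \<in> {0..1} \<Longrightarrow> (\<Sum>n. r n t * growth R i j (\<kappa> n)) \<le> C"
    "\<And>t y. t \<in> {0..1} \<Longrightarrow> y \<in> cube 1 \<Longrightarrow> (\<And>a. 0 < y $ a) \<Longrightarrow>
      (\<lambda>n. r n t * second_diff i j (\<lambda>k. \<Prod>a\<in>UNIV. y $ a ^ Suc (k a)) (\<kappa> n)) sums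
      (((1 - y $ i) * (1 - y $ j) * (Q t ** N t y) $ j $ i - (if i = j then 1 - y $ i else 0))
        * ((\<Prod>a\<in>UNIV. y $ a) * W t y))"
    by (rule series_representation[of i j]) blast
  let ?w = "\<lambda>n. growth R i j (\<kappa> n)"
  \<comment> \<open>Collects the factors free of \<open>v\<close>: \<open>s\<close> from
    \<open>T\<close>, \<open>\<theta>\<close> from the inverse determinant, and the absolute value
    of the entry of \<open>G'\<close>.\<close>
  define g where "g t = s * \<bar>G' t $ i $ j\<bar> * \<theta> t" for t
  have cg: "continuous_on {0..1} g"
    unfolding g_def[abs_def] by (intro continuous_intros cont_G' cont_\<theta>)
  have g0: "0 \<le> g t" if "t \<in> {0..1}" for t
    using \<theta>_pos[OF that] s_pos by (simp add: g_def)
  obtain K where K: "\<And>t. t \<in> {0..1} \<Longrightarrow> g t \<le> K"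
    by (rule bounded_above_unit_interval[OF cg]) blast
  define h where "h n t = g t * r n t" for n t
  have w1: "1 \<le> ?w n" for n
  proof -
    have "1 * 1 \<le> ?w n"
      using R_gt_1 by (intro mult_mono one_le_power) (auto simp: diff_weight_def)
    then show ?thesis by simp
  qed
  have w0: "0 \<le> ?w n" for n using w1[of n] by linarith
  have hm: "h n \<in> borel_measurable unit_interval" for n
    unfolding h_def[abs_def] using measurable_unit_interval[OF cg] r(1) by simp
  have h0: "0 \<le> h n t" if "t \<in> space unit_interval" for n t
    using g0[of t] r(2) that by (simp add: h_def)
  have hs: "summable (\<lambda>n. h n t * ?w n)" if "t \<in> space unit_interval" for t
    using summable_mult[OF r(3), of t "g t"] that by (simp add: h_def mult.assoc)
  have hK: "(\<Sum>n. h n t * ?w n) \<le> K * C" if "t \<in> space unit_interval" for t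
  proof -
    have t: "t \<in> {0..1}" using that by simp
    have "(\<Sum>n. h n t * ?w n) = g t * (\<Sum>n. r n t * ?w n)"
      using suminf_mult[OF r(3)[OF t], of "g t"] by (simp add: h_def mult.assoc)
    also have "\<dots> \<le> K * C"
      using K[OF t] g0[OF t] r(4)[OF t] suminf_nonneg[OF r(3)[OF t]] r(2) w0
      by (intro mult_mono) auto
    finally show ?thesis .
  qed
  show thesis
  proof (rule that[of "\<lambda>n. \<integral>t. h n t \<partial>unit_interval" \<kappa>])
    show "0 \<le> (\<integral>t. h n t \<partial>unit_interval)" for n
      using h0 by (rule Bochner_Integration.integral_nonneg)
    show "summable (\<lambda>n. (\<integral>t. h n t \<partial>unit_interval) * ?w n)"
      by (rule integral_weighted_series(1)[OF finite_measure_unit_interval hm])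
        (erule h0 | rule w1 | erule hs | erule hK)+
    fix v :: "real ^ 'n" assume v: "v \<in> nonneg_orthant"
    define F where "F k = (\<Prod>a\<in>UNIV. ratio v $ a ^ Suc (k a))" for k :: "'n \<Rightarrow> nat"
    have F: "\<bar>F k\<bar> \<le> 1 * R ^ multideg k" for k
    proof -
      have "0 \<le> F k" "F k \<le> 1"
        using ratio(1,2)[OF v] unfolding F_def
        by (auto intro!: prod_nonneg prod_le_1 power_le_one simp: less_imp_le simp del: power_Suc)
      moreover have "1 \<le> R ^ multideg k"
        using R_gt_1 by (simp add: one_le_power)
      ultimately show ?thesis by simp
    qed
    have b: "\<bar>second_diff i j F (\<kappa> n)\<bar> \<le> (4 * 1 * R ^ 2) * ?w n" for n
      using abs_second_diff_le[of F 1 R, OF F] R_gt_1 by simp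
    have series: "(\<integral>t. (\<Sum>n. h n t * second_diff i j F (\<kappa> n)) \<partial>unit_interval)
        = (\<Sum>n. (\<integral>t. h n t \<partial>unit_interval) * second_diff i j F (\<kappa> n))"
      by (rule integral_weighted_series(2)[OF finite_measure_unit_interval hm])
        (erule h0 | rule w1 | erule hs | erule hK | rule b)+
    have "G' t $ i $ j * T v i j t = \<sigma> * (\<Sum>n. h n t * second_diff i j F (\<kappa> n))" if t: "t \<in> {0..1}" for t
    proof -
      let ?y = "ratio v"
      have S: "(\<lambda>n. r n t * second_diff i j F (\<kappa> n)) sums
          (((1 - ?y $ i) * (1 - ?y $ j) * (Q t ** N t ?y) $ j $ i - (if i = j then 1 - ?y $ i else 0))
        * ((\<Prod>a\<in>UNIV. ?y $ a) * W t ?y))"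
        unfolding F_def[abs_def] by (rule r(5)[OF t ratio_cube[OF v] ratio(1)[OF v]])
      have "T v i j t = s * \<theta> t * (\<Sum>n. r n t * second_diff i j F (\<kappa> n))"
        unfolding T_def inverse_det_kernel[OF t v] sums_unique[OF S, symmetric] by (simp add: mult_ac)
      then have "G' t $ i $ j * T v i j t = \<sigma> * (g t * (\<Sum>n. r n t * second_diff i j F (\<kappa> n)))"
        by (subst sgn[OF t]) (simp add: g_def mult_ac)
      also have "g t * (\<Sum>n. r n t * second_diff i j F (\<kappa> n)) = (\<Sum>n. h n t * second_diff i j F (\<kappa> n))"
        using suminf_mult[OF sums_summable[OF S], of "g t"] by (simp add: h_def mult.assoc)
      finally show ?thesis .
    qed
    then have "(\<integral>t. G' t $ i $ j * T v i j t \<partial>unit_interval)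
        = (\<integral>t. \<sigma> * (\<Sum>n. h n t * second_diff i j F (\<kappa> n)) \<partial>unit_interval)"
      by (intro Bochner_Integration.integral_cong) auto
    also have "\<dots> = \<sigma> * (\<Sum>n. (\<integral>t. h n t \<partial>unit_interval) * second_diff i j F (\<kappa> n))"
      by (simp add: series)
    finally show "(\<integral>t. G' t $ i $ j * T v i j t \<partial>unit_interval)
      = \<sigma> * (\<Sum>n. (\<integral>t. h n t \<partial>unit_interval) * second_diff i j (gamma_mean s (\<lambda>l. exp (- (v \<bullet> l)))) (\<kappa> n))"
      unfolding gamma_mean_exp_ratio[OF v] F_def[abs_def] .
  qed
qed

text \<open>The mixing weights are the coefficients of \<open>W\<close> times
  \<open>\<theta> t\<close>, and convergence of \<open>W\<close> at y = (R, ..., R) is the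
  summability condition of \<open>integrable_exp_if_gamma_mixture\<close>.\<close>

lemma permanental_exp_moment:
  assumes t: "t \<in> {0..1}" and X: "one_permanental_vector M (G t) X"
  shows "integrable M (\<lambda>\<omega>. exp (s * (1 - 1 / R) * coord_sum (X \<omega>)))"
proof -
  obtain a :: "nat \<Rightarrow> real \<Rightarrow> ennreal" and \<kappa> where a:
    "\<And>t y. t \<in> space unit_interval \<Longrightarrow> y \<in> cube R \<Longrightarrow> ennreal (W t y) = (\<Sum>n. a n t * ennreal (mon (\<kappa> n) y))"
    using nonneg_series_W unfolding nonneg_series_def by blast
  have W0: "0 \<le> W t y" if "y \<in> cube R" for y
    using W_pos[of t y] that t by (simp add: less_imp_le)
  have fin: "a n t < top" for n
    using ennreal_series_finite[OF a[OF _ const_R_cube]] t R_gt_1 by (simp add: mon_const)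
  have sums: "(\<lambda>n. enn2real (a n t) * mon (\<kappa> n) y) sums (W t y)" if "y \<in> cube R" for y
    using ennreal_series_sums[OF a fin mon_nonneg W0] that t by simp
  show ?thesis
  proof (rule integrable_exp_if_gamma_mixture[where r = "\<lambda>n. \<theta> t * enn2real (a n t)" and \<kappa> = \<kappa>])
    show "prob_space M" "X \<in> borel_measurable M" "\<And>\<omega>. \<omega> \<in> space M \<Longrightarrow> X \<omega> \<in> nonneg_orthant"
      using X by (auto simp: one_permanental_vector_def)
    show "0 \<le> \<theta> t * enn2real (a n t)" for n
      using \<theta>_pos[OF t] by simp
    show "summable (\<lambda>n. \<theta> t * enn2real (a n t) * R ^ multideg (\<kappa> n))"
      using summable_mult[OF sums_summable[OF sums[OF const_R_cube]], of "\<theta> t"] by (simp add: mon_const mult.assoc)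
    fix v :: "real ^ 'n" assume v: "v \<in> nonneg_orthant"
    have "(\<lambda>n. \<theta> t * ((\<Prod>i\<in>UNIV. ratio v $ i) * (enn2real (a n t) * mon (\<kappa> n) (ratio v)))) sums
        (\<theta> t * ((\<Prod>i\<in>UNIV. ratio v $ i) * W t (ratio v)))"
      by (intro sums_mult sums cube_1_R ratio_cube v)
    then have "(\<Sum>n. \<theta> t * enn2real (a n t) * gamma_mean s (\<lambda>l. exp (- (v \<bullet> l))) (\<kappa> n))
        = \<theta> t * ((\<Prod>i\<in>UNIV. ratio v $ i) * W t (ratio v))"
      unfolding gamma_mean_exp_ratio[OF v] prod_Suc_eq_mon by (simp add: sums_iff mult_ac)
    then show "(\<integral>\<omega>. exp (- (v \<bullet> X \<omega>)) \<partial>M)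
        = (\<Sum>n. \<theta> t * enn2real (a n t) * gamma_mean s (\<lambda>l. exp (- (v \<bullet> l))) (\<kappa> n))"
      using X v by (simp add: one_permanental_vector_def inverse_det_kernel[OF t v, symmetric])
  qed (use s_pos R_gt_1 in auto)
qed

end

section \<open>Comparison of expectations\<close>

text \<open>The reciprocal of the determinant is the mean of a positive random variable.\<close>

lemma det_kernel_pos_if_permanental:
  assumes X: "one_permanental_vector M G X" and v: "v \<in> nonneg_orthant"
  shows "0 < det (mat 1 + diag_matrix v ** G)"
proof -
  interpret prob_space M
    using X by (simp add: one_permanental_vector_def)
  have b: "X \<in> borel_measurable M" "\<And>w. w \<in> space M \<Longrightarrow> X w \<in> nonneg_orthant"
    using X by (auto simp: one_permanental_vector_def)
  have "integrable M (\<lambda>w. exp (- (v \<bullet> X w)))"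
    using integrable_wbounded(1)[OF b _ wbounded_exp[OF v order.refl]] by simp
  then have "0 < (\<integral>w. exp (- (v \<bullet> X w)) \<partial>M)"
    by (rule expectation_greater) simp
  then show ?thesis
    using X v by (simp add: one_permanental_vector_def)
qed

context kernel_path
begin

text \<open>\<open>\<epsilon>\<close> lies strictly below the weight of the functionals, so that
  \<open>f\<close> satisfies the decay condition of \<open>wfunctional_eq_0\<close>. The factors
  \<open>\<sigma> i j\<close> stay outside the nonnegative coefficients, which makes the resulting
  series nonnegative term by term.\<close>

lemma expectation_mono:
  fixes \<sigma> :: "'n \<Rightarrow> 'n \<Rightarrow> real"
  assumes X0: "one_permanental_vector M0 (G 0) X0" and X1: "one_permanental_vector M1 (G 1) X1"
    and sgn: "\<And>i j \<alpha>. \<alpha> \<in> {0..1} \<Longrightarrow> G' \<alpha> $ i $ j = \<sigma> i j * \<bar>G' \<alpha> $ i $ j\<bar>"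
    and f: "wbounded \<epsilon> c f" "\<epsilon> < s * (1 - 1 / R)"
    and nn: "\<And>i j k. 0 \<le> \<sigma> i j * second_diff i j (gamma_mean s f) k"
  shows "(\<integral>w. f (X0 w) \<partial>M0) \<le> (\<integral>w. f (X1 w) \<partial>M1)"
proof -
  let ?\<epsilon> = "s * (1 - 1 / R)"
  have \<epsilon>: "0 \<le> ?\<epsilon>" using s_pos R_gt_1 by simp
  define P where "P i j \<rho> \<kappa> \<longleftrightarrow> (\<forall>n::nat. 0 \<le> \<rho> n) \<and>
      summable (\<lambda>n. \<rho> n * growth R i j (\<kappa> n)) \<and>
      (\<forall>v\<in>nonneg_orthant. (\<integral>\<alpha>. G' \<alpha> $ i $ j * T v i j \<alpha> \<partial>unit_interval)
        = \<sigma> i j * (\<Sum>n. \<rho> n * second_diff i j (gamma_mean s (\<lambda>l. exp (- (v \<bullet> l)))) (\<kappa> n)))" for i j \<rho> \<kappa>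
  have "\<exists>\<rho> \<kappa>. P i j \<rho> \<kappa>" for i j
    by (rule integral_G'_T_series[of i j "\<sigma> i j", OF sgn]) (auto simp: P_def)
  then obtain \<rho> \<kappa> where P: "\<And>i j. P i j (\<rho> i j) (\<kappa> i j)"
    by metis
  have \<rho>: "\<And>i j n. 0 \<le> \<rho> i j n"
      "\<And>i j. summable (\<lambda>n. \<rho> i j n * growth R i j (\<kappa> i j n))"
      "\<And>i j v. v \<in> nonneg_orthant \<Longrightarrow> (\<integral>\<alpha>. G' \<alpha> $ i $ j * T v i j \<alpha> \<partial>unit_interval)
      = \<sigma> i j * (\<Sum>n. \<rho> i j n * second_diff i j (gamma_mean s (\<lambda>l. exp (- (v \<bullet> l)))) (\<kappa> i j n))"
    using P unfolding P_def by blast+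
  define D where "D i j f = (\<Sum>n. \<rho> i j n * second_diff i j (gamma_mean s f) (\<kappa> i j n))" for i j f
  \<comment> \<open>The defect of the series representation of the difference of the expectations;
    \<open>laplace_difference\<close> makes it vanish on exponentials.\<close>
  define L where "L f = ((\<integral>w. f (X1 w) \<partial>M1) - (\<integral>w. f (X0 w) \<partial>M0)) - (\<Sum>i\<in>UNIV. \<Sum>j\<in>UNIV. \<sigma> i j * D i j f)" for f
  have D: "wfunctional ?\<epsilon> (D i j)" for i j
    unfolding D_def[abs_def] using R_gt_1
    by (intro wfunctional_second_diff_series s_pos \<rho>(1,2)) simp
  have E: "wfunctional ?\<epsilon> (\<lambda>f. \<integral>w. f (X w) \<partial>M)" if "one_permanental_vector M (G \<alpha>) X" "\<alpha> \<in> {0..1}" for M and X :: "'x \<Rightarrow> real ^ 'n" and \<alpha>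
    by (rule wfunctional_expectation[OF _ _ permanental_exp_moment[OF that(2,1)]])
      (use that(1) in \<open>auto simp: one_permanental_vector_def\<close>)
  have "wfunctional ?\<epsilon> L"
    unfolding L_def[abs_def]
    by (intro wfunctional_diff wfunctional_sum wfunctional_cmult D E[OF X0] E[OF X1] finite) auto
  moreover have "L (\<lambda>l. exp (- (v \<bullet> l))) = 0" if v: "v \<in> nonneg_orthant" for v
  proof -
    have "(\<Sum>i\<in>UNIV. \<Sum>j\<in>UNIV. \<sigma> i j * D i j (\<lambda>l. exp (- (v \<bullet> l))))
        = inverse (det (kernel v 1)) - inverse (det (kernel v 0))"
      unfolding laplace_difference[OF v] \<rho>(3)[OF v] D_def ..
    then show ?thesis
      using X0 X1 v by (simp add: L_def one_permanental_vector_def)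
  qed
  moreover have "wbounded ?\<epsilon> c f"
    using wbounded_mono[OF f(1)] f(2) by simp
  ultimately have "L f = 0"
    using wfunctional_eq_0[of ?\<epsilon> L c f] \<epsilon> wbounded_decay[OF f] by blast
  moreover have "0 \<le> (\<Sum>i\<in>UNIV. \<Sum>j\<in>UNIV. \<sigma> i j * D i j f)"
  proof (intro sum_nonneg)
    fix i j
    have "summable (\<lambda>n. \<rho> i j n * second_diff i j (gamma_mean s f) (\<kappa> i j n))"
    proof (rule summable_comparison_test')
      let ?C = "4 * (c * R ^ CARD('n)) * R ^ 2"
      show "summable (\<lambda>n. ?C * (\<rho> i j n * growth R i j (\<kappa> i j n)))"
        by (intro summable_mult \<rho>(2))
      fix n
      have c: "0 \<le> c * R ^ CARD('n)"
        using wbounded_nonneg[OF f(1)] R_gt_1 by simp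
      have "\<bar>second_diff i j (gamma_mean s f) (\<kappa> i j n)\<bar> \<le> ?C * growth R i j (\<kappa> i j n)"
        using abs_second_diff_le[OF abs_gamma_mean_le[OF s_pos _ \<open>wbounded ?\<epsilon> c f\<close>] _ c] R_gt_1 by simp
      from mult_left_mono[OF this \<rho>(1)[of i j n]]
      show "norm (\<rho> i j n * second_diff i j (gamma_mean s f) (\<kappa> i j n))
          \<le> ?C * (\<rho> i j n * growth R i j (\<kappa> i j n))"
        using \<rho>(1)[of i j n] by (simp add: abs_mult mult_ac)
    qed
    then have "\<sigma> i j * D i j f = (\<Sum>n. \<sigma> i j * (\<rho> i j n * second_diff i j (gamma_mean s f) (\<kappa> i j n)))"
        and sm: "summable (\<lambda>n. \<sigma> i j * (\<rho> i j n * second_diff i j (gamma_mean s f) (\<kappa> i j n)))"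
      unfolding D_def by (auto simp: suminf_mult intro: summable_mult)
    then show "0 \<le> \<sigma> i j * D i j f"
      using suminf_nonneg[OF sm] mult_nonneg_nonneg[OF \<rho>(1) nn] by (simp add: mult.left_commute)
  qed
  ultimately show ?thesis
    by (simp add: L_def)
qed

end

theorem lemma4p1:
  fixes G G' :: "real \<Rightarrow> real ^ 'n ^ 'n"
    and M :: "real \<Rightarrow> 'w measure"
    and X :: "real \<Rightarrow> 'w \<Rightarrow> real ^ 'n"
    and f :: "real ^ 'n \<Rightarrow> real"
  assumes permanental: "\<And>\<alpha>. \<alpha> \<in> {0..1} \<Longrightarrow> one_permanental_vector (M \<alpha>) (G \<alpha>) (X \<alpha>)"
    and inv_M: "\<And>\<alpha>. \<alpha> \<in> {0..1} \<Longrightarrow> inverse_M_matrix (G \<alpha>)"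
    and pos_def: "\<And>\<alpha>. \<alpha> \<in> {0..1} \<Longrightarrow> pos_definite (sym_part (G \<alpha>))"
    and deriv_G: "\<And>i j \<alpha>. \<alpha> \<in> {0..1} \<Longrightarrow>
          ((\<lambda>a. G a $ i $ j) has_real_derivative G' \<alpha> $ i $ j) (at \<alpha> within {0..1})"
    and cont_G': "\<And>i j. continuous_on {0..1} (\<lambda>\<alpha>. G' \<alpha> $ i $ j)"
    and const_sign: "\<And>i j. (\<forall>\<alpha>\<in>{0..1}. 0 \<le> G' \<alpha> $ i $ j) \<or> (\<forall>\<alpha>\<in>{0..1}. G' \<alpha> $ i $ j \<le> 0)"
    and growth: "subexponential_growth_order2 f"
    and diagonal: "\<And>i.
          (\<forall>\<alpha>\<in>{0..1}. 0 \<le> G' \<alpha> $ i $ i) \<and>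
          (\<forall>l\<in>nonneg_orthant. 0 \<le> partial_derivative i f l + l $ i * partial_derivative2 i i f l)
        \<or> (\<forall>\<alpha>\<in>{0..1}. G' \<alpha> $ i $ i \<le> 0) \<and>
          (\<forall>l\<in>nonneg_orthant. partial_derivative i f l + l $ i * partial_derivative2 i i f l \<le> 0)"
    and off_diagonal: "\<And>i j. i \<noteq> j \<Longrightarrow>
          (\<forall>\<alpha>\<in>{0..1}. 0 \<le> G' \<alpha> $ i $ j) \<and>
          (\<forall>l\<in>nonneg_orthant. 0 \<le> partial_derivative2 i j f l)
        \<or> (\<forall>\<alpha>\<in>{0..1}. G' \<alpha> $ i $ j \<le> 0) \<and>
          (\<forall>l\<in>nonneg_orthant. partial_derivative2 i j f l \<le> 0)"
  shows "integrable (M 0) (\<lambda>\<omega>. f (X 0 \<omega>)) \<and> integrable (M 1) (\<lambda>\<omega>. f (X 1 \<omega>)) \<and>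
         prob_space.expectation (M 1) (\<lambda>\<omega>. f (X 1 \<omega>)) \<ge> prob_space.expectation (M 0) (\<lambda>\<omega>. f (X 0 \<omega>))"
proof -
  have cont_G: "continuous_on {0..1} (\<lambda>\<alpha>. G \<alpha> $ i $ j)" for i j
    using deriv_G by (rule DERIV_continuous_on)
  obtain A s R where AsR: "0 < s" "1 < R"
    "\<And>\<alpha>. \<alpha> \<in> {0..1} \<Longrightarrow> A \<alpha> ** G \<alpha> = mat 1"
    "\<And>\<alpha> i j. \<alpha> \<in> {0..1} \<Longrightarrow> 0 \<le> (mat 1 - (1 / s) *\<^sub>R A \<alpha>) $ i $ j"
    "\<And>\<alpha> y i j. \<alpha> \<in> {0..1} \<Longrightarrow> y \<in> cube R \<Longrightarrow>
      summable (\<lambda>p. matpow (diag_matrix y ** (mat 1 - (1 / s) *\<^sub>R A \<alpha>)) p $ i $ j)"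
    by (rule uniform_contraction[OF cont_G inv_M pos_def]) blast+
  interpret kernel_path G G' A s R
    by standard (fact AsR deriv_G cont_G' | rule det_kernel_pos_if_permanental[OF permanental]; assumption)+
  define \<epsilon> where "\<epsilon> = s * (1 - 1 / R)"
  have \<epsilon>: "0 < \<epsilon>" "\<epsilon> < s"
    using AsR(1,2) by (auto simp: \<epsilon>_def field_simps)
  have f1: "partially_differentiable i f" and f2: "partially_differentiable i (partial_derivative j f)" for i j
    using growth by (auto simp: subexponential_growth_order2_def)
  \<comment> \<open>Both conditions enter the choice: if an entry of \<open>G'\<close> vanishes
    identically, either sign fits it and the sign for \<open>f\<close> decides.\<close>
  define \<sigma> :: "'n \<Rightarrow> 'n \<Rightarrow> real" where "\<sigma> i j = (if (\<forall>\<alpha>\<in>{0..1}. 0 \<le> G' \<alpha> $ i $ j) \<and>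
      (\<forall>l\<in>nonneg_orthant. 0 \<le> (if i = j then partial_derivative i f l + l $ i * partial_derivative2 i i f l
         else partial_derivative2 i j f l)) then 1 else - 1)" for i j
  have \<sigma>: "\<sigma> i j = 1 \<or> \<sigma> i j = - 1" for i j
    by (simp add: \<sigma>_def)
  have sgn: "G' \<alpha> $ i $ j = \<sigma> i j * \<bar>G' \<alpha> $ i $ j\<bar>" if "\<alpha> \<in> {0..1}" for i j \<alpha>
    using diagonal[of i] off_diagonal[of i j] that by (cases "i = j") (auto simp: \<sigma>_def)
  have diag: "0 \<le> \<sigma> i i * (partial_derivative i f l + l $ i * partial_derivative2 i i f l)" if "l \<in> nonneg_orthant" for i l
    using diagonal[of i] that by (auto simp: \<sigma>_def)
  have off: "0 \<le> \<sigma> i j * partial_derivative2 i j f l" if "i \<noteq> j" "l \<in> nonneg_orthant" for i j l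
    using off_diagonal[OF that(1)] that by (auto simp: \<sigma>_def)
  have "continuous_on nonneg_orthant f"
  proof (rule continuous_on_orthant_if_monotone_slices)
    show "continuous_on {0..} (\<lambda>t. f (update l i t))" if "l \<in> nonneg_orthant" for l i
      by (rule DERIV_continuous_on, rule slice_has_derivative[OF f1 that]) simp
    fix i
    have "\<sigma> i i * f (update l i x) \<le> \<sigma> i i * f (update l i y)" if "l \<in> nonneg_orthant" "0 \<le> x" "x \<le> y" for l x y
      by (rule diag_monotone(2)[OF f1 f2 diag that])
    then show "(\<forall>l\<in>nonneg_orthant. \<forall>x y. 0 \<le> x \<longrightarrow> x \<le> y \<longrightarrow> f (update l i x) \<le> f (update l i y)) \<or>
          (\<forall>l\<in>nonneg_orthant. \<forall>x y. 0 \<le> x \<longrightarrow> x \<le> y \<longrightarrow> f (update l i y) \<le> f (update l i x))"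
      using \<sigma>[of i i] by auto
  qed
  \<comment> \<open>Half the weight of the functionals, to leave the gap that
    \<open>wbounded_decay\<close> needs.\<close>
  then obtain c where f: "wbounded (\<epsilon> / 2) c f"
    using wbounded_if_subexponential[of f "\<epsilon> / 2"] growth \<epsilon> by (auto simp: subexponential_growth_order2_def)
  have f\<epsilon>: "wbounded \<epsilon> c f"
    using wbounded_mono[OF f] \<epsilon> by simp
  have int: "integrable (M \<alpha>) (\<lambda>\<omega>. f (X \<alpha> \<omega>))" if "\<alpha> \<in> {0..1}" for \<alpha>
    using integrable_wbounded(1)[OF _ _ permanental_exp_moment[OF that permanental[OF that], folded \<epsilon>_def] f\<epsilon>]
      permanental[OF that] by (auto simp: one_permanental_vector_def)
  have nn: "0 \<le> \<sigma> i j * second_diff i j (gamma_mean s f) k" for i j k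
  proof -
    note w = wbounded_cmult[OF f\<epsilon>, of "\<sigma> i j"]
    have "gamma_mean s (\<lambda>l. \<sigma> i j * f l) = (\<lambda>k. \<sigma> i j * gamma_mean s f k)"
      using gamma_mean_cmult by blast
    then have "\<sigma> i j * second_diff i j (gamma_mean s f) k = second_diff i j (gamma_mean s (\<lambda>l. \<sigma> i j * f l)) k"
      by (simp add: second_diff_cmult)
    also have "\<dots> \<ge> 0"
    proof (cases "i = j")
      case True
      show ?thesis
        unfolding True[symmetric]
      proof (rule second_diff_diag_nonneg[OF AsR(1) \<epsilon>(2) w[unfolded True[symmetric]],
            where D = "\<lambda>l. \<sigma> i i * partial_derivative i f l"])
        fix l :: "real ^ 'n" assume l: "l \<in> nonneg_orthant"
        show "((\<lambda>t. \<sigma> i i * f (update l i t)) has_real_derivative \<sigma> i i * partial_derivative i f (update l i t)) (at t)"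
          if "0 < t" for t
          using slice_has_derivative[OF f1 l, of t i] that at_within_interior[of t "{0..}"]
          by (intro DERIV_cmult) (simp add: interior_Ici)
        show "x * (\<sigma> i i * partial_derivative i f (update l i x)) \<le> y * (\<sigma> i i * partial_derivative i f (update l i y))"
          if "0 \<le> x" "x \<le> y" for x y
          by (rule diag_monotone(1)[OF f1 f2 diag l that])
      qed
    next
      case False
      show ?thesis
        by (rule second_diff_off_diag_nonneg[OF AsR(1) \<epsilon>(2) less_imp_le[OF \<epsilon>(1)] w False])
          (rule off_diag_supermodular[OF f1 f2 off[OF False] _ _ _ _ _ False])
    qed
    finally show ?thesis .
  qed
  have "\<epsilon> / 2 < s * (1 - 1 / R)"
    using \<epsilon>(1) unfolding \<epsilon>_def[symmetric] by simp
  then have "(\<integral>\<omega>. f (X 0 \<omega>) \<partial>M 0) \<le> (\<integral>\<omega>. f (X 1 \<omega>) \<partial>M 1)"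
    by (intro expectation_mono[OF permanental permanental sgn f _ nn]) auto
  then show ?thesis
    using int by auto
qed

end
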